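(* For a fixed polynomial $P(z)=\prod_{k=1}^n(z-p_k)^{\alpha_k}$ (distinct $p_k$) of degree $p$ and each integer $q\ge p$, the set $\mathcal L_q(P)$ (the Laine variety, defined in the context) carries a natural structure of a complex affine algebraic variety of dimension $q-p+1$.
   Context: Definition. $\mathcal L_q(P)$ is the set of all polynomials $Q$ of degree $q$ such that $$\frac{Q(z)}{P(z)}=S(z)+\sum_{k=1}^n\frac{D_k}{z-p_k},$$ where $S$ is a polynomial of degree $q-p$ and $D_k\in\mathbb C$, and such that the function $$2R=\left(\frac{P'}{P}\right)'-\frac12\left(\frac{P'}{P}\right)^2+\frac{2Q}{P}$$ satisfies the Laine condition at all its poles. For $P\equiv1$, $\mathcal L_q(1)=\{Q:\deg Q=q\}$. The natural structure: $Q$ is uniquely determined by $(S,D)$, $D=(D_1,\dots,D_n)$, and $\mathcal L_q(P)$ is regarded as the corresponding algebraic subset of $\{S\in\mathbb C[z]:\deg S=q-p\}\times\mathbb C^n$ in these coordinates (the variety need not be irreducible). Laine condition: "$2R$ satisfies the Laine condition" means that at every pole $z_0$ of $R$ the Laurent expansion has the form $R(z)=\frac{1-m^2}{4(z-z_0)^2}+\frac{b_1}{z-z_0}+b_2+b_3(z-z_0)+\cdots$ with an integer $m=m(z_0)\ge2$, and $\mathcal D_m(z_0)=0$, where $\mathcal D_m(z_0)$ is the determinant of the $m\times m$ matrix whose $j$-th row ($1\le j\le m$) has: for columns $i=1,\dots,m-1$, entry $b_{j-i}$ if $i<j$, entry $j^2-jm$ if $i=j$, and $0$ if $i>j$; and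 in the last column $i=m$ the entry $b_j$. *)

theory Defs
  imports
    "HOL-Complex_Analysis.Complex_Analysis"
    "Jordan_Normal_Form.Determinant"
    "HOL-Library.FuncSet"
begin

section \<open>Affine algebraic sets over the complex numbers\<close>

definition affine_space :: "'i set \<Rightarrow> ('i \<Rightarrow> complex) set" where
  "affine_space I = I \<rightarrow>\<^sub>E UNIV"

inductive_set polynomial_functions :: "'i set \<Rightarrow> (('i \<Rightarrow> complex) \<Rightarrow> complex) set"
  for I :: "'i set" where
  const: "(\<lambda>x. c) \<in> polynomial_functions I"
| coordinate: "i \<in> I \<Longrightarrow> (\<lambda>x. x i) \<in> polynomial_functions I"
| add: "f \<in> polynomial_functions I \<Longrightarrow> g \<in> polynomial_functions I
    \<Longrightarrow> (\<lambda>x. f x + g x) \<in> polynomial_functions I"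
| mult: "f \<in> polynomial_functions I \<Longrightarrow> g \<in> polynomial_functions I
    \<Longrightarrow> (\<lambda>x. f x * g x) \<in> polynomial_functions I"

definition zariski_closed :: "'i set \<Rightarrow> ('i \<Rightarrow> complex) set \<Rightarrow> bool" where
  "zariski_closed I V \<longleftrightarrow>
     (\<exists>F \<subseteq> polynomial_functions I. V = {x \<in> affine_space I. \<forall>f\<in>F. f x = 0})"

text \<open>Affine varieties are Zariski closed subsets of a finite-dimensional affine space;
  they need not be irreducible.\<close>

definition affine_variety :: "'i set \<Rightarrow> ('i \<Rightarrow> complex) set \<Rightarrow> bool" where
  "affine_variety I V \<longleftrightarrow> finite I \<and> zariski_closed I V"

definition irreducible_closed :: "'i set \<Rightarrow> ('i \<Rightarrow> complex) set \<Rightarrow> bool" where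
  "irreducible_closed I Z \<longleftrightarrow> zariski_closed I Z \<and> Z \<noteq> {} \<and>
     (\<forall>A B. zariski_closed I A \<and> zariski_closed I B \<and> Z = A \<union> B \<longrightarrow> Z = A \<or> Z = B)"

definition irreducible_chain ::
    "'i set \<Rightarrow> ('i \<Rightarrow> complex) set \<Rightarrow> nat \<Rightarrow> (nat \<Rightarrow> ('i \<Rightarrow> complex) set) \<Rightarrow> bool" where
  "irreducible_chain I V r Z \<longleftrightarrow>
     (\<forall>j\<le>r. irreducible_closed I (Z j) \<and> Z j \<subseteq> V) \<and> (\<forall>j<r. Z j \<subset> Z (Suc j))"

text \<open>The dimension of an affine variety \<open>V\<close> is its Krull dimension, i.e. the maximal length
  of a chain of irreducible closed subsets. As \<open>V\<close> is closed, closedness relative to \<open>V\<close> and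
  closedness in the affine space agree. The empty variety has no dimension here.\<close>

definition has_dimension :: "'i set \<Rightarrow> ('i \<Rightarrow> complex) set \<Rightarrow> nat \<Rightarrow> bool" where
  "has_dimension I V d \<longleftrightarrow>
     (\<exists>Z. irreducible_chain I V d Z) \<and> (\<forall>r Z. irreducible_chain I V r Z \<longrightarrow> r \<le> d)"


section \<open>The Laine condition\<close>

text \<open>Row and column indices of matrices start at \<open>0\<close> in the library, whence the shift by one.\<close>

definition laine_matrix :: "nat \<Rightarrow> (nat \<Rightarrow> complex) \<Rightarrow> complex mat" where
  "laine_matrix m b = Matrix.mat m m (\<lambda>(r, c). let j = r + 1; i = c + 1 in
     if i = m then b j
     else if i < j then b (j - i)
     else if i = j then (of_nat j)\<^sup>2 - of_nat j * of_nat m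
     else 0)"

text \<open>\<open>b j\<close> is the coefficient of \<open>(z - z0) ^ (j - 2)\<close> in the Laurent expansion of \<open>R\<close> at \<open>z0\<close>.\<close>

definition laine_condition_at :: "(complex \<Rightarrow> complex) \<Rightarrow> complex \<Rightarrow> bool" where
  "laine_condition_at R z0 \<longleftrightarrow>
     (\<exists>F m. (\<lambda>w. R (z0 + w)) has_laurent_expansion F \<and> m \<ge> 2 \<and>
        (\<forall>i < -2. fls_nth F i = 0) \<and>
        fls_nth F (-2) = (1 - (of_nat m)\<^sup>2) / 4 \<and>
        Determinant.det (laine_matrix m (\<lambda>j. fls_nth F (int j - 2))) = 0)"

text \<open>The condition is imposed on a function \<open>f = 2R\<close>, but formulated in terms of \<open>R\<close>.\<close>

definition laine_condition :: "(complex \<Rightarrow> complex) \<Rightarrow> bool" where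
  "laine_condition f \<longleftrightarrow>
     (let R = (\<lambda>z. f z / 2) in \<forall>z0. is_pole R z0 \<longrightarrow> laine_condition_at R z0)"

definition two_R :: "complex poly \<Rightarrow> complex poly \<Rightarrow> complex \<Rightarrow> complex" where
  "two_R P Q z = deriv (\<lambda>w. poly (pderiv P) w / poly P w) z
     - 1/2 * (poly (pderiv P) z / poly P z)\<^sup>2 + 2 * poly Q z / poly P z"


section \<open>The sets \<open>\<L>\<^sub>q(P)\<close>\<close>

text \<open>In the library the zero polynomial has degree \<open>0\<close>; here it has no degree.\<close>

definition of_degree :: "complex poly \<Rightarrow> nat \<Rightarrow> bool" where
  "of_degree Q q \<longleftrightarrow> Q \<noteq> 0 \<and> degree Q = q"

text \<open>Here \<open>a 0, \<dots>, a (n - 1)\<close> are the distinct zeros of \<open>P\<close>. The identity of rational functions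
  is stated at all points that are not zeros of \<open>P\<close>.\<close>

definition laine_decomposition ::
    "nat \<Rightarrow> (nat \<Rightarrow> complex) \<Rightarrow> complex poly \<Rightarrow> nat \<Rightarrow> complex poly
      \<Rightarrow> complex poly \<Rightarrow> (nat \<Rightarrow> complex) \<Rightarrow> bool" where
  "laine_decomposition n a P q Q S D \<longleftrightarrow>
     of_degree S (q - degree P) \<and>
     (\<forall>z. poly P z \<noteq> 0 \<longrightarrow>
        poly Q z / poly P z = poly S z + (\<Sum>k<n. D k / (z - a k)))"

definition laine_set ::
    "nat \<Rightarrow> (nat \<Rightarrow> complex) \<Rightarrow> complex poly \<Rightarrow> nat \<Rightarrow> complex poly set" where
  "laine_set n a P q = {Q. of_degree Q q \<and> (\<exists>S D. laine_decomposition n a P q Q S D) \<and>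
     laine_condition (two_R P Q)}"


section \<open>The coordinates \<open>(S, D)\<close>\<close>

text \<open>The polynomials of degree exactly \<open>d\<close> form the complement of a hyperplane in the
  \<open>(d + 1)\<close>-dimensional space of coefficient vectors. As usual, this principal open set is regarded
  as an affine variety by adjoining the inverse of the leading coefficient as a further coordinate.\<close>

datatype laine_index = Coeff nat | Lead_Inverse | Residue nat

definition laine_indices :: "nat \<Rightarrow> nat \<Rightarrow> laine_index set" where
  "laine_indices d n = Coeff ` {..d} \<union> {Lead_Inverse} \<union> Residue ` {..<n}"

definition laine_point ::
    "nat \<Rightarrow> nat \<Rightarrow> complex poly \<Rightarrow> (nat \<Rightarrow> complex) \<Rightarrow> laine_index \<Rightarrow> complex" where
  "laine_point d n S D = restrict
     (\<lambda>i. case i of Coeff j \<Rightarrow> coeff S j | Lead_Inverse \<Rightarrow> inverse (coeff S d) | Residue k \<Rightarrow> D k)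
     (laine_indices d n)"

definition laine_coordinates ::
    "nat \<Rightarrow> (nat \<Rightarrow> complex) \<Rightarrow> complex poly \<Rightarrow> nat \<Rightarrow> complex poly
      \<Rightarrow> (laine_index \<Rightarrow> complex) \<Rightarrow> bool" where
  "laine_coordinates n a P q Q x \<longleftrightarrow>
     (\<exists>S D. laine_decomposition n a P q Q S D \<and> x = laine_point (q - degree P) n S D)"

definition laine_variety ::
    "nat \<Rightarrow> (nat \<Rightarrow> complex) \<Rightarrow> complex poly \<Rightarrow> nat \<Rightarrow> (laine_index \<Rightarrow> complex) set" where
  "laine_variety n a P q = {x. \<exists>Q \<in> laine_set n a P q. laine_coordinates n a P q Q x}"

end

theory Submission
  imports Defs "HOL-Library.Function_Algebras" "HOL-Computational_Algebra.Fundamental_Theorem_Algebra"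
begin

text \<open>At a zero \<open>p\<^sub>k\<close> of order \<open>\<alpha>\<^sub>k\<close> the function \<open>R\<close> has a double pole with \<open>m = \<alpha>\<^sub>k + 1\<close>, so the Laine
  condition is the single equation \<open>\<D>\<^sub>m(p\<^sub>k) = 0\<close>. The Laurent coefficient \<open>b\<^sub>1\<close> is \<open>D\<^sub>k\<close> plus a
  constant and all other \<open>b\<^sub>j\<close> are affine in \<open>(S, D)\<close>; hence, up to sign, the determinant is
  \<open>D\<^sub>k ^ m\<close> plus terms of degree less than \<open>m\<close> in \<open>D\<close>. Such a system of \<open>n\<close> equations in the \<open>n\<close>
  unknowns \<open>D\<close> defines a finite surjective cover of the space of all \<open>S\<close>, which has dimension
  \<open>q - p + 1\<close>. Along this cover chains of irreducible closed sets can be lifted, because images of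
  closed sets are closed. Conversely, a chain of length \<open>r\<close> yields \<open>r\<close> functions with linearly
  independent monomials, while the functions on the cover of degree at most \<open>N\<close> span a space of
  dimension \<open>O(N ^ (q - p + 1))\<close>.\<close>

section \<open>Linear combinations over a subring\<close>

text \<open>The obstacle is coupling: the equation at one zero of P contains the residues at all the
  other zeros, so the fibre over a given S cannot be solved one unknown at a time. It is overcome by
  a degree that counts only D and gives functions of S degree 0. For this degree the leading forms
  are pure powers of the single D_k, whose only common zero is the origin, so no solution escapes to
  infinity. Finite fibres, solvability over every S and closed images all come from this.

  Finiteness means that a monomial in D reduces to one of finitely many. Solvability is a statement
  about ideals: the equations do not generate 1 over any base point. This is shown by comparing
  leading monomials, and a form of the Nullstellensatz turns it into a point.

  The condition that S has a nonzero leading coefficient is kept out of the cover. The cover is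
  built over the affine space of all coefficients together with the adjoined inverse, and the
  equation saying that the two are inverse to each other is imposed afterwards.\<close>

definition rng_closed :: "'a::comm_ring_1 set \<Rightarrow> bool" where
  "rng_closed A \<longleftrightarrow> 0 \<in> A \<and> (\<forall>a\<in>A. \<forall>b\<in>A. a - b \<in> A \<and> a * b \<in> A)"

definition ideal_over :: "'a::comm_ring_1 set \<Rightarrow> 'a set \<Rightarrow> bool" where
  "ideal_over R K \<longleftrightarrow> 0 \<in> K \<and> (\<forall>a\<in>K. \<forall>b\<in>K. a - b \<in> K) \<and> (\<forall>r\<in>R. \<forall>a\<in>K. r * a \<in> K)"

lemma rng_closedD:
  assumes "rng_closed A"
  shows "0 \<in> A" "\<And>a b. a \<in> A \<Longrightarrow> b \<in> A \<Longrightarrow> a - b \<in> A" "\<And>a b. a \<in> A \<Longrightarrow> b \<in> A \<Longrightarrow> a * b \<in> A"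
    "\<And>a. a \<in> A \<Longrightarrow> - a \<in> A" "\<And>a b. a \<in> A \<Longrightarrow> b \<in> A \<Longrightarrow> a + b \<in> A"
proof -
  show 0: "0 \<in> A" and diff: "\<And>a b. a \<in> A \<Longrightarrow> b \<in> A \<Longrightarrow> a - b \<in> A"
    and "\<And>a b. a \<in> A \<Longrightarrow> b \<in> A \<Longrightarrow> a * b \<in> A"
    using assms by (auto simp: rng_closed_def)
  show minus: "- a \<in> A" if "a \<in> A" for a
    using diff[OF 0 that] by simp
  show "a + b \<in> A" if "a \<in> A" "b \<in> A" for a b
    using diff[OF that(1) minus[OF that(2)]] by simp
qed

lemma ideal_overD:
  assumes "ideal_over R K"
  shows "0 \<in> K" "\<And>a b. a \<in> K \<Longrightarrow> b \<in> K \<Longrightarrow> a - b \<in> K" "\<And>r a. r \<in> R \<Longrightarrow> a \<in> K \<Longrightarrow> r * a \<in> K"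
    "\<And>a. a \<in> K \<Longrightarrow> - a \<in> K" "\<And>a b. a \<in> K \<Longrightarrow> b \<in> K \<Longrightarrow> a + b \<in> K"
proof -
  show 0: "0 \<in> K" and diff: "\<And>a b. a \<in> K \<Longrightarrow> b \<in> K \<Longrightarrow> a - b \<in> K"
    and "\<And>r a. r \<in> R \<Longrightarrow> a \<in> K \<Longrightarrow> r * a \<in> K"
    using assms by (auto simp: ideal_over_def)
  show minus: "- a \<in> K" if "a \<in> K" for a
    using diff[OF 0 that] by simp
  show "a + b \<in> K" if "a \<in> K" "b \<in> K" for a b
    using diff[OF that(1) minus[OF that(2)]] by simp
qed

text \<open>The coefficient set is a parameter because constants, functions on the base and all
  functions serve in turn. It need not contain 1: in Nakayama's lemma it will consist of the
  functions on the base that vanish at a point.\<close>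

inductive_set lspan :: "'a::comm_ring_1 set \<Rightarrow> 'a set \<Rightarrow> 'a set" for A T where
  zero: "0 \<in> lspan A T"
| step: "a \<in> A \<Longrightarrow> t \<in> T \<Longrightarrow> h \<in> lspan A T \<Longrightarrow> a * t + h \<in> lspan A T"

lemma lspan_least:
  assumes "h \<in> lspan A T" "0 \<in> S" "\<And>x y. x \<in> S \<Longrightarrow> y \<in> S \<Longrightarrow> x + y \<in> S"
    "\<And>a t. a \<in> A \<Longrightarrow> t \<in> T \<Longrightarrow> a * t \<in> S"
  shows "h \<in> S"
  using assms(1) by induction (auto intro: assms)

lemma lspan_add: "h \<in> lspan A T \<Longrightarrow> h' \<in> lspan A T \<Longrightarrow> h + h' \<in> lspan A T"
  by (induction rule: lspan.induct) (auto simp: add.assoc intro: lspan.step)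

lemma lspan_mult_gen: "a \<in> A \<Longrightarrow> t \<in> T \<Longrightarrow> a * t \<in> lspan A T"
  using lspan.step[OF _ _ lspan.zero] by fastforce

lemma lspan_gen: "1 \<in> A \<Longrightarrow> t \<in> T \<Longrightarrow> t \<in> lspan A T"
  using lspan_mult_gen[of 1 A t T] by simp

lemma lspan_sum: "(\<And>i. i \<in> X \<Longrightarrow> h i \<in> lspan A T) \<Longrightarrow> sum h X \<in> lspan A T"
  by (induction X rule: infinite_finite_induct) (auto intro: lspan.zero lspan_add)

lemma lspan_mono: "A \<subseteq> A' \<Longrightarrow> T \<subseteq> T' \<Longrightarrow> lspan A T \<subseteq> lspan A' T'"
  by (auto elim!: lspan_least intro: lspan.zero lspan_add lspan_mult_gen)

lemma lspan_scale:
  assumes "h \<in> lspan A T" "\<And>a. a \<in> A \<Longrightarrow> c * a \<in> M"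
  shows "c * h \<in> lspan M T"
  using assms(1)
proof induction
  case (step a t h)
  have "c * (a * t + h) = (c * a) * t + c * h"
    by (simp add: algebra_simps)
  then show ?case
    using step assms(2) by (auto intro: lspan.step)
qed (auto intro: lspan.zero)

lemma lspan_uminus: "rng_closed A \<Longrightarrow> h \<in> lspan A T \<Longrightarrow> - h \<in> lspan A T"
  using lspan_scale[of h A T "-1" A] rng_closedD(4)[of A] by simp

lemma lspan_insert:
  assumes "h \<in> lspan A (insert t T)" "rng_closed A"
  obtains a h' where "a \<in> A" "h' \<in> lspan A T" "h = a * t + h'"
proof -
  have "h \<in> {a * t + h' |a h'. a \<in> A \<and> h' \<in> lspan A T}"
    using assms(1)
  proof (rule lspan_least)
    show "0 \<in> {a * t + h' |a h'. a \<in> A \<and> h' \<in> lspan A T}"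
      using rng_closedD(1)[OF assms(2)] lspan.zero by (intro CollectI exI[of _ 0]) auto
  next
    fix x y
    assume "x \<in> {a * t + h' |a h'. a \<in> A \<and> h' \<in> lspan A T}"
      and "y \<in> {a * t + h' |a h'. a \<in> A \<and> h' \<in> lspan A T}"
    then obtain a h b k where "x = a * t + h" "y = b * t + k" "a \<in> A" "b \<in> A"
      "h \<in> lspan A T" "k \<in> lspan A T" by auto
    then have "x + y = (a + b) * t + (h + k)" "a + b \<in> A" "h + k \<in> lspan A T"
      using rng_closedD[OF assms(2)] by (auto simp: algebra_simps lspan_add)
    then show "x + y \<in> {a * t + h' |a h'. a \<in> A \<and> h' \<in> lspan A T}" by blast
  next
    fix a s assume as: "a \<in> A" "s \<in> insert t T"
    show "a * s \<in> {a * t + h' |a h'. a \<in> A \<and> h' \<in> lspan A T}"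
    proof (cases "s = t")
      case True
      then show ?thesis using as by (intro CollectI exI[of _ a] exI[of _ 0]) (auto intro: lspan.zero)
    next
      case False
      then show ?thesis using as rng_closedD(1)[OF assms(2)]
        by (intro CollectI exI[of _ 0] exI[of _ "a * s"]) (auto intro: lspan_mult_gen)
    qed
  qed
  then show ?thesis using that by auto
qed

lemma lspan_rep:
  assumes "h \<in> lspan A T" "rng_closed A"
  obtains F a where "finite F" "F \<subseteq> T" "a \<in> F \<rightarrow> A" "h = (\<Sum>t\<in>F. a t * t)"
proof -
  have "\<exists>F a. finite F \<and> F \<subseteq> T \<and> a \<in> F \<rightarrow> A \<and> h = (\<Sum>t\<in>F. a t * t)"
    using assms(1)
  proof induction
    case zero
    then show ?case by (intro exI[of _ "{}"]) auto
  next
    case (step b s h)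
    then obtain F a where F: "finite F" "F \<subseteq> T" "a \<in> F \<rightarrow> A" "h = (\<Sum>t\<in>F. a t * t)" by blast
    show ?case
    proof (cases "s \<in> F")
      case True
      have "b * s + h = (\<Sum>t\<in>F. (a(s := b + a s)) t * t)"
        using F True by (simp add: sum.remove[of F s] algebra_simps)
      moreover have "a(s := b + a s) \<in> F \<rightarrow> A"
        using F(3) step(1) True rng_closedD(5)[OF assms(2)] by (auto simp: Pi_iff)
      ultimately show ?thesis using F by blast
    next
      case False
      have "(\<Sum>t\<in>F. (a(s := b)) t * t) = (\<Sum>t\<in>F. a t * t)"
        using False by (intro sum.cong) auto
      then have "b * s + h = (\<Sum>t\<in>insert s F. (a(s := b)) t * t)"
        using F False by simp
      moreover have "a(s := b) \<in> insert s F \<rightarrow> A" "finite (insert s F)" "insert s F \<subseteq> T"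
        using F step by auto
      ultimately show ?thesis by blast
    qed
  qed
  then show ?thesis using that by blast
qed

lemma lspan_finite_rep:
  assumes "h \<in> lspan A T" "rng_closed A" "finite T"
  obtains a where "a \<in> T \<rightarrow> A" "h = (\<Sum>t\<in>T. a t * t)"
proof -
  obtain F a where F: "finite F" "F \<subseteq> T" "a \<in> F \<rightarrow> A" "h = (\<Sum>t\<in>F. a t * t)"
    using lspan_rep[OF assms(1,2)] by blast
  define b where "b t = (if t \<in> F then a t else 0)" for t
  have "(\<Sum>t\<in>F. a t * t) = (\<Sum>t\<in>T. b t * t)"
    using F assms(3) by (intro sum.mono_neutral_cong_left) (auto simp: b_def)
  moreover have "b \<in> T \<rightarrow> A"
    using F rng_closedD(1)[OF assms(2)] by (auto simp: b_def)
  ultimately show ?thesis using that F by blast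
qed

text \<open>Congruence modulo \<open>K\<close> takes the place of a quotient ring. With
  \<open>K\<close> the functions vanishing on a set \<open>V\<close>, this is a span inside the ring
  of functions on \<open>V\<close>.\<close>

definition lspan_mod :: "'a::comm_ring_1 set \<Rightarrow> 'a set \<Rightarrow> 'a set \<Rightarrow> 'a set" where
  "lspan_mod A T K = {h. \<exists>h'\<in>lspan A T. h - h' \<in> K}"

lemma lspan_modI: "h' \<in> lspan A T \<Longrightarrow> h - h' \<in> K \<Longrightarrow> h \<in> lspan_mod A T K"
  by (auto simp: lspan_mod_def)

lemma lspan_subset_mod: "ideal_over R K \<Longrightarrow> h \<in> lspan A T \<Longrightarrow> h \<in> lspan_mod A T K"
  using ideal_overD(1)[of R K] by (auto intro: lspan_modI)

lemma lspan_mod_add: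
  assumes "ideal_over R K" "h \<in> lspan_mod A T K" "g \<in> lspan_mod A T K"
  shows "h + g \<in> lspan_mod A T K"
proof -
  obtain h' g' where *: "h' \<in> lspan A T" "g' \<in> lspan A T" "h - h' \<in> K" "g - g' \<in> K"
    using assms by (auto simp: lspan_mod_def)
  have "(h + g) - (h' + g') = (h - h') + (g - g')" by simp
  then show ?thesis
    using ideal_overD(5)[OF assms(1) *(3,4)] by (intro lspan_modI[OF lspan_add[OF *(1,2)]]) (simp only:)
qed

lemma lspan_mod_cong:
  assumes "ideal_over R K" "h \<in> lspan_mod A T K" "g - h \<in> K"
  shows "g \<in> lspan_mod A T K"
proof -
  obtain h' where *: "h' \<in> lspan A T" "h - h' \<in> K"
    using assms by (auto simp: lspan_mod_def)
  have "g - h' = (g - h) + (h - h')" by simp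
  then show ?thesis
    using ideal_overD(5)[OF assms(1,3) *(2)] by (intro lspan_modI[OF *(1)]) (simp only:)
qed

lemma lspan_mod_mono:
  "A \<subseteq> A' \<Longrightarrow> T \<subseteq> T' \<Longrightarrow> K \<subseteq> K' \<Longrightarrow> lspan_mod A T K \<subseteq> lspan_mod A' T' K'"
  using lspan_mono[of A A' T T'] unfolding lspan_mod_def by blast

lemma lspan_mod_scale:
  assumes "ideal_over R K" "c \<in> R" "h \<in> lspan_mod A T K" "\<And>a. a \<in> A \<Longrightarrow> c * a \<in> M"
  shows "c * h \<in> lspan_mod M T K"
proof -
  obtain h' where *: "h' \<in> lspan A T" "h - h' \<in> K"
    using assms by (auto simp: lspan_mod_def)
  have "c * h - c * h' = c * (h - h')" by (simp add: algebra_simps)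
  then show ?thesis
    using * assms lspan_scale[of h' A T c M] ideal_overD(3)[OF assms(1)] lspan_modI by metis
qed

lemma lspan_mod_uminus:
  assumes "ideal_over R K" "rng_closed A" "h \<in> lspan_mod A T K"
  shows "- h \<in> lspan_mod A T K"
proof -
  obtain h' where *: "h' \<in> lspan A T" "h - h' \<in> K"
    using assms by (auto simp: lspan_mod_def)
  have "- h - (- h') = - (h - h')" by simp
  then show ?thesis
    using * assms lspan_uminus ideal_overD(4)[OF assms(1)] lspan_modI by metis
qed

lemma lspan_mod_least:
  assumes "ideal_over R K" "h \<in> lspan A T"
    "\<And>a t. a \<in> A \<Longrightarrow> t \<in> T \<Longrightarrow> a * t \<in> lspan_mod A' T' K"
  shows "h \<in> lspan_mod A' T' K"
  using assms(2) by (rule lspan_least)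
    (auto intro: lspan_mod_add assms lspan_subset_mod[OF assms(1)] lspan.zero)

lemma lspan_mod_mult_least:
  assumes "ideal_over R K" "h \<in> lspan A T"
    "\<And>a t. a \<in> A \<Longrightarrow> t \<in> T \<Longrightarrow> g * (a * t) \<in> lspan_mod A' T' K"
  shows "g * h \<in> lspan_mod A' T' K"
  using assms(2)
proof induction
  case zero
  show ?case using lspan_subset_mod[OF assms(1) lspan.zero] by (simp only: mult_zero_right)
next
  case (step a t h)
  show ?case
    unfolding distrib_left by (rule lspan_mod_add[OF assms(1) assms(3)[OF step.hyps(1,2)] step.IH])
qed

lemma lspan_mod_times:
  assumes "h \<in> lspan A T" "g \<in> lspan_mod A' T' K" "ideal_over R K" "A \<subseteq> R" "T \<subseteq> R" "rng_closed R"
    "\<And>a t a' t'. a \<in> A \<Longrightarrow> t \<in> T \<Longrightarrow> a' \<in> A' \<Longrightarrow> t' \<in> T' \<Longrightarrow> (a * t) * (a' * t') \<in> lspan_mod A'' T'' K"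
  shows "h * g \<in> lspan_mod A'' T'' K"
proof -
  obtain g' where g': "g' \<in> lspan A' T'" "g - g' \<in> K"
    using assms(2) by (auto simp: lspan_mod_def)
  have "g * (a * t) \<in> lspan_mod A'' T'' K" if at: "a \<in> A" "t \<in> T" for a t
  proof -
    have "a * t * g' \<in> lspan_mod A'' T'' K"
      by (rule lspan_mod_mult_least[OF assms(3) g'(1) assms(7)[OF at]])
    moreover have "a * t \<in> R" using at assms(4,5) rng_closedD(3)[OF assms(6)] by blast
    then have "a * t * g - a * t * g' \<in> K"
      unfolding right_diff_distrib[symmetric] by (rule ideal_overD(3)[OF assms(3) _ g'(2)])
    ultimately have "a * t * g \<in> lspan_mod A'' T'' K" by (rule lspan_mod_cong[OF assms(3)])
    then show ?thesis by (simp only: mult.commute)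
  qed
  then have "g * h \<in> lspan_mod A'' T'' K" by (rule lspan_mod_mult_least[OF assms(3,1)])
  then show ?thesis by (simp only: mult.commute)
qed

text \<open>This is the ideal generated by \<open>T\<close> and \<open>K\<close>. It is cut down to
  \<open>R\<close> because \<open>K\<close>, for instance a set of vanishing functions, may contain
  elements outside \<open>R\<close>.\<close>

lemma ideal_over_lspan_mod:
  assumes K: "ideal_over R K" and R: "rng_closed R"
  shows "ideal_over R (R \<inter> lspan_mod R T K)"
  unfolding ideal_over_def
proof (intro conjI ballI)
  show "0 \<in> R \<inter> lspan_mod R T K"
    by (intro IntI rng_closedD(1)[OF R] lspan_subset_mod[OF K] lspan.zero)
next
  fix a b assume "a \<in> R \<inter> lspan_mod R T K" "b \<in> R \<inter> lspan_mod R T K"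
  then have "a + - b \<in> R \<inter> lspan_mod R T K"
    using rng_closedD(5)[OF R _ rng_closedD(4)[OF R]] lspan_mod_uminus[OF K R]
    by (intro IntI lspan_mod_add[OF K]) blast+
  then show "a - b \<in> R \<inter> lspan_mod R T K" by (simp only: diff_conv_add_uminus)
next
  fix g a assume "g \<in> R" "a \<in> R \<inter> lspan_mod R T K"
  then show "g * a \<in> R \<inter> lspan_mod R T K"
    using rng_closedD(3)[OF R] lspan_mod_scale[OF K] by blast
qed

text \<open>Nakayama's lemma, by eliminating one generator at a time instead of by determinants.\<close>

lemma nakayama:
  assumes "finite E" "ideal_over R K" "rng_closed M" "M \<subseteq> R" "rng_closed R" "1 \<in> R"
    and "\<And>e. e \<in> E \<Longrightarrow> e \<in> lspan_mod M E K"
  shows "\<exists>u. 1 - u \<in> M \<and> (\<forall>e\<in>E. u * e \<in> K)"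
  using assms(1,7)
proof (induction E)
  case empty
  then show ?case using rng_closedD(1)[OF assms(3)] by (intro exI[of _ 1]) auto
next
  case (insert e0 E)
  note M = rng_closedD[OF assms(3)] and K = ideal_overD[OF assms(2)] and R = rng_closedD[OF assms(5)]
  have split: "\<exists>a\<in>M. \<exists>h\<in>lspan M E. e - (a * e0 + h) \<in> K" if "e \<in> insert e0 E" for e
    using insert.prems[OF that] lspan_insert[OF _ assms(3)] unfolding lspan_mod_def by blast
  obtain a0 h0 where 0: "a0 \<in> M" "h0 \<in> lspan M E" "e0 - (a0 * e0 + h0) \<in> K"
    using split by blast
  have "e \<in> lspan_mod M E K" if e: "e \<in> E" for e
  proof -
    obtain a h where ah: "a \<in> M" "h \<in> lspan M E" "e - (a * e0 + h) \<in> K"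
      using split e by blast
    \<comment> \<open>Modulo \<open>K\<close>, multiplying e = a e0 + h by 1 - a0 and replacing (1 -
      a0) e0 by h0 gives (1 - a0) e = a h0 + (1 - a0) h. So \<open>e0\<close> disappears without a
      division.\<close>
    define h' where "h' = a0 * e + (a * h0 + (h + - a0 * h))"
    have "a * h0 \<in> lspan M E"
      using 0(2) by (rule lspan_scale) (use ah(1) M in blast)
    moreover have "- a0 * h \<in> lspan M E"
      using ah(2) by (rule lspan_scale) (use 0(1) M in blast)
    ultimately have "h' \<in> lspan M E"
      unfolding h'_def using ah 0 e by (intro lspan.step lspan_add)
    have "e - h' = (1 - a0) * (e - (a * e0 + h)) + a * (e0 - (a0 * e0 + h0))"
      unfolding h'_def by (simp add: algebra_simps)
    moreover have "1 - a0 \<in> R" "a \<in> R" using R assms(4,6) 0(1) ah(1) by auto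
    ultimately have "e - h' \<in> K"
      using K(5)[OF K(3)[OF _ ah(3)] K(3)[OF _ 0(3)]] by simp
    with \<open>h' \<in> lspan M E\<close> show ?thesis by (rule lspan_modI)
  qed
  from insert.IH[OF this] obtain u where u: "1 - u \<in> M" "\<And>e. e \<in> E \<Longrightarrow> u * e \<in> K" by blast
  have uR: "u \<in> R"
    using R(2)[OF assms(6), of "1 - u"] u(1) assms(4) by auto
  have a0R: "1 - a0 \<in> R" using R assms(4,6) 0 by auto
  have uh: "u * h0 \<in> K"
    using 0(2)
  proof (rule lspan_least[where S = "{h. u * h \<in> K}", simplified])
    fix a t assume at: "a \<in> M" "t \<in> E"
    have "a * (u * t) \<in> K" using at u K assms(4) by blast
    then show "u * (a * t) \<in> K" by (simp add: algebra_simps)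
  qed (use K in \<open>auto simp: distrib_left\<close>)
  \<comment> \<open>The new multiplier is (1 - a0) u: the factor 1 - a0 turns \<open>e0\<close> into
    \<open>h0\<close>, a combination of \<open>E\<close>, which \<open>u\<close> sends into
    \<open>K\<close>.\<close>
  have "1 - (1 - a0) * u = (1 - u) + a0 - a0 * (1 - u)"
    by (simp add: algebra_simps)
  then have "1 - (1 - a0) * u \<in> M"
    using M(2)[OF M(5)[OF u(1) 0(1)] M(3)[OF 0(1) u(1)]] by (simp only:)
  moreover have "(1 - a0) * u * e0 = u * (e0 - (a0 * e0 + h0)) + u * h0"
    by (simp add: algebra_simps)
  then have "(1 - a0) * u * e0 \<in> K"
    using K(5)[OF K(3)[OF uR 0(3)] uh] by simp
  moreover have "(1 - a0) * u * e \<in> K" if "e \<in> E" for e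
    using K(3)[OF a0R u(2)[OF that]] by (simp add: mult.assoc)
  ultimately show ?case by (intro exI[of _ "(1 - a0) * u"]) auto
qed

text \<open>Gaussian elimination of one equation at a time: an unknown \<open>x0\<close> with a
  nonzero coefficient is solved for and substituted into the remaining equations.\<close>

lemma underdetermined_system:
  fixes M :: "'x \<Rightarrow> 'y \<Rightarrow> 'k::field"
  assumes "finite Y" "finite X" "card X > card Y"
  shows "\<exists>c. (\<exists>x\<in>X. c x \<noteq> 0) \<and> (\<forall>y\<in>Y. (\<Sum>x\<in>X. c x * M x y) = 0)"
  using assms
proof (induction Y arbitrary: X M)
  case empty
  then have "\<exists>x. x \<in> X" by (auto simp: card_gt_0_iff)
  then show ?case by (intro exI[of _ "\<lambda>_. 1"]) auto
next
  case (insert y Y)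
  show ?case
  proof (cases "\<forall>x\<in>X. M x y = 0")
    case True
    have "card X > card Y" using insert.hyps insert.prems by simp
    from insert.IH[OF insert.prems(1) this, of M] obtain c where
      "\<exists>x\<in>X. c x \<noteq> 0" "\<And>z. z \<in> Y \<Longrightarrow> (\<Sum>x\<in>X. c x * M x z) = 0" by blast
    moreover have "(\<Sum>x\<in>X. c x * M x y) = 0" using True by simp
    ultimately show ?thesis by (intro exI[of _ c]) auto
  next
    case False
    then obtain x0 where x0: "x0 \<in> X" "M x0 y \<noteq> 0" by blast
    define M' where "M' x z = M x z - M x y / M x0 y * M x0 z" for x z
    have "finite (X - {x0})" "card (X - {x0}) > card Y"
      using insert.hyps insert.prems x0 by auto
    from insert.IH[OF this, of M'] obtain c where
      c: "\<exists>x\<in>X - {x0}. c x \<noteq> 0" "\<And>z. z \<in> Y \<Longrightarrow> (\<Sum>x\<in>X - {x0}. c x * M' x z) = 0" by blast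
    define s where "s = (\<Sum>x\<in>X - {x0}. c x * M x y)"
    define c' where "c' = c(x0 := - s / M x0 y)"
    have sum: "(\<Sum>x\<in>X. c' x * M x z) = (\<Sum>x\<in>X - {x0}. c x * M x z) - s / M x0 y * M x0 z" for z
    proof -
      have "(\<Sum>x\<in>X - {x0}. c' x * M x z) = (\<Sum>x\<in>X - {x0}. c x * M x z)"
        by (intro sum.cong) (auto simp: c'_def)
      then show ?thesis
        using sum.remove[OF insert.prems(1) x0(1), of "\<lambda>x. c' x * M x z"] by (simp add: c'_def)
    qed
    have "(\<Sum>x\<in>X - {x0}. c x * M' x z) = (\<Sum>x\<in>X - {x0}. c x * M x z) - s / M x0 y * M x0 z" for z
    proof -
      have "(\<Sum>x\<in>X - {x0}. c x * M' x z)
        = (\<Sum>x\<in>X - {x0}. c x * M x z - c x * M x y * (M x0 z / M x0 y))"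
        by (intro sum.cong) (auto simp: M'_def right_diff_distrib)
      also have "\<dots> = (\<Sum>x\<in>X - {x0}. c x * M x z) - s * (M x0 z / M x0 y)"
        unfolding sum_subtractf s_def sum_distrib_right ..
      finally show ?thesis by simp
    qed
    with sum c(2) have "\<forall>z\<in>Y. (\<Sum>x\<in>X. c' x * M x z) = 0" by simp
    moreover have "(\<Sum>x\<in>X. c' x * M x y) = 0" using sum[of y] x0 by (simp add: s_def)
    moreover have "\<exists>x\<in>X. c' x \<noteq> 0" using c(1) by (auto simp: c'_def)
    ultimately show ?thesis by (intro exI[of _ c']) auto
  qed
qed

section \<open>Polynomial functions and Zariski closed sets\<close>

lemma sum_fun_apply: "(\<Sum>i\<in>X. f i) x = (\<Sum>i\<in>X. f i x)"
  for f :: "'b \<Rightarrow> 'c \<Rightarrow> 'a::comm_monoid_add"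
  by (induction X rule: infinite_finite_induct) auto

lemma prod_fun_apply: "(\<Prod>i\<in>X. f i) x = (\<Prod>i\<in>X. f i x)"
  for f :: "'b \<Rightarrow> 'c \<Rightarrow> 'a::comm_monoid_mult"
  by (induction X rule: infinite_finite_induct) auto

lemma power_fun_apply: "(f ^ n) x = f x ^ n" for f :: "'c \<Rightarrow> 'a::monoid_mult"
  by (induction n) auto

definition coord :: "'i \<Rightarrow> ('i \<Rightarrow> complex) \<Rightarrow> complex" where
  "coord i = (\<lambda>x. x i)"

definition const_fun :: "complex \<Rightarrow> ('i \<Rightarrow> complex) \<Rightarrow> complex" where
  "const_fun c = (\<lambda>x. c)"

lemma const_fun_apply [simp]: "const_fun c x = c"
  by (simp add: const_fun_def)

lemma coord_apply [simp]: "coord i x = x i"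
  by (simp add: coord_def)

lemma polyfun_const: "const_fun c \<in> polynomial_functions I"
  unfolding const_fun_def by (rule polynomial_functions.const)

lemma polyfun_coord: "i \<in> I \<Longrightarrow> coord i \<in> polynomial_functions I"
  unfolding coord_def by (rule polynomial_functions.coordinate)

lemma polyfun_plus:
  "f \<in> polynomial_functions I \<Longrightarrow> g \<in> polynomial_functions I \<Longrightarrow> f + g \<in> polynomial_functions I"
  unfolding plus_fun_def by (rule polynomial_functions.add)

lemma polyfun_times:
  "f \<in> polynomial_functions I \<Longrightarrow> g \<in> polynomial_functions I \<Longrightarrow> f * g \<in> polynomial_functions I"
  unfolding times_fun_def by (rule polynomial_functions.mult)

lemma polyfun_0: "0 \<in> polynomial_functions I"
  unfolding zero_fun_def by (rule polynomial_functions.const)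

lemma polyfun_1: "1 \<in> polynomial_functions I"
  unfolding one_fun_def by (rule polynomial_functions.const)

lemma polyfun_minus:
  assumes "f \<in> polynomial_functions I" "g \<in> polynomial_functions I"
  shows "f - g \<in> polynomial_functions I"
proof -
  have "f - g = f + const_fun (-1) * g" by (simp add: fun_eq_iff)
  also have "\<dots> \<in> polynomial_functions I"
    using assms by (intro polyfun_plus polyfun_times polyfun_const)
  finally show ?thesis .
qed

lemma polyfun_sum:
  "(\<And>i. i \<in> X \<Longrightarrow> f i \<in> polynomial_functions I) \<Longrightarrow> sum f X \<in> polynomial_functions I"
  by (induction X rule: infinite_finite_induct)
    (auto intro: polyfun_plus polyfun_0)

lemma polyfun_prod:
  "(\<And>i. i \<in> X \<Longrightarrow> f i \<in> polynomial_functions I) \<Longrightarrow> prod f X \<in> polynomial_functions I"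
  by (induction X rule: infinite_finite_induct)
    (auto intro: polyfun_times polyfun_1)

lemma polyfun_power:
  "f \<in> polynomial_functions I \<Longrightarrow> f ^ n \<in> polynomial_functions I"
  by (induction n) (auto intro: polyfun_times polyfun_1)

lemma rng_closed_polyfun: "rng_closed (polynomial_functions I)"
  by (simp add: rng_closed_def polyfun_0 polyfun_minus
      polyfun_times)

lemma polyfun_mono:
  assumes "I \<subseteq> J"
  shows "polynomial_functions I \<subseteq> polynomial_functions J"
proof
  fix f assume "f \<in> polynomial_functions I"
  then show "f \<in> polynomial_functions J"
    by induction (use assms in \<open>auto intro: polynomial_functions.intros\<close>)
qed

lemma polyfun_cong:
  "f \<in> polynomial_functions I \<Longrightarrow> (\<And>i. i \<in> I \<Longrightarrow> x i = y i) \<Longrightarrow> f x = f y"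
  by (induction rule: polynomial_functions.induct) auto

lemma polyfun_restrict:
  "f \<in> polynomial_functions I \<Longrightarrow> f (restrict x I) = f x"
  by (erule polyfun_cong) auto

section \<open>Vanishing ideals, closed sets and irreducibility\<close>

definition vanishing :: "'x set \<Rightarrow> ('x \<Rightarrow> complex) set" where
  "vanishing X = {h. \<forall>x\<in>X. h x = 0}"

lemma ideal_vanishing: "ideal_over R (vanishing X)"
  by (auto simp: ideal_over_def vanishing_def)

lemma rng_closed_constants: "rng_closed (range const_fun)"
proof -
  have "0 = const_fun 0" "const_fun a - const_fun b = const_fun (a - b)"
    "const_fun a * const_fun b = const_fun (a * b)" for a b
    by (simp_all add: fun_eq_iff)
  then show ?thesis unfolding rng_closed_def by blast
qed

lemma one_in_constants: "1 \<in> range const_fun"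
  by (rule image_eqI[of _ _ 1]) (auto simp: fun_eq_iff)

abbreviation cspan_mod ::
    "(('i \<Rightarrow> complex) \<Rightarrow> complex) set \<Rightarrow> (('i \<Rightarrow> complex) \<Rightarrow> complex) set \<Rightarrow> (('i \<Rightarrow> complex) \<Rightarrow> complex) set" where
  "cspan_mod \<equiv> lspan_mod (range const_fun)"

lemma constants_subset: "range const_fun \<subseteq> polynomial_functions I"
  by (auto intro: polyfun_const)

lemma zariski_closed_subset: "zariski_closed I Z \<Longrightarrow> Z \<subseteq> affine_space I"
  by (auto simp: zariski_closed_def)

lemma zariski_closedI:
  "F \<subseteq> polynomial_functions I \<Longrightarrow> Z = {x \<in> affine_space I. \<forall>f\<in>F. f x = 0} \<Longrightarrow> zariski_closed I Z"
  by (auto simp: zariski_closed_def)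

lemma zariski_closed_separates:
  assumes "zariski_closed I Z" "x \<in> affine_space I" "x \<notin> Z"
  obtains f where "f \<in> polynomial_functions I" "f \<in> vanishing Z" "f x \<noteq> 0"
  using assms by (auto simp: zariski_closed_def vanishing_def)

lemma zariski_closed_iff:
  "zariski_closed I Z \<longleftrightarrow> Z \<subseteq> affine_space I \<and>
     (\<forall>x\<in>affine_space I. (\<forall>f\<in>polynomial_functions I. f \<in> vanishing Z \<longrightarrow> f x = 0) \<longrightarrow> x \<in> Z)"
proof
  assume "zariski_closed I Z"
  then show "Z \<subseteq> affine_space I \<and>
     (\<forall>x\<in>affine_space I. (\<forall>f\<in>polynomial_functions I. f \<in> vanishing Z \<longrightarrow> f x = 0) \<longrightarrow> x \<in> Z)"
    using zariski_closed_separates zariski_closed_subset by metis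
next
  assume *: "Z \<subseteq> affine_space I \<and>
     (\<forall>x\<in>affine_space I. (\<forall>f\<in>polynomial_functions I. f \<in> vanishing Z \<longrightarrow> f x = 0) \<longrightarrow> x \<in> Z)"
  show "zariski_closed I Z"
    by (rule zariski_closedI[of "polynomial_functions I \<inter> vanishing Z"])
      (use * in \<open>auto simp: vanishing_def\<close>)
qed

lemma zariski_closed_Inter:
  assumes "\<And>Z. Z \<in> \<Z> \<Longrightarrow> zariski_closed I Z" "\<Z> \<noteq> {}"
  shows "zariski_closed I (\<Inter>\<Z>)"
  unfolding zariski_closed_iff
proof (intro conjI ballI impI InterI)
  show "\<Inter>\<Z> \<subseteq> affine_space I"
    using assms zariski_closed_subset by blast
next
  fix x Z
  assume x: "x \<in> affine_space I" "Z \<in> \<Z>"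
    "\<forall>f\<in>polynomial_functions I. f \<in> vanishing (\<Inter>\<Z>) \<longrightarrow> f x = 0"
  then have "\<forall>f\<in>polynomial_functions I. f \<in> vanishing Z \<longrightarrow> f x = 0"
    by (auto simp: vanishing_def)
  then show "x \<in> Z"
    using assms(1)[OF x(2)] x(1) by (auto simp: zariski_closed_iff)
qed

lemma zariski_closed_Int:
  "zariski_closed I A \<Longrightarrow> zariski_closed I B \<Longrightarrow> zariski_closed I (A \<inter> B)"
  using zariski_closed_Inter[of "{A, B}"] by auto

lemma zariski_closed_zeros:
  assumes "zariski_closed I Z" "f \<in> polynomial_functions I"
  shows "zariski_closed I {x \<in> Z. f x = 0}"
proof -
  have "zariski_closed I {x \<in> affine_space I. f x = 0}"
    by (rule zariski_closedI[of "{f}"]) (use assms in auto)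
  moreover have "{x \<in> Z. f x = 0} = Z \<inter> {x \<in> affine_space I. f x = 0}"
    using zariski_closed_subset[OF assms(1)] by auto
  ultimately show ?thesis
    using zariski_closed_Int[OF assms(1)] by simp
qed

text \<open>The zero sets of the two factors in \<open>Z\<close> are closed and together cover
  \<open>Z\<close>.\<close>

lemma irreducible_closed_prime:
  assumes "irreducible_closed I Z" "f \<in> polynomial_functions I" "g \<in> polynomial_functions I"
    "f * g \<in> vanishing Z"
  shows "f \<in> vanishing Z \<or> g \<in> vanishing Z"
proof -
  have Z: "zariski_closed I Z" using assms by (auto simp: irreducible_closed_def)
  have "Z = {x \<in> Z. f x = 0} \<union> {x \<in> Z. g x = 0}"
    using assms(4) by (auto simp: vanishing_def)
  then have "Z = {x \<in> Z. f x = 0} \<or> Z = {x \<in> Z. g x = 0}"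
    using assms(1) zariski_closed_zeros[OF Z assms(2)] zariski_closed_zeros[OF Z assms(3)]
    unfolding irreducible_closed_def by blast
  then show ?thesis by (auto simp: vanishing_def)
qed

text \<open>Two proper closed subsets miss points \<open>x\<close> and \<open>y\<close>, which
  polynomial functions separate from them. A point of \<open>Z\<close> where the product of these
  functions is nonzero lies in neither subset.\<close>

lemma irreducible_closedI:
  assumes "zariski_closed I Z" "Z \<noteq> {}"
    and prime: "\<And>f g x y. f \<in> polynomial_functions I \<Longrightarrow> g \<in> polynomial_functions I \<Longrightarrow>
      x \<in> Z \<Longrightarrow> f x \<noteq> 0 \<Longrightarrow> y \<in> Z \<Longrightarrow> g y \<noteq> 0 \<Longrightarrow> \<exists>z\<in>Z. f z * g z \<noteq> 0"
  shows "irreducible_closed I Z"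
  unfolding irreducible_closed_def
proof (intro conjI allI impI assms(1,2))
  fix A B assume AB: "zariski_closed I A \<and> zariski_closed I B \<and> Z = A \<union> B"
  show "Z = A \<or> Z = B"
  proof (rule ccontr)
    assume "\<not> (Z = A \<or> Z = B)"
    then obtain x y where xy: "x \<in> Z" "x \<notin> A" "y \<in> Z" "y \<notin> B" using AB by blast
    then have "x \<in> affine_space I" "y \<in> affine_space I"
      using zariski_closed_subset[OF assms(1)] by auto
    with xy AB obtain f g where
      f: "f \<in> polynomial_functions I" "f \<in> vanishing A" "f x \<noteq> 0" and
      g: "g \<in> polynomial_functions I" "g \<in> vanishing B" "g y \<noteq> 0"
      using zariski_closed_separates by metis
    obtain z where "z \<in> Z" "f z * g z \<noteq> 0"
      using prime[OF f(1) g(1) xy(1) f(3) xy(3) g(3)] by blast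
    then show False using AB f(2) g(2) by (auto simp: vanishing_def)
  qed
qed

lemma sum_in_ideal: "ideal_over R K \<Longrightarrow> (\<And>i. i \<in> X \<Longrightarrow> f i \<in> K) \<Longrightarrow> sum f X \<in> K"
  by (induction X rule: infinite_finite_induct) (simp_all add: ideal_overD(1,5))

section \<open>Common zeros of ideals of finite codimension\<close>

text \<open>A root of the univariate relation satisfied by the coordinate \<open>i\<close> can be chosen as its value
  without making the ideal improper: otherwise the relation could be divided by all its linear
  factors.\<close>

lemma adjoin_coordinate_value:
  assumes "ideal_over (polynomial_functions I) K" "1 \<notin> K" "i \<in> I"
    "p \<noteq> 0" "(\<lambda>x. poly p (x i)) \<in> K"
  obtains c where "1 \<notin> {k + h * (coord i - const_fun c) |k h. k \<in> K \<and> h \<in> polynomial_functions I}"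
proof -
  note K = ideal_overD[OF assms(1)]
  note pf = polyfun_coord polyfun_const polyfun_minus
    polyfun_times
  have poly_pf: "(\<lambda>x. poly q (x i)) \<in> polynomial_functions I" for q
  proof (induction q)
    case (pCons a q)
    have "(\<lambda>x. poly (pCons a q) (x i)) = const_fun a + coord i * (\<lambda>x. poly q (x i))"
      by (simp add: fun_eq_iff coord_def)
    then show ?case
      using pCons assms(3) by (auto intro!: polyfun_plus pf)
  qed (auto intro: polynomial_functions.const)
  have "\<exists>c. 1 \<notin> {k + h * (coord i - const_fun c) |k h. k \<in> K \<and> h \<in> polynomial_functions I}"
    using assms(4,5)
  proof (induction "degree p" arbitrary: p)
    case 0
    then obtain a where p: "p = [:a:]" "a \<noteq> 0" by (metis degree_eq_zeroE pCons_0_0)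
    have "const_fun (1 / a) * (\<lambda>x. poly p (x i)) \<in> K"
      using 0 K(3) polyfun_const by blast
    also have "const_fun (1 / a) * (\<lambda>x. poly p (x i)) = 1" using p by (simp add: fun_eq_iff)
    finally show ?case using assms(2) by contradiction
  next
    case (Suc d)
    then obtain c where "poly p c = 0"
      using alg_closed_imp_poly_has_root[of p] by auto
    then obtain q where q: "p = [:- c, 1:] * q" by (metis dvdE poly_eq_0_iff_dvd)
    then have "q \<noteq> 0" using Suc.prems by auto
    then have d: "d = degree q" using Suc(2) degree_mult_eq[of "[:- c, 1:]" q] unfolding q by simp
    show ?case
    proof (cases "1 \<in> {k + h * (coord i - const_fun c) |k h. k \<in> K \<and> h \<in> polynomial_functions I}")
      case True
      then obtain k h where kh: "k \<in> K" "h \<in> polynomial_functions I" "1 = k + h * (coord i - const_fun c)"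
        by blast
      \<comment> \<open>Since p = (x_i - c) q, multiplying 1 = k + h (x_i - c) by q exhibits q, a
        polynomial of smaller degree, as an element of \<open>K\<close>.\<close>
      have "(\<lambda>x. poly q (x i)) = (\<lambda>x. poly q (x i)) * (k + h * (coord i - const_fun c))"
        using kh(3) by simp
      also have "\<dots> = (\<lambda>x. poly q (x i)) * k + h * (\<lambda>x. poly p (x i))"
        by (simp add: q fun_eq_iff coord_def algebra_simps)
      also have "\<dots> \<in> K"
        using K(5)[OF K(3)[OF poly_pf kh(1)] K(3)[OF kh(2) Suc.prems(2)]] .
      finally show ?thesis
        using Suc.hyps(1)[OF d \<open>q \<noteq> 0\<close>] by blast
    qed blast
  qed
  then show ?thesis using that by blast
qed

text \<open>A weak Nullstellensatz for ideals modulo which every coordinate is algebraic. Values are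
  assigned to the coordinates one by one while the ideal stays proper. In the end every polynomial
  function is congruent to its value at the resulting point, so an element of \<open>K\<close> with
  a nonzero value there would put 1 into the ideal.\<close>

lemma finite_codimension_common_zero:
  assumes "finite I" "ideal_over (polynomial_functions I) K" "1 \<notin> K" "K \<subseteq> polynomial_functions I"
    and alg: "\<And>i. i \<in> I \<Longrightarrow> \<exists>p. p \<noteq> 0 \<and> (\<lambda>x. poly p (x i)) \<in> K"
  obtains x where "x \<in> affine_space I" "\<And>f. f \<in> K \<Longrightarrow> f x = 0"
proof -
  have "\<exists>J c. ideal_over (polynomial_functions I) J \<and> 1 \<notin> J \<and> K \<subseteq> J \<and>
      (\<forall>i\<in>C. coord i - const_fun (c i) \<in> J)" if "finite C" "C \<subseteq> I" for C
    using that
  proof (induction C)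
    case empty
    show ?case
      by (rule exI[of _ K], intro exI conjI order.refl assms(2,3)) simp
  next
    case (insert i C)
    then obtain J c where J: "ideal_over (polynomial_functions I) J" "1 \<notin> J" "K \<subseteq> J"
      and c: "\<And>j. j \<in> C \<Longrightarrow> coord j - const_fun (c j) \<in> J" by (meson insert_subset)
    from insert.prems have "i \<in> I" by simp
    then obtain p where p: "p \<noteq> 0" "(\<lambda>x. poly p (x i)) \<in> J" using alg[of i] J(3) by blast
    from adjoin_coordinate_value[OF J(1,2) \<open>i \<in> I\<close> p] obtain b where
      b: "1 \<notin> {k + h * (coord i - const_fun b) |k h. k \<in> J \<and> h \<in> polynomial_functions I}" .
    define J' where "J' = {k + h * (coord i - const_fun b) |k h. k \<in> J \<and> h \<in> polynomial_functions I}"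
    have JJ': "k \<in> J'" if "k \<in> J" for k
      unfolding J'_def using that polyfun_0 by (intro CollectI exI[of _ k] exI[of _ 0]) auto
    note Jd = ideal_overD[OF J(1)]
    have "ideal_over (polynomial_functions I) J'"
      unfolding ideal_over_def
    proof (intro conjI ballI)
      show "0 \<in> J'" using JJ' Jd(1) by blast
    next
      fix a a' assume "a \<in> J'" "a' \<in> J'"
      then obtain k h k' h' where "k \<in> J" "k' \<in> J" "h \<in> polynomial_functions I"
        "h' \<in> polynomial_functions I" "a = k + h * (coord i - const_fun b)"
        "a' = k' + h' * (coord i - const_fun b)" unfolding J'_def by blast
      moreover from this(5,6) have "a - a' = (k - k') + (h - h') * (coord i - const_fun b)"
        by (simp only: left_diff_distrib add_diff_add)
      moreover have "k - k' \<in> J" "h - h' \<in> polynomial_functions I"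
        using calculation Jd(2) polyfun_minus by blast+
      ultimately show "a - a' \<in> J'" unfolding J'_def by blast
    next
      fix r a assume "r \<in> polynomial_functions I" "a \<in> J'"
      then obtain k h where "k \<in> J" "h \<in> polynomial_functions I" "r \<in> polynomial_functions I"
        "a = k + h * (coord i - const_fun b)" unfolding J'_def by blast
      moreover from this(4) have "r * a = r * k + (r * h) * (coord i - const_fun b)"
        by (simp only: distrib_left mult.assoc)
      moreover have "r * k \<in> J" "r * h \<in> polynomial_functions I"
        using calculation Jd(3) polyfun_times by blast+
      ultimately show "r * a \<in> J'" unfolding J'_def by blast
    qed
    moreover have "coord i - const_fun b \<in> J'"
      unfolding J'_def using Jd(1) polyfun_1
      by (intro CollectI exI[of _ 0] exI[of _ 1]) auto
    then have "\<forall>j\<in>insert i C. coord j - const_fun ((c(i := b)) j) \<in> J'"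
      using c JJ' insert.hyps by auto
    moreover have "1 \<notin> J'" using b unfolding J'_def .
    moreover have "K \<subseteq> J'" using J(3) JJ' by blast
    ultimately show ?case by blast
  qed
  from this[OF assms(1) order.refl] obtain J c where
    J: "ideal_over (polynomial_functions I) J" "1 \<notin> J" "K \<subseteq> J"
    and c: "\<And>i. i \<in> I \<Longrightarrow> coord i - const_fun (c i) \<in> J" by blast
  note Jd = ideal_overD[OF J(1)]
  define x where "x = restrict c I"
  have eval: "f - const_fun (f x) \<in> J" if "f \<in> polynomial_functions I" for f
    using that
  proof induction
    case (const a)
    show ?case using Jd(1) by (simp only: const_fun_def diff_self)
  next
    case (coordinate i)
    have "x i = c i" using coordinate by (simp add: x_def)
    then show ?case using c[OF coordinate] by (simp only: coord_def)
  next
    case (add f g)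
    have "(\<lambda>x. f x + g x) - const_fun (f x + g x) = (f - const_fun (f x)) + (g - const_fun (g x))"
      by (simp add: fun_eq_iff)
    then show ?case using Jd(5)[OF add.IH] by (simp only:)
  next
    case (mult f g)
    have "(\<lambda>x. f x * g x) - const_fun (f x * g x)
      = g * (f - const_fun (f x)) + const_fun (f x) * (g - const_fun (g x))"
      by (simp add: fun_eq_iff algebra_simps)
    then show ?case
      using Jd(5)[OF Jd(3)[OF mult.hyps(2) mult.IH(1)]
        Jd(3)[OF polyfun_const mult.IH(2)]] by (simp only:)
  qed
  have "f x = 0" if "f \<in> K" for f
  proof (rule ccontr)
    assume nz: "f x \<noteq> 0"
    have "const_fun (1 / f x) * (f - (f - const_fun (f x))) \<in> J"
      using that assms(4) J(3) by (intro Jd(3) Jd(2) polyfun_const eval) auto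
    also have "const_fun (1 / f x) * (f - (f - const_fun (f x))) = 1" using nz by (simp add: fun_eq_iff)
    finally show False using J(2) by contradiction
  qed
  moreover have "x \<in> affine_space I" by (simp add: x_def affine_space_def)
  ultimately show ?thesis using that by blast
qed

text \<open>The powers of the coordinate up to \<open>card E\<close> outnumber the generators.\<close>

lemma univariate_relation:
  assumes "finite E" "ideal_over R K" "range const_fun \<subseteq> R"
    and "\<And>j. coord i ^ j \<in> cspan_mod E K"
  obtains p where "p \<noteq> 0" "(\<lambda>x. poly p (x i)) \<in> K"
proof -
  have "\<exists>M. coord i ^ j - (\<Sum>e\<in>E. const_fun (M e) * e) \<in> K" for j
  proof -
    obtain h where h: "h \<in> lspan (range const_fun) E" "coord i ^ j - h \<in> K"
      using assms(4)[of j] by (auto simp: lspan_mod_def)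
    obtain b where b: "b \<in> E \<rightarrow> range const_fun" "h = (\<Sum>e\<in>E. b e * e)"
      using lspan_finite_rep[OF h(1) rng_closed_constants assms(1)] by blast
    have "\<forall>e\<in>E. \<exists>c. b e = const_fun c" using b(1) by blast
    then obtain M where "\<forall>e\<in>E. b e = const_fun (M e)" by metis
    then have "h = (\<Sum>e\<in>E. const_fun (M e) * e)" using b(2) by simp
    then show ?thesis using h(2) by blast
  qed
  then obtain M where M: "\<And>j. coord i ^ j - (\<Sum>e\<in>E. const_fun (M j e) * e) \<in> K" by metis
  obtain c where c: "\<exists>j\<in>{..card E}. c j \<noteq> 0" "\<And>e. e \<in> E \<Longrightarrow> (\<Sum>j\<in>{..card E}. c j * M j e) = 0"
    using underdetermined_system[OF assms(1), of "{..card E}" M] by auto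
  define p where "p = (\<Sum>j\<in>{..card E}. Polynomial.monom (c j) j)"
  have "coeff p j = c j" if "j \<le> card E" for j
    using that by (simp add: p_def coeff_sum)
  then have "p \<noteq> 0" using c(1) by force
  moreover have "(\<lambda>x. poly p (x i))
      = (\<Sum>j\<in>{..card E}. const_fun (c j) * (coord i ^ j - (\<Sum>e\<in>E. const_fun (M j e) * e)))"
  proof
    fix x
    have "(\<Sum>j\<in>{..card E}. c j * (\<Sum>e\<in>E. M j e * e x)) = (\<Sum>e\<in>E. (\<Sum>j\<in>{..card E}. c j * M j e) * e x)"
      unfolding sum_distrib_left sum_distrib_right
      by (subst sum.swap) (simp add: mult.assoc)
    also have "\<dots> = 0" using c(2) by simp
    finally show "poly p (x i)
      = (\<Sum>j\<in>{..card E}. const_fun (c j) * (coord i ^ j - (\<Sum>e\<in>E. const_fun (M j e) * e))) x"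
      by (simp add: p_def poly_sum poly_monom sum_fun_apply power_fun_apply coord_def
          right_diff_distrib sum_subtractf)
  qed
  moreover have "(\<Sum>j\<in>{..card E}. const_fun (c j) * (coord i ^ j - (\<Sum>e\<in>E. const_fun (M j e) * e))) \<in> K"
  proof -
    note K = ideal_overD[OF assms(2)]
    have "const_fun (c j) * (coord i ^ j - (\<Sum>e\<in>E. const_fun (M j e) * e)) \<in> K" for j
      using assms(3) M by (intro K(3)) auto
    then show ?thesis
      using K(1,5) by (intro sum_in_ideal[OF assms(2)])
  qed
  ultimately show ?thesis using that[of p] by (simp only: not_False_eq_True)
qed

section \<open>Finite covers of affine space\<close>

definition fibre_monomial :: "(nat \<Rightarrow> 'i) \<Rightarrow> nat \<Rightarrow> (nat \<Rightarrow> nat) \<Rightarrow> ('i \<Rightarrow> complex) \<Rightarrow> complex" where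
  "fibre_monomial r n L = (\<Prod>k<n. coord (r k) ^ L k)"

text \<open>A filtration by the degree in the fibre coordinates alone: functions on the base count
  as degree 0, whatever their own degree.\<close>

definition fibre_deg_le :: "'i set \<Rightarrow> (nat \<Rightarrow> 'i) \<Rightarrow> nat \<Rightarrow> nat \<Rightarrow> (('i \<Rightarrow> complex) \<Rightarrow> complex) set" where
  "fibre_deg_le I0 r n N
     = lspan (polynomial_functions I0) (fibre_monomial r n ` {L. (\<Sum>k<n. L k) \<le> N})"

lemma fibre_monomial_times:
  "fibre_monomial r n L * fibre_monomial r n L' = fibre_monomial r n (\<lambda>k. L k + L' k)"
  by (simp add: fibre_monomial_def power_add prod.distrib)

lemma fibre_monomial_0: "fibre_monomial r n (\<lambda>k. 0) = 1"
  by (simp add: fibre_monomial_def)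

lemma fibre_monomial_cong:
  "(\<And>k. k < n \<Longrightarrow> L k = L' k) \<Longrightarrow> fibre_monomial r n L = fibre_monomial r n L'"
  unfolding fibre_monomial_def by (intro prod.cong) auto

lemma fibre_monomial_single:
  assumes "k < n"
  shows "fibre_monomial r n (\<lambda>j. if j = k then e else 0) = coord (r k) ^ e"
proof -
  have "fibre_monomial r n (\<lambda>j. if j = k then e else 0)
      = (\<Prod>j<n. if j = k then coord (r k) ^ e else 1)"
    unfolding fibre_monomial_def by (intro prod.cong) auto
  then show ?thesis using assms by simp
qed

lemma fibre_monomial_polynomial: "fibre_monomial r n L \<in> polynomial_functions (I0 \<union> r ` {..<n})"
  unfolding fibre_monomial_def
  by (intro polyfun_prod polyfun_power polyfun_coord) auto

lemma fibre_deg_le_add: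
  "f \<in> fibre_deg_le I0 r n N \<Longrightarrow> g \<in> fibre_deg_le I0 r n N \<Longrightarrow> f + g \<in> fibre_deg_le I0 r n N"
  unfolding fibre_deg_le_def by (rule lspan_add)

lemma fibre_deg_le_sum:
  "(\<And>i. i \<in> X \<Longrightarrow> f i \<in> fibre_deg_le I0 r n N) \<Longrightarrow> sum f X \<in> fibre_deg_le I0 r n N"
  unfolding fibre_deg_le_def by (rule lspan_sum)

lemma fibre_deg_le_mono: "N \<le> N' \<Longrightarrow> fibre_deg_le I0 r n N \<subseteq> fibre_deg_le I0 r n N'"
  unfolding fibre_deg_le_def by (intro lspan_mono) auto

lemma fibre_deg_le_base:
  assumes "a \<in> polynomial_functions I0"
  shows "a \<in> fibre_deg_le I0 r n N"
proof -
  have "a * fibre_monomial r n (\<lambda>k. 0) \<in> fibre_deg_le I0 r n N"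
    unfolding fibre_deg_le_def by (intro lspan_mult_gen assms) auto
  then show ?thesis by (simp add: fibre_monomial_0)
qed

lemma fibre_deg_le_coord:
  assumes "k < n"
  shows "coord (r k) \<in> fibre_deg_le I0 r n 1"
proof -
  have "fibre_monomial r n (\<lambda>j. if j = k then 1 else 0) \<in> fibre_deg_le I0 r n 1"
    unfolding fibre_deg_le_def using assms
    by (intro lspan_gen polyfun_1) auto
  then show ?thesis using fibre_monomial_single[OF assms, of r 1] by simp
qed

lemma ideal_over_0: "ideal_over R {0}"
  by (auto simp: ideal_over_def)

lemma lspan_mod_0: "lspan_mod A T {0} = lspan A T"
  by (auto simp: lspan_mod_def)

lemma fibre_deg_le_times:
  assumes "f \<in> fibre_deg_le I0 r n N" "g \<in> fibre_deg_le I0 r n M"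
  shows "f * g \<in> fibre_deg_le I0 r n (N + M)"
proof -
  have "f * g \<in> lspan_mod (polynomial_functions I0) (fibre_monomial r n ` {L. (\<Sum>k<n. L k) \<le> N + M}) {0}"
  proof (rule lspan_mod_times[where R = UNIV])
    show "f \<in> lspan (polynomial_functions I0) (fibre_monomial r n ` {L. (\<Sum>k<n. L k) \<le> N})"
      using assms(1) by (simp add: fibre_deg_le_def)
    show "g \<in> lspan_mod (polynomial_functions I0) (fibre_monomial r n ` {L. (\<Sum>k<n. L k) \<le> M}) {0}"
      using assms(2) by (simp add: fibre_deg_le_def lspan_mod_0)
    fix a t a' t'
    assume "a \<in> polynomial_functions I0" "a' \<in> polynomial_functions I0"
      "t \<in> fibre_monomial r n ` {L. (\<Sum>k<n. L k) \<le> N}" "t' \<in> fibre_monomial r n ` {L. (\<Sum>k<n. L k) \<le> M}"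
    then obtain L L' where LL': "(\<Sum>k<n. L k) \<le> N" "(\<Sum>k<n. L' k) \<le> M"
      "t = fibre_monomial r n L" "t' = fibre_monomial r n L'" by auto
    have "(a * a') * fibre_monomial r n (\<lambda>k. L k + L' k)
        \<in> lspan (polynomial_functions I0) (fibre_monomial r n ` {L. (\<Sum>k<n. L k) \<le> N + M})"
      using LL' \<open>a \<in> _\<close> \<open>a' \<in> _\<close>
      by (intro lspan_mult_gen polyfun_times) (auto simp: sum.distrib)
    also have "(a * a') * fibre_monomial r n (\<lambda>k. L k + L' k) = a * t * (a' * t')"
      unfolding LL' fibre_monomial_times[symmetric] by (simp only: ac_simps)
    finally show "a * t * (a' * t')
        \<in> lspan_mod (polynomial_functions I0) (fibre_monomial r n ` {L. (\<Sum>k<n. L k) \<le> N + M}) {0}"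
      by (simp only: lspan_mod_0)
  qed (auto simp: ideal_over_0 rng_closed_def)
  then show ?thesis by (simp add: fibre_deg_le_def lspan_mod_0)
qed

lemma fibre_deg_le_prod:
  assumes "finite X" "\<And>i. i \<in> X \<Longrightarrow> f i \<in> fibre_deg_le I0 r n (N i)"
  shows "prod f X \<in> fibre_deg_le I0 r n (sum N X)"
  using assms
  by (induction X) (auto intro: fibre_deg_le_base polyfun_1 fibre_deg_le_times)

lemma fibre_deg_le_exhaust:
  assumes "f \<in> polynomial_functions (I0 \<union> r ` {..<n})"
  obtains N where "f \<in> fibre_deg_le I0 r n N"
proof -
  have "\<exists>N. f \<in> fibre_deg_le I0 r n N"
    using assms
  proof induction
    case (const c)
    show ?case by (intro exI[of _ 0] fibre_deg_le_base polynomial_functions.const)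
  next
    case (coordinate i)
    then consider "i \<in> I0" | k where "k < n" "i = r k" by auto
    then show ?case
    proof cases
      case 1
      then show ?thesis by (intro exI[of _ 0] fibre_deg_le_base polynomial_functions.coordinate)
    next
      case 2
      then show ?thesis
        using fibre_deg_le_coord[of k n r I0] unfolding coord_def by (intro exI[of _ 1]) simp
    qed
  next
    case (add f g)
    then obtain N M where "f \<in> fibre_deg_le I0 r n N" "g \<in> fibre_deg_le I0 r n M" by auto
    then have "f + g \<in> fibre_deg_le I0 r n (max N M)"
      using fibre_deg_le_mono[of N "max N M" I0 r n] fibre_deg_le_mono[of M "max N M" I0 r n]
      by (intro fibre_deg_le_add) auto
    then show ?case unfolding plus_fun_def by (rule exI)
  next
    case (mult f g)
    then obtain N M where "f \<in> fibre_deg_le I0 r n N" "g \<in> fibre_deg_le I0 r n M" by auto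
    then have "f * g \<in> fibre_deg_le I0 r n (N + M)" by (rule fibre_deg_le_times)
    then show ?case unfolding times_fun_def by (rule exI)
  qed
  then show ?thesis using that by blast
qed

text \<open>A monomial substitution that keeps the order by total degree and separates all monomials of
  degree at most \<open>N\<close>.\<close>

definition kron_weight :: "nat \<Rightarrow> nat \<Rightarrow> (nat \<Rightarrow> nat) \<Rightarrow> nat" where
  "kron_weight n N L = (\<Sum>k<n. L k * (N * (N + 1) ^ n + 1 + (N + 1) ^ k))"

text \<open>Digits are recovered from the top: the last one is the quotient by the highest power of
  \<open>b\<close>, since all lower digits together contribute less than that power.\<close>

lemma base_expansion_inj:
  fixes L L' :: "nat \<Rightarrow> nat"
  assumes "(\<Sum>k<n. L k * b ^ k) = (\<Sum>k<n. L' k * b ^ k)" "\<And>k. k < n \<Longrightarrow> L k < b" "\<And>k. k < n \<Longrightarrow> L' k < b"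
    and "k < n"
  shows "L k = L' k"
  using assms
proof (induction n arbitrary: k)
  case (Suc n)
  have bound: "(\<Sum>k<n. M k * b ^ k) < b ^ n" if "\<And>k. k < Suc n \<Longrightarrow> M k < b" for M :: "nat \<Rightarrow> nat" and n
    using that
  proof (induction n)
    case (Suc n)
    then have "(\<Sum>k<n. M k * b ^ k) < b ^ n" "M n + 1 \<le> b" by (auto simp: Suc_leI)
    then have "(\<Sum>k<n. M k * b ^ k) + M n * b ^ n < (M n + 1) * b ^ n" by simp
    also have "\<dots> \<le> b * b ^ n" using \<open>M n + 1 \<le> b\<close> by (intro mult_right_mono) auto
    finally show ?case by simp
  qed simp
  have eq: "(\<Sum>k<n. L k * b ^ k) + L n * b ^ n = (\<Sum>k<n. L' k * b ^ k) + L' n * b ^ n"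
    using Suc.prems(1) by simp
  have "b > 0" using Suc.prems(2)[of 0] by simp
  note bd = bound[of n L, OF Suc.prems(2)] bound[of n L', OF Suc.prems(3)]
  have "L n = ((\<Sum>k<n. L k * b ^ k) + L n * b ^ n) div b ^ n"
    using bd(1) \<open>b > 0\<close> by (subst div_mult_self1) auto
  moreover have "L' n = ((\<Sum>k<n. L' k * b ^ k) + L' n * b ^ n) div b ^ n"
    using bd(2) \<open>b > 0\<close> by (subst div_mult_self1) auto
  ultimately have n: "L n = L' n" using eq by simp
  show ?case
  proof (cases "k = n")
    case False
    show ?thesis
    proof (rule Suc.IH)
      show "(\<Sum>k<n. L k * b ^ k) = (\<Sum>k<n. L' k * b ^ k)" using eq n by simp
      show "k < n" using False Suc.prems(4) by simp
    qed (use Suc.prems in auto)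
  qed (simp add: n)
qed simp

text \<open>For total degree at most \<open>N\<close> the second sum is smaller than the factor of
  the first. Division by this factor therefore separates the total degree, as quotient, from the
  exponents read as digits in base N + 1, as remainder.\<close>

lemma kron_weight_eq:
  "kron_weight n N L = (N * (N + 1) ^ n + 1) * (\<Sum>k<n. L k) + (\<Sum>k<n. L k * (N + 1) ^ k)"
proof -
  have "(\<Sum>k<n. L k * (w + b ^ k)) = w * (\<Sum>k<n. L k) + (\<Sum>k<n. L k * b ^ k)" for w b :: nat
    by (simp add: distrib_left sum.distrib sum_distrib_left mult.commute)
  then show ?thesis unfolding kron_weight_def .
qed

lemma kron_low_bound:
  fixes N :: nat
  assumes "(\<Sum>k<n. L k) \<le> N"
  shows "(\<Sum>k<n. L k * (N + 1) ^ k) < N * (N + 1) ^ n + 1"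
proof -
  have "(\<Sum>k<n. L k * (N + 1) ^ k) \<le> (\<Sum>k<n. L k * (N + 1) ^ n)"
    by (rule sum_mono) (auto intro!: mult_left_mono power_increasing simp del: power_Suc)
  also have "\<dots> \<le> N * (N + 1) ^ n"
    unfolding sum_distrib_right[symmetric] using assms by (intro mult_right_mono) auto
  finally show ?thesis by simp
qed

lemma kron_weight_less:
  assumes "(\<Sum>k<n. L k) < (\<Sum>k<n. L' k)" "(\<Sum>k<n. L' k) \<le> N"
  shows "kron_weight n N L < kron_weight n N L'"
proof -
  have "kron_weight n N L < (N * (N + 1) ^ n + 1) * ((\<Sum>k<n. L k) + 1)"
    using kron_low_bound[of L n N] assms by (simp add: kron_weight_eq)
  also have "\<dots> \<le> (N * (N + 1) ^ n + 1) * (\<Sum>k<n. L' k)"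
    using assms by (intro mult_left_mono) auto
  also have "\<dots> \<le> kron_weight n N L'" by (simp add: kron_weight_eq)
  finally show ?thesis .
qed

lemma kron_weight_inj:
  assumes "kron_weight n N L = kron_weight n N L'" "(\<Sum>k<n. L k) \<le> N" "(\<Sum>k<n. L' k) \<le> N" "k < n"
  shows "L k = L' k"
proof -
  define W where "W = N * (N + 1) ^ n + 1"
  have "(\<Sum>k<n. M k * (N + 1) ^ k) = kron_weight n N M mod W" if "(\<Sum>k<n. M k) \<le> N" for M
    using kron_low_bound[OF that] unfolding kron_weight_eq W_def[symmetric] by simp
  from this[OF assms(2)] this[OF assms(3)]
  have eq: "(\<Sum>k<n. L k * (N + 1) ^ k) = (\<Sum>k<n. L' k * (N + 1) ^ k)"
    unfolding assms(1) by (simp only:)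
  have "M k < N + 1" if "(\<Sum>k<n. M k) \<le> N" "k < n" for M :: "nat \<Rightarrow> nat" and k
    using member_le_sum[of k "{..<n}" M] that by simp
  then show ?thesis using base_expansion_inj[OF eq _ _ assms(4)] assms(2,3) by blast
qed

text \<open>The term of largest degree cannot cancel, and that degree is positive.\<close>

lemma sum_distinct_degrees_neq_1:
  fixes p :: "'t \<Rightarrow> complex poly"
  assumes "finite F" "F \<noteq> {}" "\<And>t. t \<in> F \<Longrightarrow> c t \<noteq> 0" "\<And>t. t \<in> F \<Longrightarrow> degree (p t) \<ge> 1"
    "inj_on (\<lambda>t. degree (p t)) F"
  shows "(\<Sum>t\<in>F. Polynomial.smult (c t) (p t)) \<noteq> 1"
proof -
  define D where "D = Max ((\<lambda>t. degree (p t)) ` F)"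
  have "D \<in> (\<lambda>t. degree (p t)) ` F" unfolding D_def using assms(1,2) by (intro Max_in) auto
  then obtain t0 where t0: "t0 \<in> F" "degree (p t0) = D" by auto
  have "coeff (p t) D = 0" if "t \<in> F - {t0}" for t
  proof (rule coeff_eq_0)
    have "degree (p t) \<le> D" unfolding D_def using assms(1) that by (intro Max_ge) auto
    moreover have "degree (p t) \<noteq> D" using that t0 inj_onD[OF assms(5), of t t0] by auto
    ultimately show "degree (p t) < D" by simp
  qed
  then have "coeff (\<Sum>t\<in>F. Polynomial.smult (c t) (p t)) D = c t0 * coeff (p t0) D"
    using assms(1) t0(1) by (simp add: coeff_sum sum.remove[of F t0])
  also have "\<dots> \<noteq> 0" using assms(3,4)[OF t0(1)] t0 by (auto simp: leading_coeff_0_iff)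
  finally have "coeff (\<Sum>t\<in>F. Polynomial.smult (c t) (p t)) D \<noteq> 0" .
  moreover have "D \<ge> 1" using assms(4)[OF t0(1)] t0(2) by simp
  then have "coeff (1 :: complex poly) D = 0" by simp
  ultimately show ?thesis by metis
qed

text \<open>The remainder of \<open>f k\<close> is bounded in the total degree of all fibre
  coordinates. A bound in \<open>r k\<close> alone would not give nonempty fibres: x - y and y - x -
  1 are each monic in their own coordinate and have no common zero.\<close>

locale finite_cover =
  fixes I0 :: "'i set" and r :: "nat \<Rightarrow> 'i" and n :: nat and m :: "nat \<Rightarrow> nat"
    and f :: "nat \<Rightarrow> ('i \<Rightarrow> complex) \<Rightarrow> complex"
  assumes finite_base: "finite I0"
    and inj: "inj_on r {..<n}"
    and disjoint: "r ` {..<n} \<inter> I0 = {}"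
    and pos: "k < n \<Longrightarrow> m k \<ge> 1"
    and leading: "k < n \<Longrightarrow> f k - coord (r k) ^ m k \<in> fibre_deg_le I0 r n (m k - 1)"
begin

section \<open>Functions on the cover as a finite module over the base\<close>

definition "indices = I0 \<union> r ` {..<n}"

abbreviation "base_funs \<equiv> polynomial_functions I0"
abbreviation "total_funs \<equiv> polynomial_functions indices"
abbreviation "monomial \<equiv> fibre_monomial r n"

definition "reduced_set = monomial ` {L. \<forall>k<n. L k < m k}"

lemma finite_indices: "finite indices"
  by (simp add: indices_def finite_base)

lemma base_subset: "base_funs \<subseteq> total_funs"
  by (rule polyfun_mono) (auto simp: indices_def)

lemma monomial_total: "monomial L \<in> total_funs"
  unfolding indices_def by (rule fibre_monomial_polynomial)

lemma fibre_deg_le_total: "fibre_deg_le I0 r n N \<subseteq> total_funs"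
proof
  fix g assume "g \<in> fibre_deg_le I0 r n N"
  then show "g \<in> total_funs"
    unfolding fibre_deg_le_def
    by (rule lspan_least)
      (use base_subset monomial_total polyfun_0 polyfun_plus
        polyfun_times in blast)+
qed

lemma equation_total: "k < n \<Longrightarrow> f k \<in> total_funs"
proof -
  assume k: "k < n"
  have "f k = (f k - coord (r k) ^ m k) + coord (r k) ^ m k" by simp
  moreover have "coord (r k) ^ m k \<in> total_funs"
    using k by (intro polyfun_power polyfun_coord) (auto simp: indices_def)
  ultimately show ?thesis
    using leading[OF k] fibre_deg_le_total polyfun_plus by (metis subsetD)
qed

lemma finite_reduced_set: "finite reduced_set"
proof -
  have "reduced_set \<subseteq> monomial ` (\<Pi>\<^sub>E k\<in>{..<n}. {..<m k})"
  proof
    fix t assume "t \<in> reduced_set"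
    then obtain L where L: "\<forall>k<n. L k < m k" "t = monomial L" by (auto simp: reduced_set_def)
    then have "t = monomial (restrict L {..<n})" by (auto intro: fibre_monomial_cong)
    moreover have "restrict L {..<n} \<in> (\<Pi>\<^sub>E k\<in>{..<n}. {..<m k})" using L by auto
    ultimately show "t \<in> monomial ` (\<Pi>\<^sub>E k\<in>{..<n}. {..<m k})" by blast
  qed
  then show ?thesis by (rule finite_subset) (auto intro!: finite_imageI finite_PiE)
qed

lemma one_reduced: "1 \<in> reduced_set"
  unfolding reduced_set_def using pos
  by (intro image_eqI[of _ _ "\<lambda>_. 0"]) (auto simp: fibre_monomial_0 Suc_le_eq)

lemma reduced_set_total: "reduced_set \<subseteq> total_funs"
  by (auto simp: reduced_set_def monomial_total)

lemma monomial_split: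
  assumes "k < n" "m k \<le> L k"
  shows "monomial L = monomial (L(k := L k - m k)) * coord (r k) ^ m k"
    and "(\<Sum>j<n. (L(k := L k - m k)) j) + m k = (\<Sum>j<n. L j)"
proof -
  have "L = (\<lambda>j. (L(k := L k - m k)) j + (if j = k then m k else 0))"
    using assms by (auto simp: fun_eq_iff)
  then have "monomial L = monomial (\<lambda>j. (L(k := L k - m k)) j + (if j = k then m k else 0))"
    by metis
  then show "monomial L = monomial (L(k := L k - m k)) * coord (r k) ^ m k"
    unfolding fibre_monomial_times[symmetric] fibre_monomial_single[OF assms(1)] .
  have "(\<Sum>j<n. L j) = (\<Sum>j<n. (L(k := L k - m k)) j + (if j = k then m k else 0))"
    using assms by (intro sum.cong) auto
  then show "(\<Sum>j<n. (L(k := L k - m k)) j) + m k = (\<Sum>j<n. L j)"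
    using assms(1) by (simp add: sum.distrib)
qed

text \<open>When an exponent reaches \<open>m k\<close>, the leading power of \<open>f k\<close> is
  split off and replaced by minus the remainder of \<open>f k\<close>. Every monomial that arises
  has smaller total degree.\<close>

lemma monomial_reduction:
  assumes K: "ideal_over total_funs K" "\<And>k. k < n \<Longrightarrow> f k \<in> K"
  shows "monomial L \<in> lspan_mod base_funs reduced_set K"
proof (induction "\<Sum>k<n. L k" arbitrary: L rule: less_induct)
  case less
  show ?case
  proof (cases "\<forall>k<n. L k < m k")
    case True
    then show ?thesis
      by (intro lspan_subset_mod[OF K(1)] lspan_gen polyfun_1)
        (auto simp: reduced_set_def)
  next
    case False
    then obtain k where k: "k < n" "m k \<le> L k" by (auto simp: not_less)
    define L' where "L' = L(k := L k - m k)"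
    note split = monomial_split[of k L, OF k, folded L'_def]
    define g where "g = f k - coord (r k) ^ m k"
    have "monomial L' * g \<in> lspan_mod base_funs reduced_set K"
    proof -
      have "monomial L' * g \<in> fibre_deg_le I0 r n ((\<Sum>j<n. L' j) + (m k - 1))"
        unfolding g_def using k leading
        by (intro fibre_deg_le_times) (auto simp: fibre_deg_le_def intro!: lspan_gen polyfun_1)
      then show ?thesis
        unfolding fibre_deg_le_def
      proof (rule lspan_mod_least[OF K(1)])
        fix a t assume a: "a \<in> base_funs"
          and "t \<in> monomial ` {L. (\<Sum>j<n. L j) \<le> (\<Sum>j<n. L' j) + (m k - 1)}"
        then obtain M where M: "t = monomial M" "(\<Sum>j<n. M j) \<le> (\<Sum>j<n. L' j) + (m k - 1)" by auto
        then have "(\<Sum>j<n. M j) < (\<Sum>j<n. L j)" using split(2) pos[OF k(1)] by linarith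
        then have "monomial M \<in> lspan_mod base_funs reduced_set K" by (rule less)
        from lspan_mod_scale[OF K(1) _ this, of a]
        show "a * t \<in> lspan_mod base_funs reduced_set K"
          unfolding M(1) using a base_subset polyfun_times by blast
      qed
    qed
    then have "- (monomial L' * g) \<in> lspan_mod base_funs reduced_set K"
      by (rule lspan_mod_uminus[OF K(1) rng_closed_polyfun])
    moreover have "monomial L - (- (monomial L' * g)) = monomial L' * f k"
      unfolding split(1) g_def by (simp only: right_diff_distrib) simp
    then have "monomial L - (- (monomial L' * g)) \<in> K"
      using ideal_overD(3)[OF K(1) monomial_total K(2)[OF k(1)]] by simp
    ultimately show ?thesis by (rule lspan_mod_cong[OF K(1)])
  qed
qed

lemma total_funs_reduction:
  assumes "ideal_over total_funs K" "\<And>k. k < n \<Longrightarrow> f k \<in> K" "h \<in> total_funs"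
  shows "h \<in> lspan_mod base_funs reduced_set K"
proof -
  obtain N where "h \<in> fibre_deg_le I0 r n N"
    using fibre_deg_le_exhaust assms(3) unfolding indices_def by blast
  then show ?thesis
    unfolding fibre_deg_le_def
  proof (rule lspan_mod_least[OF assms(1)])
    fix a t assume a: "a \<in> base_funs" and "t \<in> monomial ` {L. (\<Sum>j<n. L j) \<le> N}"
    then obtain L where L: "t = monomial L" by auto
    show "a * t \<in> lspan_mod base_funs reduced_set K"
      unfolding L
      by (rule lspan_mod_scale[OF assms(1) _ monomial_reduction[OF assms(1,2)]])
        (use a base_subset polyfun_times in auto)
  qed
qed

text \<open>Over a single base point \<open>s\<close> a function on the base may be replaced by its
  value at \<open>s\<close>, because the difference vanishes at \<open>s\<close> and so lies in
  \<open>K\<close>.\<close>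

lemma lspan_base_constants:
  assumes K: "ideal_over total_funs K" "\<And>a. a \<in> base_funs \<Longrightarrow> a s = 0 \<Longrightarrow> a \<in> K"
    and "T \<subseteq> total_funs" "h \<in> lspan_mod base_funs T K"
  shows "h \<in> cspan_mod T K"
proof -
  obtain h' where h': "h' \<in> lspan base_funs T" "h - h' \<in> K"
    using assms(4) by (auto simp: lspan_mod_def)
  have "h' \<in> cspan_mod T K"
    using h'(1)
  proof (rule lspan_mod_least[OF K(1)])
    fix a t assume at: "a \<in> base_funs" "t \<in> T"
    have "a - const_fun (a s) \<in> K"
      using at(1) by (intro K(2) polyfun_minus polyfun_const) auto
    then have "t * (a - const_fun (a s)) \<in> K"
      using assms(3) at(2) by (intro ideal_overD(3)[OF K(1)]) auto
    also have "t * (a - const_fun (a s)) = a * t - const_fun (a s) * t"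
      by (simp only: right_diff_distrib mult.commute)
    finally have "a * t - const_fun (a s) * t \<in> K" .
    moreover have "const_fun (a s) * t \<in> lspan (range const_fun) T"
      using at(2) by (intro lspan_mult_gen) auto
    ultimately show "a * t \<in> cspan_mod T K"
      by (intro lspan_modI)
  qed
  then show ?thesis using h'(2) by (rule lspan_mod_cong[OF K(1)])
qed

text \<open>Over one base point the polynomial functions modulo \<open>K\<close> form a space of
  finite dimension, spanned by the reduced monomials, so the powers of a coordinate become
  dependent.\<close>

lemma coordinate_relation:
  assumes "ideal_over total_funs K" "\<And>k. k < n \<Longrightarrow> f k \<in> K"
    "\<And>a. a \<in> base_funs \<Longrightarrow> a s = 0 \<Longrightarrow> a \<in> K" "i \<in> indices"
  obtains p where "p \<noteq> 0" "(\<lambda>x. poly p (x i)) \<in> K"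
proof (rule univariate_relation[OF finite_reduced_set assms(1) constants_subset])
  show "coord i ^ j \<in> cspan_mod reduced_set K" for j
    using assms(4)
    by (intro lspan_base_constants[OF assms(1,3)] reduced_set_total
        total_funs_reduction[OF assms(1,2)] polyfun_power polyfun_coord)
qed

lemma proper_ideal_zero:
  assumes "ideal_over total_funs K" "K \<subseteq> total_funs" "\<And>k. k < n \<Longrightarrow> f k \<in> K"
    "\<And>a. a \<in> base_funs \<Longrightarrow> a s = 0 \<Longrightarrow> a \<in> K" "1 \<notin> K"
  obtains x where "x \<in> affine_space indices" "\<And>h. h \<in> K \<Longrightarrow> h x = 0" "\<And>i. i \<in> I0 \<Longrightarrow> x i = s i"
proof -
  obtain x where x: "x \<in> affine_space indices" "\<And>h. h \<in> K \<Longrightarrow> h x = 0"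
    using finite_codimension_common_zero[OF finite_indices assms(1,5,2)]
      coordinate_relation[OF assms(1,3,4)] by metis
  moreover have "x i = s i" if "i \<in> I0" for i
  proof -
    have "coord i - const_fun (s i) \<in> K"
      using that by (intro assms(4) polyfun_minus polyfun_const polyfun_coord) auto
    then have "(coord i - const_fun (s i)) x = 0" by (rule x(2))
    then show ?thesis by simp
  qed
  ultimately show ?thesis using that by blast
qed

definition "cover = {x \<in> affine_space indices. \<forall>k<n. f k x = 0}"

text \<open>Taking for \<open>K\<close> all functions that vanish on the fibre shows that each
  coordinate has only finitely many values there.\<close>

lemma finite_fibre: "finite {x \<in> cover. restrict x I0 = s}" (is "finite ?X")
proof -
  have eqs: "f k \<in> vanishing ?X" if "k < n" for k
    using that by (auto simp: vanishing_def cover_def)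
  have base: "a \<in> vanishing ?X" if "a \<in> base_funs" "a s = 0" for a
    using that polyfun_restrict[OF that(1)] by (auto simp: vanishing_def)
  have "\<exists>p. p \<noteq> 0 \<and> (\<lambda>x. poly p (x i)) \<in> vanishing ?X" if "i \<in> indices" for i
    by (rule coordinate_relation[OF ideal_vanishing eqs base that], assumption+) (intro exI conjI)
  then have "\<forall>i\<in>indices. \<exists>p. p \<noteq> 0 \<and> (\<lambda>x. poly p (x i)) \<in> vanishing ?X" by blast
  from bchoice[OF this] obtain p where
    p: "\<And>i. i \<in> indices \<Longrightarrow> p i \<noteq> 0 \<and> (\<lambda>x. poly (p i) (x i)) \<in> vanishing ?X" by blast
  have "?X \<subseteq> (\<Pi>\<^sub>E i\<in>indices. {z. poly (p i) z = 0})"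
    using p by (auto simp: vanishing_def cover_def affine_space_def PiE_iff extensional_def)
  moreover have "finite (\<Pi>\<^sub>E i\<in>indices. {z. poly (p i) z = 0})"
    using p finite_indices by (intro finite_PiE) (auto simp: poly_roots_finite)
  ultimately show ?thesis by (rule finite_subset)
qed

section \<open>Fibres are nonempty\<close>

text \<open>Modulo the functions vanishing on a fibre, the ideal generated by the equations is spanned by
  the following multiples. Their leading monomials are pairwise distinct, so that no linear
  combination of them equals \<open>1\<close>.\<close>

definition "std_multiples = {monomial L * f k |L k. k < n \<and> (\<forall>j<k. L j < m j)}"

lemma multiples_total: "k < n \<Longrightarrow> monomial L * f k \<in> total_funs"
  by (intro polyfun_times monomial_total equation_total)

lemma lower_terms_constants:
  assumes "ideal_over total_funs K" "\<And>a. a \<in> base_funs \<Longrightarrow> a s = 0 \<Longrightarrow> a \<in> K" "k < n"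
  shows "f k - coord (r k) ^ m k \<in> cspan_mod (monomial ` {L. (\<Sum>j<n. L j) \<le> m k - 1}) K"
proof (rule lspan_base_constants[OF assms(1,2)])
  show "f k - coord (r k) ^ m k \<in> lspan_mod base_funs (monomial ` {L. (\<Sum>j<n. L j) \<le> m k - 1}) K"
    using leading[OF assms(3)] unfolding fibre_deg_le_def by (rule lspan_subset_mod[OF assms(1)])
qed (auto simp: monomial_total)

lemma lspan_mod_constants_times:
  assumes K: "ideal_over total_funs K" and "g \<in> total_funs" "h \<in> cspan_mod T K"
    "\<And>t. t \<in> T \<Longrightarrow> g * t \<in> cspan_mod T' K"
  shows "g * h \<in> cspan_mod T' K"
proof -
  obtain h' where h': "h' \<in> lspan (range const_fun) T" "h - h' \<in> K"
    using assms(3) by (auto simp: lspan_mod_def)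
  have "g * h' \<in> cspan_mod T' K"
  proof (rule lspan_mod_mult_least[OF K h'(1)])
    fix a t :: "('i \<Rightarrow> complex) \<Rightarrow> complex" assume a: "a \<in> range const_fun" and t: "t \<in> T"
    have "a * (g * t) \<in> cspan_mod T' K"
      using a constants_subset rng_closedD(3)[OF rng_closed_constants a]
      by (intro lspan_mod_scale[OF K _ assms(4)[OF t]]) blast+
    then show "g * (a * t) \<in> cspan_mod T' K"
      by (simp only: mult.left_commute)
  qed
  moreover have "g * h - g * h' \<in> K"
    using ideal_overD(3)[OF K assms(2) h'(2)] by (simp only: right_diff_distrib)
  ultimately show ?thesis by (rule lspan_mod_cong[OF K])
qed

text \<open>The identity f_j f_k = f_k f_j serves as a rewriting rule. A multiple of
  \<open>f k\<close> whose monomial is divisible by the leading power of an earlier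
  \<open>f j\<close> is exchanged for a multiple of \<open>f j\<close> with the same leading
  monomial, and the correction terms have smaller total degree.\<close>

lemma multiple_standard:
  assumes K: "ideal_over total_funs K" "\<And>a. a \<in> base_funs \<Longrightarrow> a s = 0 \<Longrightarrow> a \<in> K" and "k < n"
  shows "monomial L * f k \<in> cspan_mod std_multiples K"
  using assms(3)
proof (induction "(\<Sum>j<n. L j) + m k" arbitrary: L k rule: less_induct)
  case less
  show ?case
  proof (cases "\<forall>j<k. L j < m j")
    case True
    then have "monomial L * f k \<in> std_multiples"
      using less.prems unfolding std_multiples_def by blast
    then show ?thesis by (intro lspan_subset_mod[OF K(1)] lspan_gen one_in_constants)
  next
    case False
    \<comment> \<open>The total degree of the exchanged multiple \<open>monomial L2 * f j\<close>
      has not dropped, so the induction hypothesis does not reach it. Choosing the least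
      \<open>j\<close> makes it standard at once.\<close>
    define j where "j = (LEAST j. j < k \<and> m j \<le> L j)"
    have j: "j < k" "m j \<le> L j"
      using False LeastI_ex[of "\<lambda>j. j < k \<and> m j \<le> L j"] by (auto simp: j_def not_less)
    have least: "L i < m i" if "i < j" for i
      using not_less_Least[of i "\<lambda>j. j < k \<and> m j \<le> L j"] that j by (auto simp: j_def)
    have jn: "j < n" using j less.prems by simp
    define L' where "L' = L(j := L j - m j)"
    note split = monomial_split[of j L, OF jn j(2), folded L'_def]
    define gj where "gj = f j - coord (r j) ^ m j"
    define gk where "gk = f k - coord (r k) ^ m k"
    define L2 where "L2 = (\<lambda>i. L' i + (if i = k then m k else 0))"
    have eq: "monomial L * f k = monomial L2 * f j + (monomial L' * f j) * gk + - ((monomial L' * f k) * gj)"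
    proof -
      have "coord (r j) ^ m j = f j - gj" "coord (r k) ^ m k = f k - gk"
        by (simp_all add: gk_def gj_def)
      note split(1)[unfolded this(1)]
      moreover have "monomial L2 = monomial L' * (f k - gk)"
        unfolding L2_def fibre_monomial_times[symmetric] fibre_monomial_single[OF less.prems]
        by (simp only: \<open>coord (r k) ^ m k = f k - gk\<close>)
      moreover have "u * (x - y) * z = u * (z - w) * x + u * x * w + - (u * z * y)"
        for u w x y z :: "('i \<Rightarrow> complex) \<Rightarrow> complex"
        by (simp add: algebra_simps)
      ultimately show ?thesis by (simp only:)
    qed
    have "monomial L2 * f j \<in> cspan_mod std_multiples K"
    proof -
      have "\<forall>i<j. L2 i < m i" using least j by (auto simp: L2_def L'_def)
      then have "monomial L2 * f j \<in> std_multiples"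
        using jn unfolding std_multiples_def by blast
      then show ?thesis by (intro lspan_subset_mod[OF K(1)] lspan_gen one_in_constants)
    qed
    moreover have "(monomial L' * f j) * gk \<in> cspan_mod std_multiples K"
      unfolding gk_def
    proof (rule lspan_mod_constants_times[OF K(1) multiples_total[OF jn] lower_terms_constants[OF K less.prems]])
      fix t assume "t \<in> monomial ` {L. (\<Sum>j<n. L j) \<le> m k - 1}"
      then obtain M where M: "t = monomial M" "(\<Sum>j<n. M j) \<le> m k - 1" by auto
      have "(\<Sum>i<n. L' i + M i) + m j < (\<Sum>j<n. L j) + m k"
        using M(2) split(2) pos[OF less.prems] unfolding sum.distrib by linarith
      from less.hyps[OF this jn]
      show "(monomial L' * f j) * t \<in> cspan_mod std_multiples K"
        unfolding M(1) fibre_monomial_times[symmetric] by (simp only: ac_simps)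
    qed
    moreover have "(monomial L' * f k) * gj \<in> cspan_mod std_multiples K"
      unfolding gj_def
    proof (rule lspan_mod_constants_times[OF K(1) multiples_total[OF less.prems] lower_terms_constants[OF K jn]])
      fix t assume "t \<in> monomial ` {L. (\<Sum>i<n. L i) \<le> m j - 1}"
      then obtain M where M: "t = monomial M" "(\<Sum>i<n. M i) \<le> m j - 1" by auto
      have "(\<Sum>i<n. L' i + M i) + m k < (\<Sum>j<n. L j) + m k"
        using M(2) split(2) pos[OF jn] unfolding sum.distrib by linarith
      from less.hyps[OF this less.prems]
      show "(monomial L' * f k) * t \<in> cspan_mod std_multiples K"
        unfolding M(1) fibre_monomial_times[symmetric] by (simp only: ac_simps)
    qed
    ultimately show ?thesis
      unfolding eq by (intro lspan_mod_add[OF K(1)] lspan_mod_uminus[OF K(1) rng_closed_constants])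
  qed
qed

text \<open>A curve in the fibre over \<open>s\<close> of the ambient space. Along it every monomial
  becomes a single power of the parameter, with \<open>kron_weight\<close> as exponent. The inverse
  of \<open>r\<close> recovers the index k from the coordinate \<open>r k\<close>.\<close>

definition kron_curve :: "nat \<Rightarrow> ('i \<Rightarrow> complex) \<Rightarrow> complex \<Rightarrow> 'i \<Rightarrow> complex" where
  "kron_curve N s \<tau> = (\<lambda>i. if i \<in> r ` {..<n}
     then \<tau> ^ (N * (N + 1) ^ n + 1 + (N + 1) ^ the_inv_into {..<n} r i) else s i)"

lemma kron_curve_fibre:
  assumes "s \<in> affine_space I0"
  shows "kron_curve N s \<tau> \<in> affine_space indices" "restrict (kron_curve N s \<tau>) I0 = s"
  using assms disjoint
  by (auto simp: kron_curve_def affine_space_def indices_def PiE_iff extensional_def fun_eq_iff)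

lemma coord_kron_curve:
  "k < n \<Longrightarrow> coord (r k) (kron_curve N s \<tau>) = \<tau> ^ (N * (N + 1) ^ n + 1 + (N + 1) ^ k)"
  by (simp add: kron_curve_def the_inv_into_f_f[OF inj])

lemma monomial_kron_curve:
  "monomial L (kron_curve N s \<tau>) = \<tau> ^ kron_weight n N L"
proof -
  have "monomial L (kron_curve N s \<tau>) = (\<Prod>k<n. (\<tau> ^ (N * (N + 1) ^ n + 1 + (N + 1) ^ k)) ^ L k)"
    unfolding fibre_monomial_def prod_fun_apply power_fun_apply
    by (intro prod.cong refl) (simp only: coord_kron_curve lessThan_iff)
  also have "\<dots> = \<tau> ^ kron_weight n N L"
    unfolding kron_weight_def power_sum power_mult[symmetric] by (simp only: mult.commute)
  finally show ?thesis .
qed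

lemma lower_terms_curve:
  assumes K: "\<And>h \<tau>. h \<in> K \<Longrightarrow> h (kron_curve N s \<tau>) = 0"
    and "g \<in> cspan_mod (monomial ` {L. (\<Sum>j<n. L j) \<le> d}) K"
    and bound: "\<And>L. (\<Sum>j<n. L j) \<le> d \<Longrightarrow> kron_weight n N L < e" "e > 0"
  shows "\<exists>q. degree q < e \<and> (\<forall>\<tau>. g (kron_curve N s \<tau>) = poly q \<tau>)"
proof -
  obtain g' where g': "g' \<in> lspan (range const_fun) (monomial ` {L. (\<Sum>j<n. L j) \<le> d})" "g - g' \<in> K"
    using assms(2) by (auto simp: lspan_mod_def)
  have "\<exists>q. degree q < e \<and> (\<forall>\<tau>. g' (kron_curve N s \<tau>) = poly q \<tau>)"
    using g'(1)
  proof (rule lspan_least[where S = "{g. \<exists>q. degree q < e \<and> (\<forall>\<tau>. g (kron_curve N s \<tau>) = poly q \<tau>)}", simplified mem_Collect_eq])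
    show "\<exists>q. degree q < e \<and> (\<forall>\<tau>. 0 (kron_curve N s \<tau>) = poly q \<tau>)"
      using bound(2) by (intro exI[of _ 0]) auto
  next
    fix x y assume "\<exists>q. degree q < e \<and> (\<forall>\<tau>. x (kron_curve N s \<tau>) = poly q \<tau>)"
      "\<exists>q. degree q < e \<and> (\<forall>\<tau>. y (kron_curve N s \<tau>) = poly q \<tau>)"
    then obtain q q' where "degree q < e" "degree q' < e" "\<forall>\<tau>. x (kron_curve N s \<tau>) = poly q \<tau>"
      "\<forall>\<tau>. y (kron_curve N s \<tau>) = poly q' \<tau>" by blast
    then show "\<exists>q. degree q < e \<and> (\<forall>\<tau>. (x + y) (kron_curve N s \<tau>) = poly q \<tau>)"
      by (intro exI[of _ "q + q'"]) (auto intro: degree_add_less)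
  next
    fix a t :: "('i \<Rightarrow> complex) \<Rightarrow> complex"
    assume "a \<in> range const_fun" "t \<in> monomial ` {L. (\<Sum>j<n. L j) \<le> d}"
    then obtain c L where "a = const_fun c" "t = monomial L" "(\<Sum>j<n. L j) \<le> d" by blast
    then show "\<exists>q. degree q < e \<and> (\<forall>\<tau>. (a * t) (kron_curve N s \<tau>) = poly q \<tau>)"
      using bound(1)[of L]
      by (intro exI[of _ "Polynomial.monom c (kron_weight n N L)"])
        (auto simp: poly_monom monomial_kron_curve intro: le_less_trans[OF degree_monom_le])
  qed
  then obtain q where q: "degree q < e" "\<And>\<tau>. g' (kron_curve N s \<tau>) = poly q \<tau>" by blast
  moreover have "g (kron_curve N s \<tau>) = g' (kron_curve N s \<tau>)" for \<tau>
    using K[OF g'(2), of \<tau>] by simp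
  ultimately show ?thesis by auto
qed

text \<open>A standard multiple is determined by its leading monomial: its index is the first
  \<open>k\<close> at which the exponent reaches \<open>m k\<close>. Along the curve distinct
  standard multiples therefore become polynomials of distinct positive degrees.\<close>

lemma one_not_standard:
  assumes "s \<in> affine_space I0"
  defines "X \<equiv> {x \<in> affine_space indices. restrict x I0 = s}"
  shows "1 \<notin> cspan_mod std_multiples (vanishing X)"
proof
  assume "1 \<in> cspan_mod std_multiples (vanishing X)"
  then obtain h where h: "h \<in> lspan (range const_fun) std_multiples" "1 - h \<in> vanishing X"
    by (auto simp: lspan_mod_def)
  obtain F a where F: "finite F" "F \<subseteq> std_multiples" "a \<in> F \<rightarrow> range const_fun" "h = (\<Sum>t\<in>F. a t * t)"
    using lspan_rep[OF h(1) rng_closed_constants] by blast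
  have "\<forall>t\<in>F. \<exists>c. a t = const_fun c" using F(3) by blast
  from bchoice[OF this] obtain c where c: "\<And>t. t \<in> F \<Longrightarrow> a t = const_fun (c t)" by blast
  have "\<forall>t\<in>F. \<exists>L k. t = monomial L * f k \<and> k < n \<and> (\<forall>j<k. L j < m j)"
    using F(2) unfolding std_multiples_def by blast
  then obtain L k where Lk: "\<And>t. t \<in> F \<Longrightarrow> t = monomial (L t) * f (k t) \<and> k t < n \<and> (\<forall>j<k t. L t j < m j)"
    by metis
  define lead where "lead t j = L t j + (if j = k t then m (k t) else 0)" for t j
  \<comment> \<open>\<open>kron_weight\<close> distinguishes monomials only up to total degree
    \<open>N\<close>; the sum is a convenient bound for the leading monomials of the finitely many
    multiples that occur.\<close>
  define N where "N = (\<Sum>t\<in>F. \<Sum>j<n. lead t j)"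
  have N: "(\<Sum>j<n. lead t j) \<le> N" if "t \<in> F" for t
    unfolding N_def using that F(1) by (intro member_le_sum) auto
  define w where "w t = kron_weight n N (lead t)" for t
  have curve: "kron_curve N s \<tau> \<in> X" for \<tau>
    using kron_curve_fibre[OF assms(1)] by (simp add: X_def)
  have K: "h (kron_curve N s \<tau>) = 0" if "h \<in> vanishing X" for h \<tau>
    using that curve by (auto simp: vanishing_def)
  have Kbase: "a \<in> vanishing X" if "a \<in> base_funs" "a s = 0" for a
    using that polyfun_restrict[OF that(1)] by (auto simp: vanishing_def X_def)
  have "\<exists>p. degree p = w t \<and> w t \<ge> 1 \<and> (\<forall>\<tau>. t (kron_curve N s \<tau>) = poly p \<tau>)" if t: "t \<in> F" for t
  proof -
    define single where "single = (\<lambda>j. if j = k t then m (k t) else 0)"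
    define e where "e = kron_weight n N single"
    have k: "k t < n" using Lk[OF t] by simp
    have sum_single: "(\<Sum>j<n. single j) = m (k t)" using k by (simp add: single_def)
    have sum_lead: "(\<Sum>j<n. lead t j) = (\<Sum>j<n. L t j) + m (k t)"
      using k by (simp add: lead_def sum.distrib)
    have less: "kron_weight n N M < e" if "(\<Sum>j<n. M j) \<le> m (k t) - 1" for M
      unfolding e_def
    proof (rule kron_weight_less)
      show "(\<Sum>j<n. M j) < (\<Sum>j<n. single j)" using that pos[OF k] sum_single by linarith
      show "(\<Sum>j<n. single j) \<le> N" using N[OF t] sum_single sum_lead by linarith
    qed
    have e: "e > 0" using less[of "\<lambda>_. 0"] by simp
    have low: "f (k t) - coord (r (k t)) ^ m (k t)
        \<in> cspan_mod (monomial ` {L. (\<Sum>j<n. L j) \<le> m (k t) - 1}) (vanishing X)"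
      by (rule lower_terms_constants[where s = s, OF ideal_vanishing _ k]) (rule Kbase)
    have "\<exists>q. degree q < e \<and>
      (\<forall>\<tau>. (f (k t) - coord (r (k t)) ^ m (k t)) (kron_curve N s \<tau>) = poly q \<tau>)"
    proof (rule lower_terms_curve[where K = "vanishing X" and N = N and s = s and e = e, OF _ low])
      show "h (kron_curve N s \<tau>) = 0" if "h \<in> vanishing X" for h \<tau>
        using K[OF that] .
      show "kron_weight n N L < e" if "(\<Sum>j<n. L j) \<le> m (k t) - 1" for L
        using less[OF that] .
      show "e > 0" by (rule e)
    qed
    then obtain q where q: "degree q < e"
      "\<And>\<tau>. (f (k t) - coord (r (k t)) ^ m (k t)) (kron_curve N s \<tau>) = poly q \<tau>" by blast
    define p where "p = Polynomial.monom 1 (kron_weight n N (L t)) * (Polynomial.monom 1 e + q)"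
    have "degree (Polynomial.monom 1 e + q) = e"
      using q(1) by (simp add: degree_add_eq_left degree_monom_eq)
    moreover from this e have "Polynomial.monom 1 e + q \<noteq> 0" by auto
    ultimately have "degree p = kron_weight n N (L t) + e"
      unfolding p_def by (subst degree_mult_eq) (auto simp: degree_monom_eq monom_eq_0_iff)
    moreover have wt: "kron_weight n N (L t) + e = w t"
      unfolding w_def e_def kron_weight_def lead_def single_def
      by (simp only: sum.distrib[symmetric] distrib_right)
    ultimately have "degree p = w t" by simp
    moreover have "w t \<ge> 1" using wt e by simp
    moreover have "t (kron_curve N s \<tau>) = poly p \<tau>" for \<tau>
    proof -
      have "coord (r (k t)) ^ m (k t) = monomial single"
        unfolding single_def fibre_monomial_single[OF k] ..
      then have "(coord (r (k t)) ^ m (k t)) (kron_curve N s \<tau>) = \<tau> ^ e"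
        by (simp only: monomial_kron_curve e_def)
      then have "f (k t) (kron_curve N s \<tau>) = \<tau> ^ e + poly q \<tau>"
        using q(2)[of \<tau>] by (simp add: algebra_simps)
      then have "(monomial (L t) * f (k t)) (kron_curve N s \<tau>) = poly p \<tau>"
        by (simp add: p_def poly_monom monomial_kron_curve)
      then show ?thesis using Lk[OF t] by simp
    qed
    ultimately show ?thesis by blast
  qed
  then have "\<forall>t\<in>F. \<exists>p. degree p = w t \<and> w t \<ge> 1 \<and> (\<forall>\<tau>. t (kron_curve N s \<tau>) = poly p \<tau>)" by blast
  from bchoice[OF this] obtain p where p: "\<And>t. t \<in> F \<Longrightarrow> degree (p t) = w t" "\<And>t. t \<in> F \<Longrightarrow> w t \<ge> 1"
    "\<And>t \<tau>. t \<in> F \<Longrightarrow> t (kron_curve N s \<tau>) = poly (p t) \<tau>" by blast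
  have inj_w: "inj_on w F"
  proof (rule inj_onI)
    fix t t' assume t: "t \<in> F" "t' \<in> F" "w t = w t'"
    have lead: "lead t j = lead t' j" if "j < n" for j
      using kron_weight_inj[OF t(3)[unfolded w_def] N[OF t(1)] N[OF t(2)] that] .
    have less: "lead u j < m j" if "u \<in> F" "j < k u" for u j
      using Lk[OF that(1)] that(2) by (auto simp: lead_def)
    have ge: "lead u (k u) \<ge> m (k u)" for u by (simp add: lead_def)
    have "k t = k t'"
    proof (rule ccontr)
      assume "k t \<noteq> k t'"
      then consider "k t < k t'" | "k t' < k t" by linarith
      then show False
        using less[OF t(1), of "k t'"] less[OF t(2), of "k t"] ge[of t] ge[of t'] lead Lk[OF t(1)] Lk[OF t(2)]
        by cases (metis not_less)+
    qed
    moreover from this lead have "L t j = L t' j" if "j < n" for j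
      using lead[OF that] \<open>k t = k t'\<close> by (cases "j = k t'") (simp_all add: lead_def)
    ultimately show "t = t'"
      using Lk[OF t(1)] Lk[OF t(2)] fibre_monomial_cong[of n "L t" "L t'" r] by simp
  qed
  \<comment> \<open>Terms with coefficient 0 are dropped, so that the term of largest degree is
    really present.\<close>
  define F' where "F' = {t \<in> F. c t \<noteq> 0}"
  have eval: "(\<Sum>t\<in>F'. c t * poly (p t) \<tau>) = 1" for \<tau>
  proof -
    have "h (kron_curve N s \<tau>) = 1" using K[OF h(2), of \<tau>] by simp
    moreover have "h (kron_curve N s \<tau>) = (\<Sum>t\<in>F. c t * poly (p t) \<tau>)"
      unfolding F(4) sum_fun_apply using c p(3) by (intro sum.cong) auto
    moreover have "\<dots> = (\<Sum>t\<in>F'. c t * poly (p t) \<tau>)"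
      unfolding F'_def using F(1) by (intro sum.mono_neutral_right) auto
    ultimately show ?thesis by simp
  qed
  then have "F' \<noteq> {}" by fastforce
  have "(\<Sum>t\<in>F'. Polynomial.smult (c t) (p t)) \<noteq> 1"
  proof (rule sum_distinct_degrees_neq_1[OF _ \<open>F' \<noteq> {}\<close>])
    show "inj_on (\<lambda>t. degree (p t)) F'"
      using inj_w p(1) by (auto simp: F'_def inj_on_def)
  qed (use F(1) p in \<open>auto simp: F'_def\<close>)
  moreover have "(\<Sum>t\<in>F'. Polynomial.smult (c t) (p t)) = 1"
    using eval by (intro poly_eq_poly_eq_iff[THEN iffD1] ext) (simp add: poly_sum)
  ultimately show False by contradiction
qed

text \<open>Here \<open>X\<close> is the fibre of the whole ambient space over \<open>s\<close>, and
  \<open>K\<close> is generated by the equations together with the functions vanishing on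
  \<open>X\<close>. Its elements are combinations of standard multiples modulo
  \<open>vanishing X\<close>, and 1 is not; so \<open>K\<close> is proper and has a common
  zero.\<close>

lemma fibre_nonempty:
  assumes "s \<in> affine_space I0"
  obtains x where "x \<in> cover" "restrict x I0 = s"
proof -
  define X where "X = {x \<in> affine_space indices. restrict x I0 = s}"
  define T where "T = f ` {..<n}"
  define K where "K = total_funs \<inter> lspan_mod total_funs T (vanishing X)"
  note van = ideal_vanishing[of total_funs X]
  have ideal: "ideal_over total_funs K"
    unfolding K_def by (rule ideal_over_lspan_mod[OF van rng_closed_polyfun])
  have base: "a \<in> vanishing X" if "a \<in> base_funs" "a s = 0" for a
    using that polyfun_restrict[OF that(1)] by (auto simp: vanishing_def X_def)
  have sub: "h \<in> cspan_mod std_multiples (vanishing X)" if hK: "h \<in> K" for h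
  proof -
    obtain h' where h': "h' \<in> lspan total_funs T" "h - h' \<in> vanishing X"
      using hK unfolding K_def lspan_mod_def by blast
    have "h' \<in> cspan_mod std_multiples (vanishing X)"
      using h'(1)
    proof (rule lspan_mod_least[OF van])
      fix g t assume g: "g \<in> total_funs" and "t \<in> T"
      then obtain k where k: "t = f k" "k < n" by (auto simp: T_def)
      obtain N where "g \<in> fibre_deg_le I0 r n N"
        using fibre_deg_le_exhaust[of g I0 r n] g unfolding indices_def by blast
      then have "g \<in> lspan_mod base_funs (monomial ` {L. (\<Sum>k<n. L k) \<le> N}) (vanishing X)"
        unfolding fibre_deg_le_def by (rule lspan_subset_mod[OF van])
      then have "g \<in> cspan_mod (monomial ` {L. (\<Sum>k<n. L k) \<le> N}) (vanishing X)"
        by (rule lspan_base_constants[OF van base, rotated -1]) (auto simp: monomial_total)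
      then have "f k * g \<in> cspan_mod std_multiples (vanishing X)"
      proof (rule lspan_mod_constants_times[OF van equation_total[OF k(2)]])
        fix u assume "u \<in> monomial ` {L. (\<Sum>k<n. L k) \<le> N}"
        then obtain L where "u = monomial L" by blast
        then show "f k * u \<in> cspan_mod std_multiples (vanishing X)"
          using multiple_standard[where s = s and L = L, OF van base k(2)] by (simp only: mult.commute)
      qed
      then show "g * t \<in> cspan_mod std_multiples (vanishing X)"
        by (simp only: k mult.commute)
    qed
    then show ?thesis using h'(2) by (rule lspan_mod_cong[OF van])
  qed
  have proper: "1 \<notin> K"
    using sub one_not_standard[OF assms, folded X_def] by blast
  have "f k \<in> K" if "k < n" for k
    unfolding K_def T_def using that
    by (intro IntI equation_total lspan_subset_mod[OF van] lspan_gen polyfun_1) auto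
  moreover have "a \<in> K" if "a \<in> base_funs" "a s = 0" for a
    unfolding K_def using base[OF that] that base_subset
    by (intro IntI lspan_modI[OF lspan.zero]) auto
  moreover have "K \<subseteq> total_funs" by (auto simp: K_def)
  ultimately obtain x where x: "x \<in> affine_space indices" "\<And>h. h \<in> K \<Longrightarrow> h x = 0" "\<And>i. i \<in> I0 \<Longrightarrow> x i = s i"
    "\<And>k. k < n \<Longrightarrow> f k \<in> K"
    using proper_ideal_zero[OF ideal _ _ _ proper] by metis
  then have "x \<in> cover" by (auto simp: cover_def)
  moreover have "restrict x I0 = s"
    using x(3) assms by (auto simp: fun_eq_iff affine_space_def PiE_iff extensional_def)
  ultimately show ?thesis using that by blast
qed

end

section \<open>Images and preimages of closed sets\<close>

lemma zariski_closed_preimage: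
  assumes "zariski_closed I Y" "zariski_closed I0 W" "I0 \<subseteq> I"
  shows "zariski_closed I {x \<in> Y. restrict x I0 \<in> W}"
  unfolding zariski_closed_iff
proof (intro conjI ballI impI)
  show "{x \<in> Y. restrict x I0 \<in> W} \<subseteq> affine_space I"
    using zariski_closed_subset[OF assms(1)] by blast
next
  fix x assume x: "x \<in> affine_space I"
    "\<forall>f\<in>polynomial_functions I. f \<in> vanishing {x \<in> Y. restrict x I0 \<in> W} \<longrightarrow> f x = 0"
  have "x \<in> Y"
    using assms(1) x unfolding zariski_closed_iff by (auto simp: vanishing_def)
  moreover have "restrict x I0 \<in> W"
  proof (rule ccontr)
    assume "restrict x I0 \<notin> W"
    moreover have "restrict x I0 \<in> affine_space I0" by (simp add: affine_space_def)
    ultimately obtain g where g: "g \<in> polynomial_functions I0" "g \<in> vanishing W" "g (restrict x I0) \<noteq> 0"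
      using zariski_closed_separates[OF assms(2)] by blast
    have "g y = 0" if "restrict y I0 \<in> W" for y
      using g(2) that polyfun_restrict[OF g(1), of y] by (auto simp: vanishing_def)
    then have "g x = 0"
      using x(2) g(1) polyfun_mono[OF assms(3)] by (auto simp: vanishing_def)
    then show False using g polyfun_restrict[OF g(1), of x] by simp
  qed
  ultimately show "x \<in> {x \<in> Y. restrict x I0 \<in> W}" by blast
qed

context finite_cover
begin

text \<open>The classical fact that finite morphisms are closed. If the image misses
  \<open>s\<close>, the functions vanishing at \<open>s\<close> generate the unit ideal on
  \<open>Z\<close>. Nakayama's lemma, applied to the reduced monomials, then yields a function
  \<open>u\<close> on the base with value 1 at \<open>s\<close> that vanishes on the image.\<close>

lemma closed_image:
  assumes Z: "zariski_closed indices Z" "Z \<subseteq> cover"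
  shows "zariski_closed I0 ((\<lambda>x. restrict x I0) ` Z)"
  unfolding zariski_closed_iff
proof (intro conjI ballI impI)
  show "(\<lambda>x. restrict x I0) ` Z \<subseteq> affine_space I0" by (auto simp: affine_space_def)
next
  fix s assume s: "s \<in> affine_space I0"
    and vs: "\<forall>a\<in>base_funs. a \<in> vanishing ((\<lambda>x. restrict x I0) ` Z) \<longrightarrow> a s = 0"
  show "s \<in> (\<lambda>x. restrict x I0) ` Z"
  proof (rule ccontr)
    assume notin: "s \<notin> (\<lambda>x. restrict x I0) ` Z"
    define M where "M = {a \<in> base_funs. a s = 0}"
    note van = ideal_vanishing[of total_funs Z]
    note tot = rng_closed_polyfun[of indices]
    have M: "rng_closed M"
      unfolding rng_closed_def M_def
      by (auto intro: polyfun_0 polyfun_minus polyfun_times)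
    have M_total: "M \<subseteq> total_funs" using base_subset by (auto simp: M_def)
    define K where "K = total_funs \<inter> lspan_mod total_funs M (vanishing Z)"
    have ideal: "ideal_over total_funs K"
      unfolding K_def by (rule ideal_over_lspan_mod[OF van tot])
    have van_K: "h \<in> K" if "h \<in> total_funs" "h \<in> vanishing Z" for h
      unfolding K_def using that by (intro IntI lspan_modI[OF lspan.zero]) simp_all
    have M_K: "a \<in> K" if "a \<in> base_funs" "a s = 0" for a
      unfolding K_def using that base_subset
      by (intro IntI lspan_subset_mod[OF van] lspan_gen polyfun_1) (auto simp: M_def)
    have f_K: "f k \<in> K" if "k < n" for k
      using that Z(2) by (intro van_K equation_total) (auto simp: vanishing_def cover_def)
    have "1 \<in> K"
    proof (rule ccontr)
      assume proper: "1 \<notin> K"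
      have sub: "K \<subseteq> total_funs" by (auto simp: K_def)
      obtain x where x: "x \<in> affine_space indices" "\<And>h. h \<in> K \<Longrightarrow> h x = 0" "\<And>i. i \<in> I0 \<Longrightarrow> x i = s i"
        using proper_ideal_zero[where s = s, OF ideal sub f_K M_K proper] by blast
      then have "x \<in> Z"
        using Z(1) van_K unfolding zariski_closed_iff by blast
      moreover have "restrict x I0 = s"
        using x(3) s by (auto simp: fun_eq_iff affine_space_def PiE_iff extensional_def)
      ultimately show False using notin by blast
    qed
    then obtain h where h: "h \<in> lspan total_funs M" "1 - h \<in> vanishing Z"
      unfolding K_def lspan_mod_def by blast
    have f_van: "f k \<in> vanishing Z" if "k < n" for k
      using that Z(2) by (auto simp: vanishing_def cover_def)
    \<comment> \<open>On \<open>Z\<close> the function \<open>h\<close> equals 1, so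
      \<open>e\<close> equals \<open>e * h\<close>. Each term of the product contains a factor from
      \<open>M\<close>, and reducing the remaining factor over the base leaves all coefficients in
      \<open>M\<close>.\<close>
    have "e \<in> lspan_mod M reduced_set (vanishing Z)" if e: "e \<in> reduced_set" for e
    proof -
      have e_total: "e \<in> total_funs" using e reduced_set_total by blast
      have "e * h \<in> lspan_mod M reduced_set (vanishing Z)"
      proof (rule lspan_mod_mult_least[OF van h(1)])
        fix g a assume g: "g \<in> total_funs" and a: "a \<in> M"
        have "e * g \<in> lspan_mod base_funs reduced_set (vanishing Z)"
          by (intro total_funs_reduction[OF van f_van] polyfun_times e_total g)
        moreover have "a * b \<in> M" if "b \<in> base_funs" for b
          using a that by (auto simp: M_def intro: polyfun_times)
        ultimately have "a * (e * g) \<in> lspan_mod M reduced_set (vanishing Z)"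
          using a M_total lspan_mod_scale[OF van, of a "e * g" base_funs reduced_set M] by blast
        then show "e * (g * a) \<in> lspan_mod M reduced_set (vanishing Z)"
          by (simp only: ac_simps)
      qed
      moreover have "e - e * h \<in> vanishing Z"
        using ideal_overD(3)[OF van e_total h(2)] by (simp only: right_diff_distrib mult_1_right)
      ultimately show ?thesis by (rule lspan_mod_cong[OF van])
    qed
    from nakayama[OF finite_reduced_set van M M_total tot polyfun_1 this]
    obtain u where u: "1 - u \<in> M" "\<And>e. e \<in> reduced_set \<Longrightarrow> u * e \<in> vanishing Z" by blast
    have "u = 1 - (1 - u)" by simp
    then have "u \<in> base_funs"
      using polyfun_minus[OF polyfun_1] u(1) unfolding M_def
      by (metis (no_types, lifting) mem_Collect_eq)
    moreover have "u \<in> vanishing ((\<lambda>x. restrict x I0) ` Z)"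
      using u(2)[OF one_reduced] polyfun_restrict[OF \<open>u \<in> base_funs\<close>]
      by (auto simp: vanishing_def)
    ultimately have "u s = 0" using vs by blast
    moreover have "(1 - u) s = 0" using u(1) by (auto simp: M_def)
    ultimately show False by simp
  qed
qed

section \<open>Lifting chains\<close>

text \<open>A minimal closed set over \<open>W\<close> exists by Zorn's lemma because fibres are finite; it is
  irreducible because images are closed.\<close>

lemma irreducible_lift:
  assumes W: "irreducible_closed I0 W" and Y: "zariski_closed indices Y" "Y \<subseteq> cover"
    and sub: "W \<subseteq> (\<lambda>x. restrict x I0) ` Y"
  obtains Z where "irreducible_closed indices Z" "Z \<subseteq> Y" "(\<lambda>x. restrict x I0) ` Z = W"
proof -
  define \<pi> where "\<pi> = (\<lambda>x :: 'i \<Rightarrow> complex. restrict x I0)"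
  define \<C> where "\<C> = {Z. zariski_closed indices Z \<and> Z \<subseteq> Y \<and> \<pi> ` Z = W}"
  have W_closed: "zariski_closed I0 W" "W \<noteq> {}" using W by (auto simp: irreducible_closed_def)
  define Y' where "Y' = {x \<in> Y. restrict x I0 \<in> W}"
  have Y': "Y' \<in> \<C>"
    unfolding \<C>_def using zariski_closed_preimage[OF Y(1) W_closed(1)] sub
    by (auto simp: Y'_def \<pi>_def indices_def)
  have po: "partial_order_on \<C> (relation_of (\<lambda>A B. B \<subseteq> A) \<C>)"
    by (rule partial_order_on_relation_ofI) auto
  have "\<exists>Z\<in>\<C>. \<forall>A\<in>\<C>. A \<subseteq> Z \<longrightarrow> A = Z"
  proof (rule predicate_Zorn[OF po])
    fix C assume C: "C \<in> Chains (relation_of (\<lambda>A B. B \<subseteq> A) \<C>)"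
    then have CC: "C \<subseteq> \<C>" and chain: "\<And>A B. A \<in> C \<Longrightarrow> B \<in> C \<Longrightarrow> A \<subseteq> B \<or> B \<subseteq> A"
      unfolding Chains_def relation_of_def by blast+
    show "\<exists>u\<in>\<C>. \<forall>a\<in>C. u \<subseteq> a"
    proof (cases "C = {}")
      case False
      have "\<Inter>C \<in> \<C>"
        unfolding \<C>_def
      proof (intro CollectI conjI)
        show "zariski_closed indices (\<Inter>C)"
          using CC False by (intro zariski_closed_Inter) (auto simp: \<C>_def)
        show "\<Inter>C \<subseteq> Y" using CC False by (auto simp: \<C>_def)
        show "\<pi> ` \<Inter>C = W"
        proof
          show "\<pi> ` \<Inter>C \<subseteq> W" using CC False unfolding \<C>_def by blast
          show "W \<subseteq> \<pi> ` \<Inter>C"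
          proof
            fix w assume w: "w \<in> W"
            \<comment> \<open>Finite fibres keep the intersection nonempty over \<open>w\<close>: a
              fibre with the fewest points is contained in the fibre of every other member of the
              chain.\<close>
            define fib where "fib A = {x \<in> A. \<pi> x = w}" for A
            have fin: "finite (fib A)" if "A \<in> C" for A
            proof -
              have "A \<subseteq> cover" using that CC Y(2) unfolding \<C>_def by blast
              then show ?thesis
                by (intro finite_subset[OF _ finite_fibre[of w]]) (auto simp: fib_def \<pi>_def)
            qed
            obtain A where A: "A \<in> C" "\<And>B. B \<in> C \<Longrightarrow> card (fib A) \<le> card (fib B)"
              using ex_has_least_nat[of "\<lambda>A. A \<in> C" _ "\<lambda>A. card (fib A)"] False by blast
            have "fib A \<subseteq> fib B" if B: "B \<in> C" for B
            proof (cases "A \<subseteq> B")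
              case False
              then have "fib B \<subseteq> fib A" using chain[OF A(1) B] by (auto simp: fib_def)
              then have "fib B = fib A" using A(2)[OF B] fin[OF A(1)] by (intro card_seteq)
              then show ?thesis by simp
            qed (auto simp: fib_def)
            moreover obtain x where "x \<in> fib A"
              using w A(1) CC by (auto simp: fib_def \<C>_def)
            ultimately have "x \<in> \<Inter>C" "\<pi> x = w" by (auto simp: fib_def)
            then show "w \<in> \<pi> ` \<Inter>C" by blast
          qed
        qed
      qed
      then show ?thesis by blast
    qed (use Y' in blast)
  qed
  then obtain Z where Z: "Z \<in> \<C>" and minimal: "\<And>A. A \<in> \<C> \<Longrightarrow> A \<subseteq> Z \<Longrightarrow> A = Z" by blast
  have "irreducible_closed indices Z"
    unfolding irreducible_closed_def
  proof (intro conjI allI impI)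
    show "zariski_closed indices Z" "Z \<noteq> {}" using Z W_closed(2) by (auto simp: \<C>_def)
    fix A B assume AB: "zariski_closed indices A \<and> zariski_closed indices B \<and> Z = A \<union> B"
    then have "A \<subseteq> cover" "B \<subseteq> cover" using Z Y(2) by (auto simp: \<C>_def)
    then have "zariski_closed I0 (\<pi> ` A)" "zariski_closed I0 (\<pi> ` B)"
      using AB closed_image unfolding \<pi>_def by blast+
    \<comment> \<open>Irreducibility of \<open>W\<close> makes one of the two closed images all of
      \<open>W\<close>, and minimality then makes the corresponding part equal to
      \<open>Z\<close>.\<close>
    moreover have "W = \<pi> ` A \<union> \<pi> ` B" using Z AB unfolding \<C>_def by blast
    ultimately have "W = \<pi> ` A \<or> W = \<pi> ` B" using W unfolding irreducible_closed_def by blast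
    then have "A \<in> \<C> \<or> B \<in> \<C>" using AB Z unfolding \<C>_def by blast
    then show "Z = A \<or> Z = B" using minimal AB by blast
  qed
  then show ?thesis using that Z unfolding \<C>_def \<pi>_def by blast
qed

text \<open>The chain is lifted from the top: each smaller member is sought inside the lift of the
  next larger one, which is why \<open>Y\<close> is an arbitrary closed set. The lifted inclusions
  are strict because the images differ.\<close>

lemma chain_lift:
  assumes "\<And>j. j \<le> l \<Longrightarrow> irreducible_closed I0 (W j)" "\<And>j. j < l \<Longrightarrow> W j \<subset> W (Suc j)"
    and "zariski_closed indices Y" "Y \<subseteq> cover" "W l \<subseteq> (\<lambda>x. restrict x I0) ` Y"
  shows "\<exists>Z. irreducible_chain indices Y l Z \<and> (\<lambda>x. restrict x I0) ` Z l = W l"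
  using assms
proof (induction l arbitrary: Y)
  case 0
  then obtain Z where Z: "irreducible_closed indices Z" "Z \<subseteq> Y" "(\<lambda>x. restrict x I0) ` Z = W 0"
    using irreducible_lift[of "W 0" Y] by blast
  then have "irreducible_chain indices Y 0 (\<lambda>_. Z)" by (simp add: irreducible_chain_def)
  then show ?case using Z(3) by blast
next
  case (Suc l)
  obtain A where A: "irreducible_closed indices A" "A \<subseteq> Y" "(\<lambda>x. restrict x I0) ` A = W (Suc l)"
    using irreducible_lift[of "W (Suc l)" Y] Suc.prems by blast
  have "\<exists>Z. irreducible_chain indices A l Z \<and> (\<lambda>x. restrict x I0) ` Z l = W l"
  proof (rule Suc.IH)
    show "zariski_closed indices A" using A(1) by (simp add: irreducible_closed_def)
    show "W l \<subseteq> (\<lambda>x. restrict x I0) ` A" using Suc.prems(2)[of l] A(3) by auto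
  qed (use Suc.prems A in auto)
  then obtain Z where Z: "irreducible_chain indices A l Z" "(\<lambda>x. restrict x I0) ` Z l = W l" by blast
  have "Z l \<noteq> A" using Z(2) A(3) Suc.prems(2)[of l] by auto
  then have "irreducible_chain indices Y (Suc l) (Z(Suc l := A))"
    using Z(1) A(1,2) unfolding irreducible_chain_def
    by (auto simp: le_Suc_eq less_Suc_eq)
  then show ?case using A(3) by (intro exI[of _ "Z(Suc l := A)"] conjI) (simp_all only: fun_upd_same)
qed

end

section \<open>An upper bound for the length of chains\<close>

text \<open>In a combination that vanishes, the lowest power of the last function can be cancelled,
  since \<open>Z (Suc l)\<close> is irreducible and this function does not vanish on it. Restricting
  to \<open>Z l\<close>, where it does vanish, leaves only the terms of lowest exponent. They form a
  combination of monomials in the earlier functions, and the argument repeats.\<close>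

lemma chain_monomials_independent:
  assumes chain: "irreducible_chain I V l Z"
    and "\<And>j. j < l \<Longrightarrow> \<phi> j \<in> polynomial_functions I" "\<And>j. j < l \<Longrightarrow> \<phi> j \<in> vanishing (Z j)"
    "\<And>j. j < l \<Longrightarrow> \<phi> j \<notin> vanishing (Z (Suc j))"
    and X: "finite X" "X \<noteq> {}" "\<And>e. e \<in> X \<Longrightarrow> c e \<noteq> 0" "inj_on (\<lambda>e. restrict e {..<l}) X"
  shows "(\<Sum>e\<in>X. const_fun (c e) * (\<Prod>j<l. \<phi> j ^ e j)) \<notin> vanishing (Z l)"
  using assms
proof (induction l arbitrary: X)
  case 0
  obtain e where "e \<in> X" using 0 by blast
  \<comment> \<open>Restricted to the empty set all exponents coincide, so injectivity leaves a
    single term, a nonzero constant.\<close>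
  then have X: "X = {e}" using 0(8) by (auto simp: inj_on_def)
  have "Z 0 \<noteq> {}" using 0(1) by (auto simp: irreducible_chain_def irreducible_closed_def)
  then show ?case using X 0(7)[of e] by (auto simp: vanishing_def)
next
  case (Suc l)
  have irr: "irreducible_closed I (Z (Suc l))" and sub: "Z l \<subseteq> Z (Suc l)"
    and chain: "irreducible_chain I V l Z"
    using Suc.prems(1) by (auto simp: irreducible_chain_def)
  note pf = polyfun_sum polyfun_times polyfun_const
    polyfun_prod polyfun_power
  define i0 where "i0 = Min ((\<lambda>e. e l) ` X)"
  have i0: "i0 \<le> e l" if "e \<in> X" for e
    using that Suc.prems(5) by (auto simp: i0_def)
  have "i0 \<in> (\<lambda>e. e l) ` X" unfolding i0_def using Suc.prems(5,6) by (intro Min_in) auto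
  define X0 where "X0 = {e \<in> X. e l = i0}"
  have X0: "X0 \<noteq> {}" using \<open>i0 \<in> _\<close> by (auto simp: X0_def)
  define g where "g = (\<Sum>e\<in>X. const_fun (c e) * (\<Prod>j<l. \<phi> j ^ e j) * \<phi> l ^ (e l - i0))"
  have factor: "(\<Sum>e\<in>X. const_fun (c e) * (\<Prod>j<Suc l. \<phi> j ^ e j)) = \<phi> l ^ i0 * g"
    unfolding g_def sum_distrib_left
  proof (rule sum.cong[OF refl])
    fix e assume "e \<in> X"
    then have "\<phi> l ^ e l = \<phi> l ^ i0 * \<phi> l ^ (e l - i0)"
      using i0 by (simp only: power_add[symmetric] le_add_diff_inverse)
    then show "const_fun (c e) * (\<Prod>j<Suc l. \<phi> j ^ e j)
      = \<phi> l ^ i0 * (const_fun (c e) * (\<Prod>j<l. \<phi> j ^ e j) * \<phi> l ^ (e l - i0))"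
      unfolding prod.lessThan_Suc by (simp only: ac_simps)
  qed
  show ?case
  proof
    assume "(\<Sum>e\<in>X. const_fun (c e) * (\<Prod>j<Suc l. \<phi> j ^ e j)) \<in> vanishing (Z (Suc l))"
    then have prod: "\<phi> l ^ i0 * g \<in> vanishing (Z (Suc l))" by (simp only: factor)
    have g_pf: "g \<in> polynomial_functions I"
      unfolding g_def using Suc.prems(2) by (intro pf) auto
    have "\<phi> l ^ i0 \<in> polynomial_functions I" using Suc.prems(2) by (intro pf) auto
    from irreducible_closed_prime[OF irr this g_pf prod]
    have g_van: "g \<in> vanishing (Z (Suc l))"
    proof
      assume "\<phi> l ^ i0 \<in> vanishing (Z (Suc l))"
      then have "\<phi> l \<in> vanishing (Z (Suc l)) \<or> i0 = 0 \<and> Z (Suc l) = {}"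
        by (cases "i0 = 0") (auto simp: vanishing_def power_fun_apply)
      then show ?thesis using Suc.prems(4) irr by (auto simp: irreducible_closed_def)
    qed
    have "(\<Sum>e\<in>X0. const_fun (c e) * (\<Prod>j<l. \<phi> j ^ e j)) \<in> vanishing (Z l)"
      unfolding vanishing_def
    proof (intro CollectI ballI)
      fix x assume x: "x \<in> Z l"
      have "\<phi> l x = 0" using x Suc.prems(3)[of l] by (auto simp: vanishing_def)
      have "g x = 0" using g_van x sub by (auto simp: vanishing_def)
      have "(\<Sum>e\<in>X0. const_fun (c e) * (\<Prod>j<l. \<phi> j ^ e j)) x
          = (\<Sum>e\<in>X0. c e * (\<Prod>j<l. \<phi> j x ^ e j) * \<phi> l x ^ (e l - i0))"
        unfolding sum_fun_apply by (intro sum.cong) (auto simp: X0_def prod_fun_apply power_fun_apply)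
      also have "\<dots> = (\<Sum>e\<in>X. c e * (\<Prod>j<l. \<phi> j x ^ e j) * \<phi> l x ^ (e l - i0))"
        using Suc.prems(5) i0 \<open>\<phi> l x = 0\<close>
        by (intro sum.mono_neutral_left) (auto simp: X0_def le_less)
      also have "\<dots> = g x" by (simp add: g_def sum_fun_apply prod_fun_apply power_fun_apply)
      finally show "(\<Sum>e\<in>X0. const_fun (c e) * (\<Prod>j<l. \<phi> j ^ e j)) x = 0"
        using \<open>g x = 0\<close> by simp
    qed
    moreover have "inj_on (\<lambda>e. restrict e {..<l}) X0"
    proof (rule inj_onI)
      fix e e' assume e: "e \<in> X0" "e' \<in> X0" "restrict e {..<l} = restrict e' {..<l}"
      have "e j = e' j" if "j < Suc l" for j
      proof (cases "j = l")
        case False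
        then show ?thesis using fun_cong[OF e(3), of j] that by auto
      qed (use e in \<open>auto simp: X0_def\<close>)
      then have "restrict e {..<Suc l} = restrict e' {..<Suc l}" by (auto simp: fun_eq_iff)
      with Suc.prems(8) e(1,2) show "e = e'" unfolding inj_on_def X0_def by blast
    qed
    moreover have "finite X0" "\<And>e. e \<in> X0 \<Longrightarrow> c e \<noteq> 0"
      using Suc.prems(5,7) by (auto simp: X0_def)
    ultimately show False
      using Suc.IH[OF chain Suc.prems(2-4)[OF less_SucI], of X0] X0 by blast
  qed
qed

context finite_cover
begin

text \<open>\<open>G N\<close> stands for the monomials of degree at most \<open>N\<close> on the
  base: products add the index, every function on the base is reached modulo
  \<open>vanishing V\<close>, and the growth is of order \<open>\<delta>\<close>. Multiplying by the
  reduced monomials extends this filtration to the cover at the cost of a constant factor in the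
  growth.\<close>

lemma chain_length_le:
  assumes chain: "irreducible_chain indices V l Z" and V: "V \<subseteq> cover"
    and fin: "\<And>N. finite (G N)" and card: "\<And>N. card (G N) \<le> C * (N + 1) ^ \<delta>"
    and G_total: "\<And>N. G N \<subseteq> total_funs" and G_mono: "\<And>N N'. N \<le> N' \<Longrightarrow> G N \<subseteq> G N'"
    and one: "1 \<in> G 0"
    and span: "\<And>a. a \<in> base_funs \<Longrightarrow> \<exists>N. a \<in> cspan_mod (G N) (vanishing V)"
    and times: "\<And>N N' g g'. g \<in> G N \<Longrightarrow> g' \<in> G N' \<Longrightarrow> g * g' \<in> cspan_mod (G (N + N')) (vanishing V)"
  shows "l \<le> \<delta>"
proof (rule ccontr)
  assume "\<not> l \<le> \<delta>"
  define E where "E = reduced_set"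
  define GE where "GE N = (\<lambda>(g, e). g * e) ` (G N \<times> E)" for N
  define S where "S N = cspan_mod (GE N) (vanishing V)" for N
  note van = ideal_vanishing[of total_funs V]
  have E: "finite E" "1 \<in> E" "E \<subseteq> total_funs"
    using finite_reduced_set one_reduced reduced_set_total by (auto simp: E_def)
  have S_mono: "S N \<subseteq> S N'" if "N \<le> N'" for N N'
    unfolding S_def GE_def using G_mono[OF that] by (intro lspan_mod_mono) auto
  have S_add: "h + h' \<in> S N" if "h \<in> S N" "h' \<in> S N" for h h' N
    using that unfolding S_def by (rule lspan_mod_add[OF van])
  have base_times: "a * e \<in> S N" if "a \<in> cspan_mod (G N) (vanishing V)" "e \<in> E" for a e N
  proof -
    have "e * a \<in> S N"
      unfolding S_def
    proof (rule lspan_mod_constants_times[OF van _ that(1)])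
      show "e \<in> total_funs" using E that by blast
      fix t assume "t \<in> G N"
      then have "t * e \<in> GE N" using that(2) by (force simp: GE_def)
      then show "e * t \<in> cspan_mod (GE N) (vanishing V)"
        by (intro lspan_subset_mod[OF van] lspan_gen one_in_constants) (simp only: mult.commute)
    qed
    then show ?thesis by (simp only: mult.commute)
  qed
  have in_S: "\<exists>N. h \<in> S N" if h: "h \<in> total_funs" for h
  proof -
    have "f k \<in> vanishing V" if "k < n" for k
      using that V by (auto simp: vanishing_def cover_def)
    then have "h \<in> lspan_mod base_funs E (vanishing V)"
      unfolding E_def by (intro total_funs_reduction[OF van _ h])
    then obtain h' where h': "h' \<in> lspan base_funs E" "h - h' \<in> vanishing V"
      unfolding lspan_mod_def by blast
    have "\<exists>N. h' \<in> S N"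
      using h'(1)
    proof (rule lspan_least[where S = "{h. \<exists>N. h \<in> S N}", simplified mem_Collect_eq])
      show "\<exists>N. 0 \<in> S N"
        unfolding S_def by (intro exI lspan_subset_mod[OF van] lspan.zero)
    next
      fix x y assume "\<exists>N. x \<in> S N" "\<exists>N. y \<in> S N"
      then obtain N N' where "x \<in> S N" "y \<in> S N'" by blast
      then have "x + y \<in> S (max N N')"
        using S_mono[of N "max N N'"] S_mono[of N' "max N N'"] by (intro S_add) auto
      then show "\<exists>N. x + y \<in> S N" by (rule exI)
    next
      fix a e assume "a \<in> base_funs" "e \<in> E"
      then show "\<exists>N. a * e \<in> S N" using span base_times by blast
    qed
    then obtain N where "h' \<in> S N" by blast
    then have "h \<in> S N" using h'(2) unfolding S_def by (rule lspan_mod_cong[OF van])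
    then show ?thesis by (rule exI)
  qed
  \<comment> \<open>The shift can be chosen independently of \<open>N\<close> and \<open>x\<close>,
    because only the products of \<open>h\<close> with the finitely many elements of
    \<open>E\<close> have to be expressed.\<close>
  have S_shift: "\<exists>c. \<forall>N. \<forall>x\<in>S N. h * x \<in> S (N + c)" if h: "h \<in> total_funs" for h
  proof -
    have "\<forall>e\<in>E. \<exists>N. h * e \<in> S N"
      using h E(3) by (intro ballI in_S polyfun_times) auto
    from bchoice[OF this] obtain b where b: "\<And>e. e \<in> E \<Longrightarrow> h * e \<in> S (b e)" by blast
    define c where "c = Max (b ` E)"
    have c: "h * e \<in> S c" if "e \<in> E" for e
      using b[OF that] S_mono[of "b e" c] that E(1) by (auto simp: c_def)
    have "h * x \<in> S (N + c)" if x: "x \<in> S N" for x N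
      unfolding S_def
    proof (rule lspan_mod_constants_times[OF van h])
      show "x \<in> cspan_mod (GE N) (vanishing V)" using x by (simp only: S_def)
      fix t assume "t \<in> GE N"
      then obtain g e where t: "t = g * e" "g \<in> G N" "e \<in> E" by (auto simp: GE_def)
      have "g * (h * e) \<in> S (N + c)"
        unfolding S_def
      proof (rule lspan_mod_constants_times[OF van])
        show "g \<in> total_funs" using t(2) G_total by blast
        show "h * e \<in> cspan_mod (GE c) (vanishing V)"
          using c[OF t(3)] by (simp only: S_def)
        fix u assume "u \<in> GE c"
        then obtain g' e' where u: "u = g' * e'" "g' \<in> G c" "e' \<in> E" by (auto simp: GE_def)
        have "(g * g') * e' \<in> S (N + c)" using base_times[OF times[OF t(2) u(2)] u(3)] .
        then show "g * u \<in> cspan_mod (GE (N + c)) (vanishing V)"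
          unfolding u(1) S_def by (simp only: mult.assoc)
      qed
      then show "h * t \<in> cspan_mod (GE (N + c)) (vanishing V)"
        unfolding t(1) S_def by (simp only: mult.left_commute)
    qed
    then show ?thesis by blast
  qed
  have "\<exists>\<phi>\<in>total_funs. \<phi> \<in> vanishing (Z j) \<and> \<phi> \<notin> vanishing (Z (Suc j))" if j: "j < l" for j
  proof -
    have "zariski_closed indices (Z j)" "zariski_closed indices (Z (Suc j))" "Z j \<subset> Z (Suc j)"
      using chain j by (auto simp: irreducible_chain_def irreducible_closed_def)
    then obtain x where x: "x \<in> Z (Suc j)" "x \<notin> Z j" "x \<in> affine_space indices"
      using zariski_closed_subset by blast
    obtain g where "g \<in> total_funs" "g \<in> vanishing (Z j)" "g x \<noteq> 0"
      using zariski_closed_separates[OF \<open>zariski_closed indices (Z j)\<close> x(3,2)] by blast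
    moreover from this(3) x(1) have "g \<notin> vanishing (Z (Suc j))" by (auto simp: vanishing_def)
    ultimately show ?thesis by blast
  qed
  then have "\<forall>j\<in>{..<l}. \<exists>\<phi>. \<phi> \<in> total_funs \<and> \<phi> \<in> vanishing (Z j) \<and> \<phi> \<notin> vanishing (Z (Suc j))" by blast
  from bchoice[OF this] obtain \<phi> where \<phi>: "\<And>j. j < l \<Longrightarrow> \<phi> j \<in> total_funs"
    "\<And>j. j < l \<Longrightarrow> \<phi> j \<in> vanishing (Z j)" "\<And>j. j < l \<Longrightarrow> \<phi> j \<notin> vanishing (Z (Suc j))" by blast
  have "\<forall>j\<in>{..<l}. \<exists>c. \<forall>N. \<forall>x\<in>S N. \<phi> j * x \<in> S (N + c)" using S_shift \<phi>(1) by blast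
  from bchoice[OF this] obtain b where b: "\<And>j N x. j < l \<Longrightarrow> x \<in> S N \<Longrightarrow> \<phi> j * x \<in> S (N + b j)" by blast
  define c where "c = (\<Sum>j<l. b j)"
  have c: "\<phi> j * x \<in> S (N + c)" if "j < l" "x \<in> S N" for j N x
    using b[OF that] S_mono[of "N + b j" "N + c"] member_le_sum[of j "{..<l}" b] that by (auto simp: c_def)
  have power: "\<phi> j ^ i * x \<in> S (N + i * c)" if "j < l" "x \<in> S N" for i j N x
  proof (induction i)
    case (Suc i)
    have "N + Suc i * c = N + i * c + c" by simp
    then show ?case using c[OF that(1) Suc.IH] by (simp only: power_Suc mult.assoc)
  qed (use that in simp)
  have monomials: "(\<Prod>j<k. \<phi> j ^ e j) \<in> S ((\<Sum>j<k. e j) * c)" if "k \<le> l" for k and e :: "nat \<Rightarrow> nat"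
    using that
  proof (induction k)
    case 0
    have "1 * 1 \<in> GE 0" using one E(2) unfolding GE_def by blast
    then have "1 \<in> S 0" unfolding S_def by (intro lspan_subset_mod[OF van] lspan_gen one_in_constants) simp
    then show ?case by (simp only: lessThan_0 prod.empty sum.empty mult_0)
  next
    case (Suc k)
    then have "\<phi> k ^ e k * (\<Prod>j<k. \<phi> j ^ e j) \<in> S ((\<Sum>j<k. e j) * c + e k * c)"
      by (intro power) auto
    then show ?case
      unfolding prod.lessThan_Suc sum.lessThan_Suc distrib_right by (simp only: mult.commute[of "\<phi> k ^ e k"])
  qed
  \<comment> \<open>The monomials with exponents at most \<open>N\<close> lie in
    \<open>S (l * N * c)\<close>, whose generators number at most N (N + 1)^delta by this choice of
    \<open>N\<close>. That is less than (N + 1)^l when l exceeds delta.\<close>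
  define N where "N = card E * C * (c * l + 1) ^ \<delta>"
  define X where "X = (\<Pi>\<^sub>E j\<in>{..<l}. {..N})"
  define M where "M = l * N * c"
  have X: "finite X" "card X = (N + 1) ^ l"
    unfolding X_def by (auto intro: finite_PiE simp: card_PiE)
  have in_SM: "(\<Prod>j<l. \<phi> j ^ e j) \<in> S M" if "e \<in> X" for e
  proof -
    have "(\<Sum>j<l. e j) \<le> (\<Sum>j<l. N)" using that by (intro sum_mono) (auto simp: X_def PiE_iff)
    then have "(\<Sum>j<l. e j) * c \<le> M" unfolding M_def by (intro mult_right_mono) auto
    then show ?thesis using monomials[OF order.refl, of e] S_mono by blast
  qed
  have GE_finite: "finite (GE M)" unfolding GE_def using fin E(1) by auto
  have "card (GE M) \<le> card (G M) * card E"
    unfolding GE_def using card_image_le[of "G M \<times> E" "\<lambda>(g, e). g * e"] fin E(1) by (simp add: card_cartesian_product)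
  also have "\<dots> \<le> C * (M + 1) ^ \<delta> * card E" using card by (intro mult_right_mono) auto
  also have "\<dots> \<le> C * ((c * l + 1) * (N + 1)) ^ \<delta> * card E"
    by (intro mult_right_mono mult_left_mono power_mono) (auto simp: M_def algebra_simps)
  also have "\<dots> = N * (N + 1) ^ \<delta>" by (simp only: N_def power_mult_distrib ac_simps)
  also have "\<dots> < (N + 1) * (N + 1) ^ \<delta>" by simp
  also have "\<dots> = (N + 1) ^ (\<delta> + 1)" by simp
  also have "\<dots> \<le> (N + 1) ^ l" using \<open>\<not> l \<le> \<delta>\<close> by (intro power_increasing) auto
  finally have less: "card (GE M) < card X" by (simp only: X(2))
  have "\<exists>q. (\<Prod>j<l. \<phi> j ^ e j) - (\<Sum>t\<in>GE M. const_fun (q t) * t) \<in> vanishing V" if e: "e \<in> X" for e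
  proof -
    obtain h where h: "h \<in> lspan (range const_fun) (GE M)" "(\<Prod>j<l. \<phi> j ^ e j) - h \<in> vanishing V"
      using in_SM[OF e] unfolding S_def lspan_mod_def by blast
    obtain a where a: "a \<in> GE M \<rightarrow> range const_fun" "h = (\<Sum>t\<in>GE M. a t * t)"
      using lspan_finite_rep[OF h(1) rng_closed_constants GE_finite] by blast
    have "\<forall>t\<in>GE M. \<exists>c. a t = const_fun c" using a(1) by blast
    from bchoice[OF this] obtain q where "\<And>t. t \<in> GE M \<Longrightarrow> a t = const_fun (q t)" by blast
    then have "h = (\<Sum>t\<in>GE M. const_fun (q t) * t)" unfolding a(2) by (intro sum.cong) auto
    then show ?thesis using h(2) by blast
  qed
  then have "\<forall>e\<in>X. \<exists>q. (\<Prod>j<l. \<phi> j ^ e j) - (\<Sum>t\<in>GE M. const_fun (q t) * t) \<in> vanishing V" by blast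
  from bchoice[OF this] obtain Q where
    Q: "\<And>e. e \<in> X \<Longrightarrow> (\<Prod>j<l. \<phi> j ^ e j) - (\<Sum>t\<in>GE M. const_fun (Q e t) * t) \<in> vanishing V" by blast
  \<comment> \<open>There are more exponents in \<open>X\<close> than elements of
    \<open>GE M\<close>, so a nontrivial combination of the monomials vanishes on \<open>V\<close>,
    hence on \<open>Z l\<close>.\<close>
  obtain a where a: "\<exists>e\<in>X. a e \<noteq> 0" "\<And>t. t \<in> GE M \<Longrightarrow> (\<Sum>e\<in>X. a e * Q e t) = 0"
    using underdetermined_system[OF GE_finite X(1) less, of Q] by blast
  define X' where "X' = {e \<in> X. a e \<noteq> 0}"
  have "(\<Sum>e\<in>X'. const_fun (a e) * (\<Prod>j<l. \<phi> j ^ e j)) \<notin> vanishing (Z l)"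
  proof (rule chain_monomials_independent[where \<phi> = \<phi> and c = a and X = X', OF chain])
    show "inj_on (\<lambda>e. restrict e {..<l}) X'"
    proof (rule inj_onI)
      fix e e' assume *: "e \<in> X'" "e' \<in> X'" "restrict e {..<l} = restrict e' {..<l}"
      have restr: "restrict e {..<l} = e" if "e \<in> X'" for e
        using that unfolding X'_def X_def by (blast intro: PiE_restrict)
      show "e = e'" by (rule trans[OF trans[OF restr[OF *(1), symmetric] *(3)] restr[OF *(2)]])
    qed
    show "finite X'" unfolding X'_def using X(1) by simp
    show "X' \<noteq> {}" unfolding X'_def using a(1) by blast
    show "a e \<noteq> 0" if "e \<in> X'" for e using that unfolding X'_def by blast
  qed (fact \<phi>)+
  moreover have "(\<Sum>e\<in>X'. const_fun (a e) * (\<Prod>j<l. \<phi> j ^ e j)) x = 0" if x: "x \<in> V" for x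
  proof -
    define P where "P e = (\<Prod>j<l. \<phi> j ^ e j) x" for e
    have "P e = (\<Sum>t\<in>GE M. Q e t * t x)" if "e \<in> X" for e
    proof -
      have "((\<Prod>j<l. \<phi> j ^ e j) - (\<Sum>t\<in>GE M. const_fun (Q e t) * t)) x = 0"
        using Q[OF that] x unfolding vanishing_def by blast
      then show ?thesis
        by (simp only: P_def minus_apply sum_fun_apply times_fun_apply const_fun_apply right_minus_eq)
    qed
    note P = this
    have "(\<Sum>e\<in>X'. const_fun (a e) * (\<Prod>j<l. \<phi> j ^ e j)) x = (\<Sum>e\<in>X'. a e * P e)"
      by (simp only: sum_fun_apply times_fun_apply const_fun_apply P_def)
    also have "\<dots> = (\<Sum>e\<in>X. a e * P e)"
      unfolding X'_def using X(1) by (intro sum.mono_neutral_left) auto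
    also have "\<dots> = (\<Sum>e\<in>X. a e * (\<Sum>t\<in>GE M. Q e t * t x))"
      using P by (intro sum.cong) auto
    also have "\<dots> = (\<Sum>t\<in>GE M. (\<Sum>e\<in>X. a e * Q e t) * t x)"
      unfolding sum_distrib_left sum_distrib_right by (subst sum.swap) (simp only: mult.assoc)
    also have "\<dots> = 0" using a(2) by simp
    finally show ?thesis .
  qed
  moreover have "Z l \<subseteq> V" using chain by (auto simp: irreducible_chain_def)
  ultimately show False unfolding vanishing_def by blast
qed

end

section \<open>The leading term of the Laine determinant\<close>

lemma fibre_deg_le_const_times:
  "g \<in> fibre_deg_le I0 r n N \<Longrightarrow> const_fun c * g \<in> fibre_deg_le I0 r n N"
  using fibre_deg_le_times[OF fibre_deg_le_base[OF polyfun_const, where N = 0], of g I0 r n N c]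
  by (simp only: add_0)

text \<open>Telescoping: with x the coordinate, g^(j+1) - x^(j+1) = g (g^j - x^j) + (g - x) x^j,
  where g - x has degree 0.\<close>

lemma shifted_power_leading:
  assumes "k < n" "g - coord (r k) \<in> polynomial_functions I0"
  shows "g ^ Suc m - coord (r k) ^ Suc m \<in> fibre_deg_le I0 r n m"
proof (induction m)
  case 0
  then show ?case using fibre_deg_le_base[OF assms(2)] by (simp only: power_Suc power_0 mult_1_right)
next
  case (Suc m)
  have D: "coord (r k) ^ i \<in> fibre_deg_le I0 r n i" for i
  proof (induction i)
    case 0
    show ?case unfolding power_0 by (intro fibre_deg_le_base polyfun_1)
  next
    case (Suc i)
    show ?case
      using fibre_deg_le_times[OF fibre_deg_le_coord[OF assms(1)] Suc.IH]
      by (simp only: power_Suc plus_1_eq_Suc)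
  qed
  have "(g - coord (r k)) + coord (r k) \<in> fibre_deg_le I0 r n 1"
    by (intro fibre_deg_le_add fibre_deg_le_base assms fibre_deg_le_coord)
  then have "g \<in> fibre_deg_le I0 r n 1" by (simp only: diff_add_cancel)
  from fibre_deg_le_times[OF this Suc.IH]
    fibre_deg_le_times[OF fibre_deg_le_base[OF assms(2), of r n 0] D[of "Suc m"]]
  have "g * (g ^ Suc m - coord (r k) ^ Suc m) + (g - coord (r k)) * coord (r k) ^ Suc m
      \<in> fibre_deg_le I0 r n (Suc m)"
    by (intro fibre_deg_le_add) (simp_all only: plus_1_eq_Suc add_0)
  also have "g * (g ^ Suc m - coord (r k) ^ Suc m) + (g - coord (r k)) * coord (r k) ^ Suc m
    = g ^ Suc (Suc m) - coord (r k) ^ Suc (Suc m)"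
  proof -
    have "g * (u - v) + (g - w) * v = g * u - w * v" for u v w
      by (simp only: right_diff_distrib left_diff_distrib) simp
    then show ?thesis by (simp only: power_Suc)
  qed
  finally show ?case .
qed

text \<open>Every permutation other than the cycle sending each row to the preceding column picks a
  constant entry, namely a diagonal entry or one above the diagonal.\<close>

definition laine_cycle :: "nat \<Rightarrow> nat \<Rightarrow> nat" where
  "laine_cycle m = (\<lambda>i. if i = 0 then m - 1 else if i < m then i - 1 else i)"

lemma laine_cycle_permutes:
  assumes "m \<ge> 1"
  shows "laine_cycle m permutes {0..<m}"
proof (rule bij_imp_permutes)
  show "bij_betw (laine_cycle m) {0..<m} {0..<m}"
  proof (rule bij_betwI[where g = "\<lambda>i. if i = m - 1 then 0 else i + 1"])
    show "laine_cycle m \<in> {0..<m} \<rightarrow> {0..<m}" using assms by (auto simp: laine_cycle_def)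
    show "(\<lambda>i. if i = m - 1 then 0 else i + 1) \<in> {0..<m} \<rightarrow> {0..<m}" using assms by auto
  qed (auto simp: laine_cycle_def split: if_splits)
qed (use assms in \<open>auto simp: laine_cycle_def\<close>)

text \<open>Row 0 must go to the last column, so by injectivity every other row i goes to a column
  less than i. A column less than i - 1 is already taken, by induction, by the row just after
  it.\<close>

lemma laine_cycle_unique:
  assumes "p permutes {0..<m}" "m \<ge> 1" "\<And>i. i < m \<Longrightarrow> p i < i \<or> p i = m - 1"
  shows "p = laine_cycle m"
proof
  fix i
  have inj: "p i = p j \<Longrightarrow> i = j" for i j
    using permutes_inj[OF assms(1)] by (auto dest: injD)
  have p0: "p 0 = m - 1" using assms(2) assms(3)[of 0] by auto
  have below: "p i < i" if "0 < i" "i < m" for i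
    using assms(3)[of i] that inj[of i 0] p0 by auto
  have pred: "p i = i - 1" if "0 < i" "i < m" for i
    using that
  proof (induction i rule: less_induct)
    case (less i)
    show ?case
    proof (rule ccontr)
      assume "p i \<noteq> i - 1"
      then have lt: "p i + 1 < i" using below[OF less.prems] by simp
      then have "p (p i + 1) = p i" using less.IH[of "p i + 1"] less.prems by simp
      then show False using inj[of "p i + 1" i] lt by simp
    qed
  qed
  show "p i = laine_cycle m i"
    using p0 pred[of i] permutes_not_in[OF assms(1), of i] by (auto simp: laine_cycle_def)
qed

text \<open>On the cycle every entry is \<open>b 1\<close>: below the diagonal and in the upper
  right corner. Any other permutation picks a factor of degree 0 and so loses at least one degree.
  The factor \<open>\<sigma>\<close> is the sign of the cycle.\<close>

lemma laine_det_leading: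
  assumes "k < n" "m \<ge> 1" and b: "\<And>j. b j \<in> fibre_deg_le I0 r n 1"
    and b1: "b 1 - coord (r k) \<in> polynomial_functions I0"
  shows "\<exists>\<sigma>. \<sigma> \<noteq> 0 \<and> (\<lambda>x. \<sigma> * Determinant.det (laine_matrix m (\<lambda>j. b j x))) - coord (r k) ^ m
    \<in> fibre_deg_le I0 r n (m - 1)"
proof -
  \<comment> \<open>The last column is tested first, since there the coefficients replace the
    diagonal entry; for m = 1 it is the whole matrix.\<close>
  define ent where "ent i c = (if c + 1 = m then b (i + 1) else if c < i then b (i - c)
    else if c = i then const_fun ((of_nat (i + 1))\<^sup>2 - of_nat (i + 1) * of_nat m) else 0)" for i c
  define F where "F N = fibre_deg_le I0 r n N" for N
  have ent: "laine_matrix m (\<lambda>j. b j x) $$ (i, c) = ent i c x" if "i < m" "c < m" for i c x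
    using that by (simp add: laine_matrix_def ent_def Let_def)
  have F1: "ent i c \<in> F 1" for i c
    unfolding ent_def F_def
    by (simp add: b[unfolded One_nat_def] fibre_deg_le_base polyfun_const polyfun_0)
  have F0: "ent i c \<in> F 0" if "c + 1 \<noteq> m" "\<not> c < i" for i c
    unfolding ent_def F_def using that
    by (simp add: fibre_deg_le_base polyfun_const polyfun_0)
  define T where "T p = (\<Prod>i = 0..<m. ent i (p i))" for p
  have det: "(\<lambda>x. Determinant.det (laine_matrix m (\<lambda>j. b j x)))
      = (\<Sum>p\<in>{p. p permutes {0..<m}}. const_fun (signof p) * T p)"
  proof
    fix x
    have dim: "laine_matrix m (\<lambda>j. b j x) \<in> carrier_mat m m" by (simp add: laine_matrix_def)
    have "Determinant.det (laine_matrix m (\<lambda>j. b j x))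
      = (\<Sum>p\<in>{p. p permutes {0..<m}}. signof p * (\<Prod>i = 0..<m. laine_matrix m (\<lambda>j. b j x) $$ (i, p i)))"
      by (rule det_def'[OF dim])
    also have "\<dots> = (\<Sum>p\<in>{p. p permutes {0..<m}}. (const_fun (signof p) * T p) x)"
    proof (rule sum.cong[OF refl])
      fix p assume "p \<in> {p. p permutes {0..<m}}"
      then have p: "p permutes {0..<m}" by simp
      have "(\<Prod>i = 0..<m. laine_matrix m (\<lambda>j. b j x) $$ (i, p i)) = (\<Prod>i = 0..<m. ent i (p i) x)"
      proof (rule prod.cong[OF refl])
        fix i assume i: "i \<in> {0..<m}"
        then have "p i < m" using permutes_in_image[OF p, of i] by simp
        then show "laine_matrix m (\<lambda>j. b j x) $$ (i, p i) = ent i (p i) x" using ent i by simp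
      qed
      then show "signof p * (\<Prod>i = 0..<m. laine_matrix m (\<lambda>j. b j x) $$ (i, p i))
        = (const_fun (signof p) * T p) x"
        by (simp only: T_def prod_fun_apply times_fun_apply const_fun_apply)
    qed
    finally show "Determinant.det (laine_matrix m (\<lambda>j. b j x))
      = (\<Sum>p\<in>{p. p permutes {0..<m}}. const_fun (signof p) * T p) x"
      by (simp only: sum_fun_apply)
  qed
  define p0 where "p0 = laine_cycle m"
  have p0: "p0 permutes {0..<m}" unfolding p0_def by (rule laine_cycle_permutes[OF assms(2)])
  have low: "T p \<in> F (m - 1)" if p: "p permutes {0..<m}" "p \<noteq> p0" for p
  proof -
    have "\<not> (\<forall>i<m. p i < i \<or> p i = m - 1)"
      using laine_cycle_unique[OF p(1) assms(2)] p(2) unfolding p0_def by blast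
    then obtain i0 where i0: "i0 < m" "\<not> p i0 < i0" "p i0 \<noteq> m - 1" by blast
    then have F0': "ent i0 (p i0) \<in> F 0" by (intro F0) auto
    have "T p \<in> F (\<Sum>i = 0..<m. if i = i0 then 0 else 1)"
      unfolding T_def F_def
    proof (rule fibre_deg_le_prod)
      show "ent i (p i) \<in> fibre_deg_le I0 r n (if i = i0 then 0 else 1)" for i
        using F1 F0' unfolding F_def by simp
    qed simp
    also have "(\<Sum>i = 0..<m. if i = i0 then 0 else 1) = m - 1"
    proof -
      have "(\<Sum>i = 0..<m. if i = i0 then 0 else (1::nat)) = (\<Sum>i\<in>{0..<m} - {i0}. 1)"
        by (intro sum.mono_neutral_cong_right) auto
      then show ?thesis using i0(1) by simp
    qed
    finally show ?thesis .
  qed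
  have top: "T p0 = b 1 ^ m"
  proof -
    have "ent i (p0 i) = b 1" if "i < m" for i
      using that by (auto simp: ent_def p0_def laine_cycle_def)
    then have "T p0 = (\<Prod>i = 0..<m. b 1)" unfolding T_def by (intro prod.cong) auto
    then show ?thesis by simp
  qed
  define \<sigma> where "\<sigma> = (signof p0 :: complex)"
  have \<sigma>: "\<sigma> * \<sigma> = 1" by (simp add: \<sigma>_def sign_def)
  have fin: "finite {p. p permutes {0..<m}}" by (rule finite_permutations) simp
  define R where "R = (\<Sum>p\<in>{p. p permutes {0..<m}} - {p0}. const_fun (signof p) * T p)"
  have R: "R \<in> F (m - 1)"
    unfolding R_def F_def
    by (intro fibre_deg_le_sum fibre_deg_le_const_times) (use low in \<open>auto simp: F_def\<close>)
  have "(\<lambda>x. \<sigma> * Determinant.det (laine_matrix m (\<lambda>j. b j x)))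
      = const_fun \<sigma> * (const_fun \<sigma> * b 1 ^ m + R)"
  proof
    fix x
    have "Determinant.det (laine_matrix m (\<lambda>j. b j x)) = (const_fun \<sigma> * b 1 ^ m + R) x"
      using fun_cong[OF det, of x] p0 fin unfolding R_def \<sigma>_def top[symmetric]
      by (simp only: sum.remove[OF fin, of p0] mem_Collect_eq)
    then show "\<sigma> * Determinant.det (laine_matrix m (\<lambda>j. b j x))
      = (const_fun \<sigma> * (const_fun \<sigma> * b 1 ^ m + R)) x"
      by (simp only: times_fun_apply const_fun_apply)
  qed
  also have "\<dots> = b 1 ^ m + const_fun \<sigma> * R"
  proof -
    have "const_fun \<sigma> * (const_fun \<sigma> * b 1 ^ m) = b 1 ^ m"
      using \<sigma> by (simp add: fun_eq_iff mult.assoc[symmetric])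
    then show ?thesis by (simp only: distrib_left)
  qed
  finally have eq: "(\<lambda>x. \<sigma> * Determinant.det (laine_matrix m (\<lambda>j. b j x))) - coord (r k) ^ m
    = (b 1 ^ m - coord (r k) ^ m) + const_fun \<sigma> * R" by (simp only: add_diff_eq diff_add_eq)
  have "(b 1 ^ m - coord (r k) ^ m) + const_fun \<sigma> * R \<in> F (m - 1)"
    unfolding F_def
  proof (rule fibre_deg_le_add)
    show "b 1 ^ m - coord (r k) ^ m \<in> fibre_deg_le I0 r n (m - 1)"
    proof -
      have "Suc (m - 1) = m" using assms(2) by simp
      then show ?thesis
        using shifted_power_leading[where m = "m - 1" and r = r and g = "b 1", OF assms(1) b1]
        by (simp only:)
    qed
    show "const_fun \<sigma> * R \<in> fibre_deg_le I0 r n (m - 1)"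
      using fibre_deg_le_const_times R unfolding F_def by blast
  qed
  then have "(\<lambda>x. \<sigma> * Determinant.det (laine_matrix m (\<lambda>j. b j x))) - coord (r k) ^ m
    \<in> fibre_deg_le I0 r n (m - 1)" unfolding eq F_def .
  moreover have "\<sigma> \<noteq> 0" using \<sigma> by auto
  ultimately show ?thesis by blast
qed

section \<open>Polynomials with invertible leading coefficient\<close>

definition base_indices :: "nat \<Rightarrow> laine_index set" where
  "base_indices d = Coeff ` {..d} \<union> {Lead_Inverse}"

definition hyperbola :: "nat \<Rightarrow> (laine_index \<Rightarrow> complex) set" where
  "hyperbola d = {s \<in> affine_space (base_indices d). s (Coeff d) * s Lead_Inverse = 1}"

text \<open>Freezing coefficients at 1 is compatible with an invertible leading coefficient. For j =
  0 a single point remains and for j = d + 1 the whole hyperbola, which gives d + 1 strict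
  inclusions.\<close>

definition hyp_flag :: "nat \<Rightarrow> nat \<Rightarrow> (laine_index \<Rightarrow> complex) set" where
  "hyp_flag d j = {s \<in> hyperbola d. \<forall>i. j \<le> i \<and> i \<le> d \<longrightarrow> s (Coeff i) = 1}"

lemma finite_base_indices: "finite (base_indices d)"
  by (simp add: base_indices_def)

lemma closed_hyp_flag: "zariski_closed (base_indices d) (hyp_flag d j)"
proof (rule zariski_closedI)
  let ?F = "{coord (Coeff d) * coord Lead_Inverse - 1} \<union> {coord (Coeff i) - 1 |i. j \<le> i \<and> i \<le> d}"
  show "?F \<subseteq> polynomial_functions (base_indices d)"
    by (auto simp: base_indices_def intro!: polyfun_minus polyfun_times
        polyfun_1 polyfun_coord)
  show "hyp_flag d j = {x \<in> affine_space (base_indices d). \<forall>f\<in>?F. f x = 0}"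
    unfolding hyp_flag_def hyperbola_def by (auto simp: ball_Un)
qed

text \<open>Two points of the flag are joined by an affine line in the coefficients; a polynomial function
  becomes a univariate rational function on it.\<close>

definition hyp_line :: "nat \<Rightarrow> (laine_index \<Rightarrow> complex) \<Rightarrow> (laine_index \<Rightarrow> complex) \<Rightarrow> complex
    \<Rightarrow> laine_index \<Rightarrow> complex" where
  "hyp_line d x y \<tau> = restrict (\<lambda>i. if i = Lead_Inverse
     then inverse (x (Coeff d) + \<tau> * (y (Coeff d) - x (Coeff d))) else x i + \<tau> * (y i - x i))
     (base_indices d)"

text \<open>The leading coefficient \<open>u\<close> along the line is the only denominator that can
  occur.\<close>

lemma hyp_line_rational:
  fixes x y :: "laine_index \<Rightarrow> complex"
  assumes "f \<in> polynomial_functions (base_indices d)"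
  defines "u \<equiv> [:x (Coeff d), y (Coeff d) - x (Coeff d):]"
  shows "\<exists>N p. \<forall>\<tau>. poly u \<tau> \<noteq> 0 \<longrightarrow> f (hyp_line d x y \<tau>) * poly u \<tau> ^ N = poly p \<tau>"
  using assms(1)
proof induction
  case (const c)
  show ?case by (intro exI[of _ 0] exI[of _ "[:c:]"]) simp
next
  case (coordinate i)
  show ?case
  proof (cases "i = Lead_Inverse")
    case True
    then show ?thesis
      by (intro exI[of _ 1] exI[of _ 1]) (auto simp: hyp_line_def u_def base_indices_def)
  next
    case False
    then show ?thesis using coordinate
      by (intro exI[of _ 0] exI[of _ "[:x i, y i - x i:]"]) (auto simp: hyp_line_def)
  qed
next
  case (add f g)
  then obtain N p M q where *:
    "\<And>\<tau>. poly u \<tau> \<noteq> 0 \<Longrightarrow> f (hyp_line d x y \<tau>) * poly u \<tau> ^ N = poly p \<tau>"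
    "\<And>\<tau>. poly u \<tau> \<noteq> 0 \<Longrightarrow> g (hyp_line d x y \<tau>) * poly u \<tau> ^ M = poly q \<tau>" by blast
  have "(f (hyp_line d x y \<tau>) + g (hyp_line d x y \<tau>)) * poly u \<tau> ^ (N + M)
      = poly (p * u ^ M + q * u ^ N) \<tau>" if "poly u \<tau> \<noteq> 0" for \<tau>
    using *[OF that, symmetric] by (simp add: power_add algebra_simps)
  then show ?case by blast
next
  case (mult f g)
  then obtain N p M q where *:
    "\<And>\<tau>. poly u \<tau> \<noteq> 0 \<Longrightarrow> f (hyp_line d x y \<tau>) * poly u \<tau> ^ N = poly p \<tau>"
    "\<And>\<tau>. poly u \<tau> \<noteq> 0 \<Longrightarrow> g (hyp_line d x y \<tau>) * poly u \<tau> ^ M = poly q \<tau>" by blast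
  have "(f (hyp_line d x y \<tau>) * g (hyp_line d x y \<tau>)) * poly u \<tau> ^ (N + M)
      = poly (p * q) \<tau>" if "poly u \<tau> \<noteq> 0" for \<tau>
    using *[OF that, symmetric] by (simp add: power_add algebra_simps)
  then show ?case by blast
qed

lemma hyp_line_0:
  assumes "x \<in> hyperbola d"
  shows "hyp_line d x y 0 = x" "x (Coeff d) \<noteq> 0" "x Lead_Inverse = inverse (x (Coeff d))"
proof -
  have *: "x (Coeff d) * x Lead_Inverse = 1" using assms by (simp add: hyperbola_def)
  then show "x (Coeff d) \<noteq> 0" by auto
  show "x Lead_Inverse = inverse (x (Coeff d))" using * by (simp add: inverse_unique)
  then show "hyp_line d x y 0 = x"
    using assms by (auto simp: hyp_line_def hyperbola_def affine_space_def fun_eq_iff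
        PiE_iff extensional_def)
qed

lemma hyp_line_1:
  assumes "y \<in> hyperbola d"
  shows "hyp_line d x y 1 = y"
  using hyp_line_0(3)[OF assms] assms
  by (auto simp: hyp_line_def hyperbola_def affine_space_def fun_eq_iff PiE_iff extensional_def)

lemma hyp_line_flag:
  assumes "x \<in> hyp_flag d j" "y \<in> hyp_flag d j"
    "x (Coeff d) + \<tau> * (y (Coeff d) - x (Coeff d)) \<noteq> 0"
  shows "hyp_line d x y \<tau> \<in> hyp_flag d j"
  using assms
  by (auto simp: hyp_flag_def hyperbola_def hyp_line_def affine_space_def base_indices_def)

lemma hyp_flag_point:
  assumes "c \<noteq> 0" "j \<le> d"
  shows "restrict (\<lambda>i. case i of Coeff i \<Rightarrow> if i = j then c else 1
      | Lead_Inverse \<Rightarrow> if j = d then inverse c else 1 | _ \<Rightarrow> 0) (base_indices d) \<in> hyp_flag d (Suc j)"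
    (is "?s \<in> _")
  using assms by (auto simp: hyp_flag_def hyperbola_def affine_space_def base_indices_def)

text \<open>On the line from \<open>x\<close> to \<open>y\<close> the numerator of f is nonzero at 0
  and that of g at 1. Together with \<open>u\<close> they have only finitely many roots, and any
  other parameter gives a point of the flag where both functions are nonzero.\<close>

lemma irreducible_hyp_flag: "irreducible_closed (base_indices d) (hyp_flag d j)"
proof (rule irreducible_closedI[OF closed_hyp_flag])
  have "restrict (\<lambda>_. 1) (base_indices d) \<in> hyp_flag d j"
    by (auto simp: hyp_flag_def hyperbola_def affine_space_def base_indices_def)
  then show "hyp_flag d j \<noteq> {}" by blast
next
  fix f g x y
  assume f: "f \<in> polynomial_functions (base_indices d)" "f x \<noteq> 0" and x: "x \<in> hyp_flag d j"
    and g: "g \<in> polynomial_functions (base_indices d)" "g y \<noteq> 0" and y: "y \<in> hyp_flag d j"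
  define u where "u = [:x (Coeff d), y (Coeff d) - x (Coeff d):]"
  have xy: "x \<in> hyperbola d" "y \<in> hyperbola d" using x y by (auto simp: hyp_flag_def)
  obtain N p where p: "\<And>\<tau>. poly u \<tau> \<noteq> 0 \<Longrightarrow> f (hyp_line d x y \<tau>) * poly u \<tau> ^ N = poly p \<tau>"
    using hyp_line_rational[OF f(1), of x y] unfolding u_def by blast
  obtain M q where q: "\<And>\<tau>. poly u \<tau> \<noteq> 0 \<Longrightarrow> g (hyp_line d x y \<tau>) * poly u \<tau> ^ M = poly q \<tau>"
    using hyp_line_rational[OF g(1), of x y] unfolding u_def by blast
  have u0: "poly u 0 \<noteq> 0" and u1: "poly u 1 \<noteq> 0"
    using hyp_line_0(2)[OF xy(1)] hyp_line_0(2)[OF xy(2)] by (simp_all add: u_def)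
  have "poly p 0 \<noteq> 0" "poly q 1 \<noteq> 0"
    using p[OF u0] q[OF u1] f(2) g(2) u0 u1
    by (auto simp: hyp_line_0(1)[OF xy(1)] hyp_line_1[OF xy(2)] simp flip: p q)
  then have "u * p * q \<noteq> 0" using u0 by auto
  then have "finite {\<tau>. poly (u * p * q) \<tau> = 0}" by (rule poly_roots_finite)
  then obtain \<tau> where \<tau>: "poly (u * p * q) \<tau> \<noteq> 0"
    using ex_new_if_finite[OF infinite_UNIV_char_0] by blast
  then have "poly u \<tau> \<noteq> 0" by simp
  then have "hyp_line d x y \<tau> \<in> hyp_flag d j"
    by (intro hyp_line_flag x y) (simp add: u_def)
  moreover have "f (hyp_line d x y \<tau>) * g (hyp_line d x y \<tau>) \<noteq> 0"
    using \<tau> p[OF \<open>poly u \<tau> \<noteq> 0\<close>] q[OF \<open>poly u \<tau> \<noteq> 0\<close>] by auto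
  ultimately show "\<exists>z\<in>hyp_flag d j. f z * g z \<noteq> 0" by blast
qed

lemma hyp_flag_strict:
  assumes "j \<le> d"
  shows "hyp_flag d j \<subset> hyp_flag d (Suc j)"
proof
  show "hyp_flag d j \<subseteq> hyp_flag d (Suc j)" by (auto simp: hyp_flag_def)
  \<comment> \<open>The coefficient that is frozen at 1 in the smaller set gets the value 2; for j =
    d the adjoined inverse has to follow.\<close>
  define s where "s = restrict (\<lambda>i. case i of Coeff i \<Rightarrow> if i = j then 2 else 1
      | Lead_Inverse \<Rightarrow> if j = d then inverse 2 else (1::complex) | _ \<Rightarrow> 0) (base_indices d)"
  have "s \<in> hyp_flag d (Suc j)" unfolding s_def using hyp_flag_point[of 2 j d] assms by simp
  moreover have "s (Coeff j) = 2" using assms by (simp add: s_def base_indices_def)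
  then have "s \<notin> hyp_flag d j" using assms by (auto simp: hyp_flag_def)
  ultimately show "hyp_flag d j \<noteq> hyp_flag d (Suc j)" by blast
qed

text \<open>On the hyperbola \<open>Coeff d\<close> and \<open>Lead_Inverse\<close> are inverse to
  each other, so powers of only one of them need to occur; the Boolean tells which. Hence d + 1
  exponents suffice for d + 2 coordinates, and the growth exponent is the dimension d + 1.\<close>

definition hyp_monomials :: "nat \<Rightarrow> nat \<Rightarrow> ((laine_index \<Rightarrow> complex) \<Rightarrow> complex) set" where
  "hyp_monomials d N = (\<lambda>(e, i, l). (\<Prod>j<d. coord (Coeff j) ^ e j) * coord (if l then Lead_Inverse else Coeff d) ^ i)
     ` (({..<d} \<rightarrow>\<^sub>E {..N}) \<times> {..N} \<times> UNIV)"

lemma hyp_monomialsI: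
  assumes "\<And>j. j < d \<Longrightarrow> e j \<le> N" "i \<le> N" "i' = Lead_Inverse \<or> i' = Coeff d"
  shows "(\<Prod>j<d. coord (Coeff j) ^ e j) * coord i' ^ i \<in> hyp_monomials d N"
proof -
  have "(\<Prod>j<d. coord (Coeff j) ^ e j) = (\<Prod>j<d. coord (Coeff j) ^ restrict e {..<d} j)"
    by (intro prod.cong) auto
  moreover have "(restrict e {..<d}, i, i' = Lead_Inverse) \<in> ({..<d} \<rightarrow>\<^sub>E {..N}) \<times> {..N} \<times> UNIV"
    using assms by auto
  moreover have "i' = (if i' = Lead_Inverse then Lead_Inverse else Coeff d)" using assms(3) by auto
  ultimately show ?thesis
    unfolding hyp_monomials_def
    by (intro image_eqI[of _ _ "(restrict e {..<d}, i, i' = Lead_Inverse)"]) (simp_all only: prod.case)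
qed

lemma hyp_monomialsE:
  assumes "g \<in> hyp_monomials d N"
  obtains e i i' where "\<And>j. j < d \<Longrightarrow> e j \<le> N" "i \<le> N" "i' = Lead_Inverse \<or> i' = Coeff d"
    "g = (\<Prod>j<d. coord (Coeff j) ^ e j) * coord i' ^ i"
proof -
  let ?m = "\<lambda>(e, i, l). (\<Prod>j<d. coord (Coeff j) ^ e j) * coord (if l then Lead_Inverse else Coeff d) ^ i"
  obtain y where y: "g = ?m y" "y \<in> ({..<d} \<rightarrow>\<^sub>E {..N}) \<times> {..N} \<times> UNIV"
    using assms unfolding hyp_monomials_def by (rule imageE)
  obtain e i l where eil: "y = (e, i, l)" by (cases y) blast
  have "e \<in> {..<d} \<rightarrow>\<^sub>E {..N}" "i \<le> N" using y(2) unfolding eil by blast+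
  moreover from this(1) have "e j \<le> N" if "j < d" for j
    using that by (auto simp only: PiE_iff atMost_iff lessThan_iff)
  moreover have "g = (\<Prod>j<d. coord (Coeff j) ^ e j) * coord (if l then Lead_Inverse else Coeff d) ^ i"
    unfolding y(1) eil by (simp only: prod.case)
  ultimately show ?thesis
    by (intro that[of e i "if l then Lead_Inverse else Coeff d"]) (auto simp only: split: if_splits)
qed

lemma finite_hyp_monomials: "finite (hyp_monomials d N)"
  unfolding hyp_monomials_def by (auto intro!: finite_imageI finite_cartesian_product finite_PiE)

lemma card_hyp_monomials: "card (hyp_monomials d N) \<le> 2 * (N + 1) ^ (d + 1)"
proof -
  have "finite ({..<d} \<rightarrow>\<^sub>E {..N})" by (intro finite_PiE) auto
  then have "card (hyp_monomials d N) \<le> card (({..<d} \<rightarrow>\<^sub>E {..N}) \<times> {..N} \<times> (UNIV :: bool set))"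
    unfolding hyp_monomials_def by (intro card_image_le) auto
  also have "\<dots> = 2 * (N + 1) ^ (d + 1)"
    by (simp add: card_cartesian_product card_PiE card_UNIV_bool)
  finally show ?thesis .
qed

lemma hyp_monomials_mono:
  assumes "N \<le> N'"
  shows "hyp_monomials d N \<subseteq> hyp_monomials d N'"
proof
  fix g assume "g \<in> hyp_monomials d N"
  then obtain e i i' where g: "\<And>j. j < d \<Longrightarrow> e j \<le> N" "i \<le> N" "i' = Lead_Inverse \<or> i' = Coeff d"
    "g = (\<Prod>j<d. coord (Coeff j) ^ e j) * coord i' ^ i" by (rule hyp_monomialsE) blast
  show "g \<in> hyp_monomials d N'"
    unfolding g(4) using g(1-3) assms by (intro hyp_monomialsI) (auto intro: order.trans)
qed

lemma hyp_monomials_polynomial: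
  "hyp_monomials d N \<subseteq> polynomial_functions (base_indices d)"
proof
  fix g assume "g \<in> hyp_monomials d N"
  then obtain e i i' where g: "i' = Lead_Inverse \<or> i' = Coeff d"
    "g = (\<Prod>j<d. coord (Coeff j) ^ e j) * coord i' ^ i" by (rule hyp_monomialsE) blast
  show "g \<in> polynomial_functions (base_indices d)"
    unfolding g(2) using g(1)
    by (intro polyfun_times polyfun_prod polyfun_power
        polyfun_coord) (auto simp: base_indices_def)
qed

lemma hyp_monomials_times:
  assumes V: "\<And>x. x \<in> V \<Longrightarrow> x (Coeff d) * x Lead_Inverse = 1"
    and "g \<in> hyp_monomials d N" "g' \<in> hyp_monomials d N'"
  shows "g * g' \<in> cspan_mod (hyp_monomials d (N + N')) (vanishing V)"
proof -
  obtain e i c where g: "\<And>j. j < d \<Longrightarrow> e j \<le> N" "i \<le> N" "c = Lead_Inverse \<or> c = Coeff d"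
    "g = (\<Prod>j<d. coord (Coeff j) ^ e j) * coord c ^ i"
    using assms(2) by (rule hyp_monomialsE) blast
  obtain e' i' c' where g': "\<And>j. j < d \<Longrightarrow> e' j \<le> N'" "i' \<le> N'" "c' = Lead_Inverse \<or> c' = Coeff d"
    "g' = (\<Prod>j<d. coord (Coeff j) ^ e' j) * coord c' ^ i'"
    using assms(3) by (rule hyp_monomialsE) blast
  \<comment> \<open>Exponents of equal coordinates add. Different coordinates are inverse to each
    other on \<open>V\<close>, so the smaller exponent cancels against the larger.\<close>
  obtain b l where bl: "b = Lead_Inverse \<or> b = Coeff d" "l \<le> N + N'"
    "\<And>x. x \<in> V \<Longrightarrow> x c ^ i * x c' ^ i' = x b ^ l"
  proof (cases "c = c'")
    case True
    show ?thesis by (rule that[of c "i + i'"]) (use True g g' in \<open>auto simp: power_add\<close>)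
  next
    case False
    have inv: "x c * x c' = 1" if "x \<in> V" for x
      using V[OF that] g(3) g'(3) False by (auto simp: mult.commute)
    show ?thesis
    proof (cases "i \<le> i'")
      case True
      have "x c ^ i * x c' ^ i' = x c' ^ (i' - i)" if "x \<in> V" for x
      proof -
        have "x c ^ i * x c' ^ i' = (x c * x c') ^ i * x c' ^ (i' - i)"
          using True by (simp add: power_mult_distrib mult.assoc flip: power_add)
        then show ?thesis using inv[OF that] by simp
      qed
      then show ?thesis using g'(2,3) by (intro that[of c' "i' - i"]) auto
    next
      case False
      have "x c ^ i * x c' ^ i' = x c ^ (i - i')" if "x \<in> V" for x
      proof -
        have "x c ^ i * x c' ^ i' = (x c * x c') ^ i' * x c ^ (i - i')"
          using False by (simp add: power_mult_distrib mult.assoc mult.left_commute mult.commute flip: power_add)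
        then show ?thesis using inv[OF that] by simp
      qed
      then show ?thesis using g(2,3) by (intro that[of c "i - i'"]) auto
    qed
  qed
  define h where "h = (\<Prod>j<d. coord (Coeff j) ^ (e j + e' j)) * coord b ^ l"
  have "h \<in> hyp_monomials d (N + N')"
    unfolding h_def using g(1) g'(1) bl by (intro hyp_monomialsI) (auto intro: add_mono)
  then have "h \<in> lspan (range const_fun) (hyp_monomials d (N + N'))"
    by (intro lspan_gen one_in_constants)
  moreover have "g * g' - h \<in> vanishing V"
    unfolding vanishing_def
  proof (intro CollectI ballI)
    fix x assume x: "x \<in> V"
    have "(g * g') x = (\<Prod>j<d. x (Coeff j) ^ (e j + e' j)) * (x c ^ i * x c' ^ i')"
      by (simp add: g(4) g'(4) prod_fun_apply power_fun_apply power_add prod.distrib mult_ac)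
    also have "\<dots> = h x" using bl(3)[OF x] by (simp add: h_def prod_fun_apply power_fun_apply)
    finally show "(g * g' - h) x = 0" by simp
  qed
  ultimately show ?thesis by (rule lspan_modI)
qed

lemma hyp_monomials_span:
  assumes V: "\<And>x. x \<in> V \<Longrightarrow> x (Coeff d) * x Lead_Inverse = 1"
    and "a \<in> polynomial_functions (base_indices d)"
  shows "\<exists>N. a \<in> cspan_mod (hyp_monomials d N) (vanishing V)"
proof -
  note van = ideal_vanishing[of UNIV V]
  have mono: "cspan_mod (hyp_monomials d N) (vanishing V)
      \<subseteq> cspan_mod (hyp_monomials d N') (vanishing V)" if "N \<le> N'" for N N'
    using hyp_monomials_mono[OF that] by (intro lspan_mod_mono) auto
  have gen: "g \<in> cspan_mod (hyp_monomials d N) (vanishing V)"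
    if "g \<in> hyp_monomials d N" for g N
    using that by (intro lspan_subset_mod[OF van] lspan_gen one_in_constants)
  show ?thesis
    using assms(2)
  proof induction
    case (const c)
    have "const_fun c * ((\<Prod>j<d. coord (Coeff j) ^ 0) * coord (Coeff d) ^ 0)
        \<in> cspan_mod (hyp_monomials d 0) (vanishing V)"
      by (intro lspan_subset_mod[OF van] lspan_mult_gen hyp_monomialsI) auto
    also have "const_fun c * ((\<Prod>j<d. coord (Coeff j) ^ 0) * coord (Coeff d) ^ 0) = (\<lambda>x. c)"
      by (simp add: fun_eq_iff)
    finally show ?case by (rule exI)
  next
    case (coordinate i)
    consider "i = Lead_Inverse \<or> i = Coeff d" | k where "i = Coeff k" "k < d"
      using coordinate by (force simp: base_indices_def le_less)
    then show ?case
    proof cases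
      case 1
      then have "(\<Prod>j<d. coord (Coeff j) ^ 0) * coord i ^ 1 \<in> hyp_monomials d 1"
        by (intro hyp_monomialsI) auto
      also have "(\<Prod>j<d. coord (Coeff j) ^ 0) * coord i ^ 1 = (\<lambda>x. x i)" by (simp add: fun_eq_iff)
      finally show ?thesis using gen by blast
    next
      case 2
      have "(\<Prod>j<d. coord (Coeff j) ^ (if j = k then 1 else 0)) * coord (Coeff d) ^ 0 \<in> hyp_monomials d 1"
        by (intro hyp_monomialsI) auto
      also have "(\<Prod>j<d. coord (Coeff j) ^ (if j = k then 1 else 0)) * coord (Coeff d) ^ 0 = (\<lambda>x. x i)"
      proof -
        have "(\<Prod>j<d. coord (Coeff j) ^ (if j = k then 1 else 0)) = (\<Prod>j<d. if j = k then coord (Coeff k) else 1)"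
          by (intro prod.cong) auto
        then show ?thesis using 2 by (simp add: fun_eq_iff)
      qed
      finally show ?thesis using gen by blast
    qed
  next
    case (add f g)
    then obtain N M where NM: "f \<in> cspan_mod (hyp_monomials d N) (vanishing V)"
      "g \<in> cspan_mod (hyp_monomials d M) (vanishing V)" by blast
    then have "f + g \<in> cspan_mod (hyp_monomials d (max N M)) (vanishing V)"
      using mono[of N "max N M"] mono[of M "max N M"] by (intro lspan_mod_add[OF van]) auto
    then show ?case unfolding plus_fun_def by (rule exI)
  next
    case (mult f g)
    then obtain N M where f: "f \<in> cspan_mod (hyp_monomials d N) (vanishing V)"
      and g: "g \<in> cspan_mod (hyp_monomials d M) (vanishing V)" by blast
    let ?S = "cspan_mod (hyp_monomials d (N + M)) (vanishing V)"
    obtain f' where f': "f' \<in> lspan (range const_fun) (hyp_monomials d N)" "f - f' \<in> vanishing V"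
      using f unfolding lspan_mod_def by blast
    have "f' * g \<in> ?S"
    proof (rule lspan_mod_times[OF f'(1) g ideal_vanishing[of UNIV V]])
      show "rng_closed (UNIV :: ((laine_index \<Rightarrow> complex) \<Rightarrow> complex) set)" by (simp add: rng_closed_def)
      fix a t a' t' :: "(laine_index \<Rightarrow> complex) \<Rightarrow> complex"
      assume a: "a \<in> range const_fun" "a' \<in> range const_fun"
        and t: "t \<in> hyp_monomials d N" "t' \<in> hyp_monomials d M"
      have "a * a' \<in> range const_fun" using rng_closedD(3)[OF rng_closed_constants a] .
      then have "(a * a') * (t * t') \<in> ?S"
        using rng_closedD(3)[OF rng_closed_constants]
        by (intro lspan_mod_scale[OF van _ hyp_monomials_times[OF V t]]) auto
      then show "(a * t) * (a' * t') \<in> ?S" by (simp only: ac_simps)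
    qed auto
    moreover have "f * g - f' * g \<in> vanishing V"
      using ideal_overD(3)[OF van UNIV_I f'(2), of g] by (simp only: left_diff_distrib mult.commute[of g])
    ultimately have "f * g \<in> ?S" by (rule lspan_mod_cong[OF van])
    then show ?case unfolding times_fun_def by (rule exI)
  qed
qed

section \<open>Laurent expansions at the zeros of \<open>P\<close>\<close>

lemma laine_matrix_cong:
  "(\<And>j. j \<ge> 1 \<Longrightarrow> b j = b' j) \<Longrightarrow> laine_matrix m b = laine_matrix m b'"
  unfolding laine_matrix_def by (intro cong_mat) (auto simp: Let_def)

text \<open>Here \<open>d\<close> stands for q - p, the degree of S.\<close>

locale laine_setup =
  fixes n d :: nat and a :: "nat \<Rightarrow> complex" and \<alpha> :: "nat \<Rightarrow> nat" and P :: "complex poly"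
  assumes inj_a: "inj_on a {..<n}"
    and \<alpha>_pos: "\<And>k. k < n \<Longrightarrow> \<alpha> k \<ge> 1"
    and P_def: "P = (\<Prod>k<n. [:- a k, 1:] ^ \<alpha> k)"
begin

lemma P_eval: "poly P z = (\<Prod>k<n. (z - a k) ^ \<alpha> k)"
  by (simp add: P_def poly_prod)

lemma P_zero_iff: "poly P z = 0 \<longleftrightarrow> z \<in> a ` {..<n}"
  using \<alpha>_pos by (force simp: P_eval)

lemma P_nonzero: "P \<noteq> 0"
  by (auto simp: P_def)

lemma open_nonzeros: "open {z. poly P z \<noteq> 0}"
proof -
  have "{z. poly P z \<noteq> 0} = - (a ` {..<n})" by (auto simp: P_zero_iff)
  then show ?thesis by (simp add: finite_imp_closed open_Compl)
qed

lemma eventually_nonzero: "eventually (\<lambda>w. poly P w \<noteq> 0) (at z)"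
proof -
  have "open (- (a ` {..<n} - {z}))" by (intro open_Compl finite_imp_closed) simp
  then have "eventually (\<lambda>w. w \<in> - (a ` {..<n} - {z}) - {z}) (at z)"
    by (intro eventually_at_in_open) auto
  then show ?thesis by eventually_elim (auto simp: P_zero_iff)
qed

lemma logarithmic_derivative:
  assumes "poly P z \<noteq> 0"
  shows "poly (pderiv P) z / poly P z = (\<Sum>k<n. of_nat (\<alpha> k) / (z - a k))"
proof -
  have nz: "z - a k \<noteq> 0" if "k < n" for k using assms that by (auto simp: P_zero_iff)
  have "poly (pderiv P) z
      = (\<Sum>k<n. (\<Prod>j\<in>{..<n} - {k}. (z - a j) ^ \<alpha> j) * (of_nat (\<alpha> k) * (z - a k) ^ (\<alpha> k - 1)))"
    unfolding P_def pderiv_prod by (simp add: poly_sum poly_prod pderiv_power pderiv_pCons mult_ac)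
  also have "\<dots> = (\<Sum>k<n. poly P z * (of_nat (\<alpha> k) / (z - a k)))"
  proof (rule sum.cong[OF refl])
    fix k assume k: "k \<in> {..<n}"
    have pow: "(z - a k) ^ \<alpha> k = (z - a k) ^ (\<alpha> k - 1) * (z - a k)"
      using \<alpha>_pos[of k] k by (metis lessThan_iff Suc_diff_1 power_Suc2 less_eq_Suc_le One_nat_def)
    have P: "poly P z = (z - a k) ^ \<alpha> k * (\<Prod>j\<in>{..<n} - {k}. (z - a j) ^ \<alpha> j)"
      unfolding P_eval using k by (intro prod.remove) auto
    have "u * (c * x) = x * y * u * (c / y)" if "y \<noteq> 0" for u c x y :: complex
      using that by simp
    then show "(\<Prod>j\<in>{..<n} - {k}. (z - a j) ^ \<alpha> j) * (of_nat (\<alpha> k) * (z - a k) ^ (\<alpha> k - 1))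
        = poly P z * (of_nat (\<alpha> k) / (z - a k))"
      unfolding P pow using nz k by blast
  qed
  also have "\<dots> = poly P z * (\<Sum>k<n. of_nat (\<alpha> k) / (z - a k))" by (simp only: sum_distrib_left)
  finally show ?thesis using assms by simp
qed

text \<open>The function R away from the zeros of P, with the partial fractions of P'/P and Q/P
  inserted.\<close>

definition explicit_R :: "complex poly \<Rightarrow> (nat \<Rightarrow> complex) \<Rightarrow> complex \<Rightarrow> complex" where
  "explicit_R S D z = - 1/2 * (\<Sum>k<n. of_nat (\<alpha> k) / (z - a k)\<^sup>2)
     - 1/4 * (\<Sum>k<n. of_nat (\<alpha> k) / (z - a k))\<^sup>2 + poly S z + (\<Sum>k<n. D k / (z - a k))"

lemma two_R_explicit:
  assumes "poly P z \<noteq> 0" "poly Q z / poly P z = poly S z + (\<Sum>k<n. D k / (z - a k))"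
  shows "two_R P Q z / 2 = explicit_R S D z"
proof -
  have nz: "z - a k \<noteq> 0" if "k < n" for k using assms that by (auto simp: P_zero_iff)
  have "eventually (\<lambda>w. w \<in> {z. poly P z \<noteq> 0}) (nhds z)"
    using open_nonzeros assms(1) by (intro eventually_nhds_in_open) auto
  then have "eventually (\<lambda>w. poly (pderiv P) w / poly P w = (\<Sum>k<n. of_nat (\<alpha> k) / (w - a k))) (nhds z)"
    by eventually_elim (use logarithmic_derivative in blast)
  then have "deriv (\<lambda>w. poly (pderiv P) w / poly P w) z = deriv (\<lambda>w. \<Sum>k<n. of_nat (\<alpha> k) / (w - a k)) z"
    by (rule deriv_cong_ev) simp
  also have "\<dots> = (\<Sum>k<n. - (of_nat (\<alpha> k) / (z - a k)\<^sup>2))"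
  proof (rule DERIV_imp_deriv, rule DERIV_sum)
    fix k assume "k \<in> {..<n}"
    then show "((\<lambda>w. of_nat (\<alpha> k) / (w - a k)) has_field_derivative - (of_nat (\<alpha> k) / (z - a k)\<^sup>2)) (at z)"
      using nz[of k] by (auto intro!: derivative_eq_intros simp: power2_eq_square)
  qed
  finally show ?thesis
    using assms(2) logarithmic_derivative[OF assms(1)]
    by (simp add: two_R_def explicit_R_def sum_negf add_divide_distrib diff_divide_distrib)
qed

text \<open>For j different from k, the Taylor series of 1/(z - a_j) at a_k.\<close>

definition pole_fps :: "nat \<Rightarrow> nat \<Rightarrow> complex fps" where
  "pole_fps k j = inverse (fps_const (a k - a j) + fps_X)"

lemma pole_fps_expansion:
  assumes "k < n" "j \<in> {..<n} - {k}"
  shows "(\<lambda>w. inverse (a k + w - a j)) has_fps_expansion pole_fps k j"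
proof -
  have "a k \<noteq> a j" using assms inj_onD[OF inj_a] by auto
  then have "(\<lambda>w. inverse ((a k - a j) + w)) has_fps_expansion inverse (fps_const (a k - a j) + fps_X)"
    by (intro has_fps_expansion_inverse has_fps_expansion_add has_fps_expansion_const
        has_fps_expansion_fps_X) simp
  then show ?thesis by (simp add: pole_fps_def algebra_simps)
qed

definition log_fps :: "nat \<Rightarrow> complex fps" where
  "log_fps k = (\<Sum>j\<in>{..<n} - {k}. fps_const (of_nat (\<alpha> j)) * pole_fps k j)"

text \<open>Minus the derivative of the part of P'/P that is regular at a_k. The square of that part
  is \<open>log_fps k * log_fps k\<close>, a different series.\<close>

definition log_square_fps :: "nat \<Rightarrow> complex fps" where
  "log_square_fps k = (\<Sum>j\<in>{..<n} - {k}. fps_const (of_nat (\<alpha> j)) * (pole_fps k j * pole_fps k j))"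

text \<open>With w = z - a_k, the logarithmic derivative P'/P is alpha_k/w + h with h regular.
  Expanding its square yields the terms alpha_k^2/w^2, 2 alpha_k h/w and h^2, each entering R with
  the factor -1/4.\<close>

definition R_fls :: "nat \<Rightarrow> complex poly \<Rightarrow> (nat \<Rightarrow> complex) \<Rightarrow> complex fls" where
  "R_fls k S D = fls_const (- of_nat (\<alpha> k) / 2 - (of_nat (\<alpha> k))\<^sup>2 / 4) * fls_X_inv ^ 2
     + fls_const (D k) * fls_X_inv - fls_const (of_nat (\<alpha> k) / 2) * (fls_X_inv * fps_to_fls (log_fps k))
     + fps_to_fls (fps_const (- 1/2) * log_square_fps k - fps_const (1/4) * (log_fps k * log_fps k)
       + (\<Sum>i\<le>degree S. fps_const (coeff S i) * (fps_const (a k) + fps_X) ^ i)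
       + (\<Sum>j\<in>{..<n} - {k}. fps_const (D j) * pole_fps k j))"

lemma explicit_R_expansion:
  assumes k: "k < n"
  shows "(\<lambda>w. explicit_R S D (a k + w)) has_laurent_expansion R_fls k S D"
proof -
  define h where "h w = (\<Sum>j\<in>{..<n} - {k}. of_nat (\<alpha> j) * inverse (a k + w - a j))" for w
  define h2 where "h2 w = (\<Sum>j\<in>{..<n} - {k}. of_nat (\<alpha> j) * (inverse (a k + w - a j) * inverse (a k + w - a j)))" for w
  define s where "s w = (\<Sum>i\<le>degree S. coeff S i * (a k + w) ^ i)" for w
  define g where "g w = (\<Sum>j\<in>{..<n} - {k}. D j * inverse (a k + w - a j))" for w
  have h: "h has_fps_expansion log_fps k"
    unfolding h_def log_fps_def
    by (intro has_fps_expansion_sum has_fps_expansion_cmult_left pole_fps_expansion k)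
  have h2: "h2 has_fps_expansion log_square_fps k"
    unfolding h2_def log_square_fps_def
    by (intro has_fps_expansion_sum has_fps_expansion_cmult_left has_fps_expansion_mult pole_fps_expansion k)
  have "(\<lambda>w. (a k + w) ^ i) has_fps_expansion (fps_const (a k) + fps_X) ^ i" for i
  proof (induction i)
    case (Suc i)
    then show ?case
      unfolding power_Suc
      by (intro has_fps_expansion_mult has_fps_expansion_add has_fps_expansion_const has_fps_expansion_fps_X)
  qed (simp add: has_fps_expansion_1)
  then have s: "s has_fps_expansion (\<Sum>i\<le>degree S. fps_const (coeff S i) * (fps_const (a k) + fps_X) ^ i)"
    unfolding s_def by (intro has_fps_expansion_sum has_fps_expansion_cmult_left)
  have g: "g has_fps_expansion (\<Sum>j\<in>{..<n} - {k}. fps_const (D j) * pole_fps k j)"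
    unfolding g_def by (intro has_fps_expansion_sum has_fps_expansion_cmult_left pole_fps_expansion k)
  have fps: "(\<lambda>w. - 1/2 * h2 w - 1/4 * (h w * h w) + s w + g w) has_fps_expansion
      fps_const (- 1/2) * log_square_fps k - fps_const (1/4) * (log_fps k * log_fps k)
       + (\<Sum>i\<le>degree S. fps_const (coeff S i) * (fps_const (a k) + fps_X) ^ i)
       + (\<Sum>j\<in>{..<n} - {k}. fps_const (D j) * pole_fps k j)"
    by (intro has_fps_expansion_add has_fps_expansion_diff has_fps_expansion_cmult_left
        has_fps_expansion_mult h h2 s g)
  have expansion: "(\<lambda>w. (- of_nat (\<alpha> k) / 2 - (of_nat (\<alpha> k))\<^sup>2 / 4) * inverse w ^ 2 + D k * inverse w
      - of_nat (\<alpha> k) / 2 * (inverse w * h w) + (- 1/2 * h2 w - 1/4 * (h w * h w) + s w + g w))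
      has_laurent_expansion R_fls k S D"
    unfolding R_fls_def
    by (intro has_laurent_expansion_add has_laurent_expansion_diff has_laurent_expansion_cmult_left
        has_laurent_expansion_power has_laurent_expansion_mult has_laurent_expansion_fls_X_inv
        has_laurent_expansion_fps h fps)
  have split: "(\<Sum>j<n. F j) = F k + (\<Sum>j\<in>{..<n} - {k}. F j)" for F :: "nat \<Rightarrow> complex"
    using k by (intro sum.remove) auto
  have eq: "explicit_R S D (a k + w) = (- of_nat (\<alpha> k) / 2 - (of_nat (\<alpha> k))\<^sup>2 / 4) * inverse w ^ 2 + D k * inverse w
      - of_nat (\<alpha> k) / 2 * (inverse w * h w) + (- 1/2 * h2 w - 1/4 * (h w * h w) + s w + g w)" for w
  proof -
    have 1: "(\<Sum>j<n. of_nat (\<alpha> j) / (a k + w - a j)) = of_nat (\<alpha> k) * inverse w + h w"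
      unfolding split h_def by (simp add: divide_inverse)
    have 2: "(\<Sum>j<n. of_nat (\<alpha> j) / (a k + w - a j)\<^sup>2) = of_nat (\<alpha> k) * inverse w ^ 2 + h2 w"
      unfolding split h2_def by (simp add: divide_inverse power2_eq_square)
    have 3: "(\<Sum>j<n. D j / (a k + w - a j)) = D k * inverse w + g w"
      unfolding split g_def by (simp add: divide_inverse)
    have 4: "poly S (a k + w) = s w" by (simp add: s_def poly_altdef)
    show ?thesis
      unfolding explicit_R_def 1 2 3 4 by (simp add: power2_eq_square algebra_simps)
  qed
  show ?thesis using expansion unfolding eq .
qed

text \<open>The derivative of P'/P contributes -alpha/2 to the double pole of R and its square
  contributes -alpha^2/4. The sum is (1 - (alpha + 1)^2)/4, which is the origin of m = alpha +
  1.\<close>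

lemma R_fls_nth_low:
  shows "i < -2 \<Longrightarrow> fls_nth (R_fls k S D) i = 0"
    and "fls_nth (R_fls k S D) (-2) = (1 - (of_nat (\<alpha> k + 1))\<^sup>2) / 4"
  by (simp_all add: R_fls_def fls_X_inv_times_conv_shift power2_eq_square algebra_simps diff_divide_distrib
      add_divide_distrib)

text \<open>The coefficient b_j as a function of the coordinates (S, D), for j at least 1. The case
  distinction at 2 keeps the truncated difference j - 2 from reading off a constant term that
  belongs to b_2.\<close>

definition laine_coefficient :: "nat \<Rightarrow> nat \<Rightarrow> (laine_index \<Rightarrow> complex) \<Rightarrow> complex" where
  "laine_coefficient k j x = (if j = 1 then x (Residue k) else 0) - of_nat (\<alpha> k) / 2 * fps_nth (log_fps k) (j - 1)
     + (if j < 2 then 0 else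
         - 1/2 * fps_nth (log_square_fps k) (j - 2) - 1/4 * fps_nth (log_fps k * log_fps k) (j - 2)
         + (\<Sum>i\<le>d. x (Coeff i) * fps_nth ((fps_const (a k) + fps_X) ^ i) (j - 2))
         + (\<Sum>l\<in>{..<n} - {k}. x (Residue l) * fps_nth (pole_fps k l) (j - 2)))"

lemma R_fls_nth:
  assumes "k < n" "j \<ge> 1" "degree S = d"
  shows "fls_nth (R_fls k S D) (int j - 2) = laine_coefficient k j (laine_point d n S D)"
proof -
  have pt: "laine_point d n S D (Coeff i) = coeff S i" if "i \<le> d" for i
    using that by (simp add: laine_point_def laine_indices_def)
  have pt': "laine_point d n S D (Residue l) = D l" if "l < n" for l
    using that by (simp add: laine_point_def laine_indices_def image_iff)
  have idx: "nat (int j - 2) = j - 2" "nat (int j - 1) = j - 1" by auto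
  show ?thesis
    using assms
    by (auto simp: R_fls_def laine_coefficient_def fls_X_inv_times_conv_shift idx pt pt' fps_sum_nth)
qed

definition laine_equation :: "nat \<Rightarrow> (laine_index \<Rightarrow> complex) \<Rightarrow> complex" where
  "laine_equation k x = Determinant.det (laine_matrix (\<alpha> k + 1) (\<lambda>j. laine_coefficient k j x))"

text \<open>The poles of R are exactly the a_k: there the double pole has a nonzero coefficient
  because \<open>\<alpha> k\<close> is positive, and elsewhere R agrees near the point with a
  continuous function.\<close>

lemma laine_condition_iff:
  assumes "\<And>z. poly P z \<noteq> 0 \<Longrightarrow> poly Q z / poly P z = poly S z + (\<Sum>k<n. D k / (z - a k))" "degree S = d"
  shows "laine_condition (two_R P Q) \<longleftrightarrow> (\<forall>k<n. laine_equation k (laine_point d n S D) = 0)"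
proof -
  define R where "R = (\<lambda>z. two_R P Q z / 2)"
  have ev: "eventually (\<lambda>w. R w = explicit_R S D w) (at z)" for z
    using eventually_nonzero[of z] by eventually_elim (simp add: R_def two_R_explicit assms(1))
  have expansion: "(\<lambda>w. R (a k + w)) has_laurent_expansion R_fls k S D" if "k < n" for k
    using explicit_R_expansion[OF that] has_laurent_expansion_cong'[OF ev refl refl] by blast
  have no_pole: "\<not> is_pole R z" if "z \<notin> a ` {..<n}" for z
  proof
    assume "is_pole R z"
    then have "filterlim R at_infinity (at z)" by (simp add: is_pole_def)
    then have "filterlim (explicit_R S D) at_infinity (at z)"
      using filterlim_cong[OF refl refl ev] by blast
    moreover have "isCont (explicit_R S D) z"
      unfolding explicit_R_def using that by (auto intro!: continuous_intros)
    ultimately show False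
      using not_tendsto_and_filterlim_at_infinity[of "at z" "explicit_R S D"] by (auto simp: isCont_def)
  qed
  have pole: "is_pole R (a k)" if "k < n" for k
  proof (rule has_laurent_expansion_imp_is_pole[OF expansion[OF that]])
    have "(of_nat (\<alpha> k + 1))\<^sup>2 \<noteq> (1::complex)"
    proof
      assume "(of_nat (\<alpha> k + 1))\<^sup>2 = (1::complex)"
      then have "(\<alpha> k + 1)\<^sup>2 = 1" by (metis of_nat_1 of_nat_eq_iff of_nat_power)
      then show False using \<alpha>_pos[OF that] by (simp add: power2_eq_square)
    qed
    then have "fls_nth (R_fls k S D) (-2) \<noteq> 0" unfolding R_fls_nth_low(2) by simp
    then show "fls_subdegree (R_fls k S D) < 0"
      using fls_subdegree_leI[of "R_fls k S D" "-2"] by simp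
  qed
  have at: "laine_condition_at R (a k) \<longleftrightarrow> laine_equation k (laine_point d n S D) = 0" if k: "k < n" for k
  proof -
    have det: "Determinant.det (laine_matrix (\<alpha> k + 1) (\<lambda>j. fls_nth (R_fls k S D) (int j - 2)))
        = laine_equation k (laine_point d n S D)"
      unfolding laine_equation_def
      by (intro arg_cong[of _ _ Determinant.det] laine_matrix_cong R_fls_nth k assms(2))
    show ?thesis
    proof
      assume "laine_condition_at R (a k)"
      then obtain F m where F: "(\<lambda>w. R (a k + w)) has_laurent_expansion F"
        "fls_nth F (-2) = (1 - (of_nat m)\<^sup>2) / 4"
        "Determinant.det (laine_matrix m (\<lambda>j. fls_nth F (int j - 2))) = 0"
        unfolding laine_condition_at_def by blast
      have FR: "F = R_fls k S D" by (rule has_laurent_expansion_unique[OF F(1) expansion[OF k]])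
      \<comment> \<open>The coefficient of the double pole fixes the square of m and hence m, so the
        existential quantifier leaves a single determinant.\<close>
      have "(of_nat m)\<^sup>2 = (of_nat (\<alpha> k + 1))\<^sup>2 * (1::complex)"
        using F(2) unfolding FR R_fls_nth_low(2) by simp
      then have "m\<^sup>2 = (\<alpha> k + 1)\<^sup>2" by (metis mult_1_right of_nat_eq_iff of_nat_power)
      then have "m = \<alpha> k + 1" by (simp only: power2_eq_iff_nonneg[OF le0 le0])
      then show "laine_equation k (laine_point d n S D) = 0" using F(3) det unfolding FR by simp
    next
      assume "laine_equation k (laine_point d n S D) = 0"
      then have "Determinant.det (laine_matrix (\<alpha> k + 1) (\<lambda>j. fls_nth (R_fls k S D) (int j - 2))) = 0"
        by (simp only: det)
      moreover have "\<alpha> k + 1 \<ge> 2" using \<alpha>_pos[OF k] by simp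
      ultimately show "laine_condition_at R (a k)"
        unfolding laine_condition_at_def using expansion[OF k] R_fls_nth_low(1)[of _ k S D] R_fls_nth_low(2)[of k S D] by blast
    qed
  qed
  have "laine_condition (two_R P Q) \<longleftrightarrow> (\<forall>z. is_pole R z \<longrightarrow> laine_condition_at R z)"
    by (simp add: laine_condition_def R_def Let_def)
  also have "\<dots> \<longleftrightarrow> (\<forall>k<n. laine_condition_at R (a k))"
  proof (intro iffI allI impI)
    fix z assume *: "\<forall>k<n. laine_condition_at R (a k)" "is_pole R z"
    then obtain k where "k < n" "z = a k" using no_pole[of z] by blast
    then show "laine_condition_at R z" using * by simp
  qed (use pole in simp)
  finally show ?thesis using at by blast
qed

text \<open>The power series involved depend on P alone, so every b_j is affine in (S, D). In b_1
  only the residue at a_k itself occurs.\<close>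

lemma laine_coefficient_degree:
  assumes "k < n"
  shows "laine_coefficient k j \<in> fibre_deg_le (base_indices d) Residue n 1"
    and "laine_coefficient k 1 - coord (Residue k) \<in> polynomial_functions (base_indices d)"
proof -
  define c where "c = - of_nat (\<alpha> k) / 2 * fps_nth (log_fps k) (j - 1)
      + (if j < 2 then 0 else - 1/2 * fps_nth (log_square_fps k) (j - 2)
         - 1/4 * fps_nth (log_fps k * log_fps k) (j - 2))"
  have "laine_coefficient k j
      = const_fun (if j = 1 then 1 else 0) * coord (Residue k) + (const_fun c
        + ((\<Sum>i\<le>d. const_fun (if j < 2 then 0 else fps_nth ((fps_const (a k) + fps_X) ^ i) (j - 2)) * coord (Coeff i))
        + (\<Sum>l\<in>{..<n} - {k}. const_fun (if j < 2 then 0 else fps_nth (pole_fps k l) (j - 2)) * coord (Residue l))))"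
    by (auto simp: fun_eq_iff laine_coefficient_def c_def sum_fun_apply mult.commute)
  also have "\<dots> \<in> fibre_deg_le (base_indices d) Residue n 1"
    using assms
    by (intro fibre_deg_le_add fibre_deg_le_sum fibre_deg_le_const_times fibre_deg_le_coord
        fibre_deg_le_base polyfun_const polyfun_coord)
      (auto simp: base_indices_def)
  finally show "laine_coefficient k j \<in> fibre_deg_le (base_indices d) Residue n 1" .
  have "laine_coefficient k 1 - coord (Residue k) = const_fun (- of_nat (\<alpha> k) / 2 * fps_nth (log_fps k) 0)"
    by (simp add: fun_eq_iff laine_coefficient_def)
  then show "laine_coefficient k 1 - coord (Residue k) \<in> polynomial_functions (base_indices d)"
    by (simp only: polyfun_const)
qed

section \<open>Partial fractions as coordinates\<close>

text \<open>Clearing the denominators with the squarefree product \<open>F\<close> leaves a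
  polynomial with infinitely many zeros. Its value at a_k is c_k times a nonzero number.\<close>

lemma partial_fractions_unique:
  assumes "\<And>z. poly P z \<noteq> 0 \<Longrightarrow> poly T z + (\<Sum>k<n. c k / (z - a k)) = 0"
  shows "T = 0" "\<And>k. k < n \<Longrightarrow> c k = 0"
proof -
  define F where "F = (\<Prod>k<n. [:- a k, 1:])"
  define G where "G k = (\<Prod>j\<in>{..<n} - {k}. [:- a j, 1:])" for k
  define U where "U = T * F + (\<Sum>k<n. Polynomial.smult (c k) (G k))"
  have split: "F = [:- a k, 1:] * G k" if "k < n" for k
    unfolding F_def G_def using that by (intro prod.remove) auto
  have "poly U z = 0" if z: "poly P z \<noteq> 0" for z
  proof -
    have nz: "z - a k \<noteq> 0" if "k < n" for k using z that by (auto simp: P_zero_iff)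
    have "poly (G k) z = poly F z / (z - a k)" if "k < n" for k
    proof -
      have "poly F z = (z - a k) * poly (G k) z"
        using arg_cong[OF split[OF that], of "\<lambda>p. poly p z"] by (simp add: algebra_simps)
      then show ?thesis using nz[OF that] by simp
    qed
    then have "poly U z = poly F z * (poly T z + (\<Sum>k<n. c k / (z - a k)))"
      by (simp add: U_def poly_sum distrib_left sum_distrib_left mult_ac)
    then show ?thesis using assms[OF z] by simp
  qed
  then have "- (a ` {..<n}) \<subseteq> {z. poly U z = 0}" by (auto simp: P_zero_iff)
  moreover have "infinite (- (a ` {..<n}))"
    using finite_compl[of "a ` {..<n}"] infinite_UNIV_char_0[where 'a = complex] by simp
  ultimately have "infinite {z. poly U z = 0}" using infinite_super by blast
  then have U: "U = 0" using poly_roots_finite by blast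
  show c: "c k = 0" if k: "k < n" for k
  proof -
    have "poly (G l) (a k) = 0" if "l < n" "l \<noteq> k" for l
      unfolding G_def poly_prod using that k by (intro prod_zero) (auto intro!: bexI[of _ k])
    then have "(\<Sum>l<n. c l * poly (G l) (a k)) = (\<Sum>l<n. if l = k then c k * poly (G k) (a k) else 0)"
      by (intro sum.cong) auto
    then have "(\<Sum>l<n. c l * poly (G l) (a k)) = c k * poly (G k) (a k)" using k by simp
    moreover have "poly U (a k) = (\<Sum>l<n. c l * poly (G l) (a k))"
      by (simp add: U_def poly_sum split[OF k])
    moreover have "poly (G k) (a k) \<noteq> 0"
      unfolding G_def poly_prod using inj_onD[OF inj_a] k by auto
    ultimately show ?thesis using U by simp
  qed
  have "T * F = 0" using U c by (simp add: U_def)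
  moreover have "F \<noteq> 0" by (auto simp: F_def)
  ultimately show "T = 0" by simp
qed

lemma decomposition_unique:
  assumes "\<And>z. poly P z \<noteq> 0 \<Longrightarrow> poly Q z / poly P z = poly S z + (\<Sum>k<n. D k / (z - a k))"
    "\<And>z. poly P z \<noteq> 0 \<Longrightarrow> poly Q z / poly P z = poly S' z + (\<Sum>k<n. D' k / (z - a k))"
  shows "S = S'" "\<And>k. k < n \<Longrightarrow> D k = D' k"
proof -
  have "poly (S - S') z + (\<Sum>k<n. (D k - D' k) / (z - a k)) = 0" if "poly P z \<noteq> 0" for z
    using assms(1)[OF that] assms(2)[OF that]
    by (simp add: diff_divide_distrib sum_subtractf algebra_simps)
  note * = partial_fractions_unique[OF this]
  show "S = S'" "\<And>k. k < n \<Longrightarrow> D k = D' k" using * by auto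
qed

text \<open>The witness is P S plus the sum of D_k P/(z - a_k); each quotient is a polynomial of
  degree one less than P, so the leading term is that of P S.\<close>

lemma decomposition_exists:
  assumes "of_degree S d"
  obtains Q where "of_degree Q (d + degree P)"
    "\<And>z. poly P z \<noteq> 0 \<Longrightarrow> poly Q z / poly P z = poly S z + (\<Sum>k<n. D k / (z - a k))"
proof -
  have "\<exists>B. P = [:- a k, 1:] * B" if "k < n" for k
    using that P_zero_iff[of "a k"] poly_eq_0_iff_dvd[of P "a k"] by (auto simp: dvd_def)
  then have "\<forall>k\<in>{..<n}. \<exists>B. P = [:- a k, 1:] * B" by blast
  from bchoice[OF this] obtain B where B: "\<And>k. k < n \<Longrightarrow> P = [:- a k, 1:] * B k" by blast
  define Q where "Q = P * S + (\<Sum>k<n. Polynomial.smult (D k) (B k))"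
  have S: "S \<noteq> 0" "degree S = d" using assms by (auto simp: of_degree_def)
  have lead: "degree (P * S) = d + degree P" using S P_nonzero by (simp add: degree_mult_eq)
  have "of_degree Q (d + degree P)"
  \<comment> \<open>Without zeros P is 1 and the sum is empty; its degree 0, which is also the
    degree of P S if d = 0, would spoil the strict comparison of degrees used otherwise.\<close>
  proof (cases "n = 0")
    case True
    then show ?thesis using lead S P_nonzero by (simp add: Q_def of_degree_def)
  next
    case False
    have "degree (B k) + 1 = degree P" if "k < n" for k
    proof -
      have "B k \<noteq> 0" using B[OF that] P_nonzero by auto
      then have "degree ([:- a k, 1:] * B k) = 1 + degree (B k)" by (subst degree_mult_eq) auto
      then show ?thesis using B[OF that] by simp
    qed
    note degB = this
    then have pos: "degree P > 0" using False by (metis add_gr_0 gr0I less_numeral_extra(1))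
    have "degree (\<Sum>k<n. Polynomial.smult (D k) (B k)) \<le> degree P - 1"
    proof (rule degree_sum_le)
      fix k assume "k \<in> {..<n}"
      then show "degree (Polynomial.smult (D k) (B k)) \<le> degree P - 1"
        using degB[of k] degree_smult_le[of "D k" "B k"] by simp
    qed simp
    then have "degree (\<Sum>k<n. Polynomial.smult (D k) (B k)) < degree (P * S)" using pos lead by simp
    then have "degree Q = d + degree P" unfolding Q_def using lead by (simp add: degree_add_eq_left)
    then show ?thesis using pos by (auto simp: of_degree_def)
  qed
  moreover have "poly Q z / poly P z = poly S z + (\<Sum>k<n. D k / (z - a k))" if z: "poly P z \<noteq> 0" for z
  proof -
    have "poly (B k) z / poly P z = 1 / (z - a k)" if "k < n" for k
    proof -
      have "poly P z = (z - a k) * poly (B k) z" using arg_cong[OF B[OF that], of "\<lambda>p. poly p z"] by (simp add: algebra_simps)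
      then show ?thesis using z by auto
    qed
    then have "(\<Sum>k<n. D k * poly (B k) z / poly P z) = (\<Sum>k<n. D k / (z - a k))"
      by (intro sum.cong) (simp_all add: divide_inverse mult.assoc)
    then show ?thesis using z by (simp add: Q_def poly_sum add_divide_distrib sum_divide_distrib)
  qed
  ultimately show ?thesis using that by blast
qed

section \<open>The Laine variety in coordinates\<close>

lemma decompositionD:
  assumes "laine_decomposition n a P (d + degree P) Q S D"
  shows "of_degree S d" "degree S = d"
    "\<And>z. poly P z \<noteq> 0 \<Longrightarrow> poly Q z / poly P z = poly S z + (\<Sum>k<n. D k / (z - a k))"
  using assms by (auto simp: laine_decomposition_def of_degree_def)

lemma laine_point_cong:
  "(\<And>k. k < n \<Longrightarrow> D k = D' k) \<Longrightarrow> laine_point d n S D = laine_point d n S D'"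
  unfolding laine_point_def laine_indices_def by (intro restrict_ext) auto

lemma coordinates_unique:
  assumes "Q \<in> laine_set n a P (d + degree P)"
  shows "\<exists>!x. laine_coordinates n a P (d + degree P) Q x"
proof -
  obtain S D where SD: "laine_decomposition n a P (d + degree P) Q S D"
    using assms by (auto simp: laine_set_def)
  show ?thesis
  proof (rule ex1I)
    show "laine_coordinates n a P (d + degree P) Q (laine_point d n S D)"
      using SD by (auto simp: laine_coordinates_def)
    fix x assume "laine_coordinates n a P (d + degree P) Q x"
    then obtain S' D' where SD': "laine_decomposition n a P (d + degree P) Q S' D'"
      and x: "x = laine_point d n S' D'" by (auto simp: laine_coordinates_def)
    have uniq: "S' = S" "\<And>k. k < n \<Longrightarrow> D' k = D k"
      using decomposition_unique[where Q = Q and S = S' and D = D' and S' = S and D' = D]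
        decompositionD(3)[OF SD'] decompositionD(3)[OF SD] by blast+
    show "x = laine_point d n S D"
      unfolding x uniq(1) by (rule laine_point_cong) (rule uniq(2))
  qed
qed

lemma polynomial_unique:
  assumes "laine_coordinates n a P (d + degree P) Q x" "laine_coordinates n a P (d + degree P) Q' x"
  shows "Q = Q'"
proof -
  obtain S D S' D' where SD: "laine_decomposition n a P (d + degree P) Q S D" "x = laine_point d n S D"
    and SD': "laine_decomposition n a P (d + degree P) Q' S' D'" "x = laine_point d n S' D'"
    using assms by (auto simp: laine_coordinates_def)
  have eq: "laine_point d n S D i = laine_point d n S' D' i" for i using SD(2) SD'(2) by simp
  have "coeff S i = coeff S' i" for i
  proof (cases "i \<le> d")
    case True
    then show ?thesis using eq[of "Coeff i"] by (simp add: laine_point_def laine_indices_def)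
  next
    case False
    then show ?thesis using decompositionD(2)[OF SD(1)] decompositionD(2)[OF SD'(1)] by (simp add: coeff_eq_0)
  qed
  then have S: "S = S'" by (rule poly_eqI)
  have D: "D k = D' k" if "k < n" for k
    using eq[of "Residue k"] that by (simp add: laine_point_def laine_indices_def image_iff)
  have "poly (Q - Q') z = 0" if z: "poly P z \<noteq> 0" for z
  proof -
    have "poly Q z / poly P z = poly Q' z / poly P z"
      using decompositionD(3)[OF SD(1) z] decompositionD(3)[OF SD'(1) z] S D by simp
    then show ?thesis using z by simp
  qed
  then have "(Q - Q') * P = 0" by (intro poly_all_0_iff_0[THEN iffD1]) auto
  then show ?thesis using P_nonzero by simp
qed

lemma laine_point_indices:
  assumes "of_degree S d"
  shows "laine_point d n S D \<in> affine_space (laine_indices d n)"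
    "laine_point d n S D (Coeff d) * laine_point d n S D Lead_Inverse = 1"
proof -
  show "laine_point d n S D \<in> affine_space (laine_indices d n)"
    by (simp add: laine_point_def affine_space_def)
  have "coeff S d \<noteq> 0" using assms by (auto simp: of_degree_def)
  then show "laine_point d n S D (Coeff d) * laine_point d n S D Lead_Inverse = 1"
    by (simp add: laine_point_def laine_indices_def)
qed

lemma laine_variety_eq:
  "laine_variety n a P (d + degree P) = {x \<in> affine_space (laine_indices d n).
     x (Coeff d) * x Lead_Inverse = 1 \<and> (\<forall>k<n. laine_equation k x = 0)}"
proof (intro equalityI subsetI)
  fix x assume "x \<in> laine_variety n a P (d + degree P)"
  then obtain Q S D where "Q \<in> laine_set n a P (d + degree P)"
    and SD: "laine_decomposition n a P (d + degree P) Q S D" and x: "x = laine_point d n S D"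
    by (auto simp: laine_variety_def laine_coordinates_def)
  then have "laine_condition (two_R P Q)" by (simp add: laine_set_def)
  then have "\<forall>k<n. laine_equation k x = 0"
    unfolding x using laine_condition_iff[OF decompositionD(3,2)[OF SD]] by blast
  then show "x \<in> {x \<in> affine_space (laine_indices d n).
     x (Coeff d) * x Lead_Inverse = 1 \<and> (\<forall>k<n. laine_equation k x = 0)}"
    using laine_point_indices[OF decompositionD(1)[OF SD]] x by blast
next
  fix x assume "x \<in> {x \<in> affine_space (laine_indices d n).
     x (Coeff d) * x Lead_Inverse = 1 \<and> (\<forall>k<n. laine_equation k x = 0)}"
  then have x: "x \<in> affine_space (laine_indices d n)" "x (Coeff d) * x Lead_Inverse = 1"
    "\<And>k. k < n \<Longrightarrow> laine_equation k x = 0" by auto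
  define S where "S = (\<Sum>i\<le>d. Polynomial.monom (x (Coeff i)) i)"
  define D where "D k = x (Residue k)" for k
  have coeff: "coeff S i = (if i \<le> d then x (Coeff i) else 0)" for i
    by (simp add: S_def coeff_sum)
  have "x (Coeff d) \<noteq> 0" using x(2) by auto
  then have "degree S = d" by (intro antisym degree_le le_degree) (auto simp: coeff)
  then have S: "of_degree S d" using coeff[of d] \<open>x (Coeff d) \<noteq> 0\<close> by (auto simp: of_degree_def)
  have point: "laine_point d n S D = x"
  proof
    fix i show "laine_point d n S D i = x i"
    proof (cases "i \<in> laine_indices d n")
      case True
      then show ?thesis
        using inverse_unique[OF x(2)] by (auto simp: laine_point_def laine_indices_def coeff D_def)
    next
      case False
      then have "x i = undefined" using x(1) unfolding affine_space_def by (rule PiE_arb[rotated])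
      then show ?thesis using False by (simp add: laine_point_def)
    qed
  qed
  obtain Q where Q: "of_degree Q (d + degree P)"
    "\<And>z. poly P z \<noteq> 0 \<Longrightarrow> poly Q z / poly P z = poly S z + (\<Sum>k<n. D k / (z - a k))"
    using decomposition_exists[OF S] by blast
  have decomposition: "laine_decomposition n a P (d + degree P) Q S D"
    using S Q(2) by (simp add: laine_decomposition_def)
  have "laine_condition (two_R P Q)"
    using laine_condition_iff[OF Q(2) \<open>degree S = d\<close>] x(3) by (simp only: point) blast
  then have "Q \<in> laine_set n a P (d + degree P)"
    using Q(1) decomposition by (auto simp: laine_set_def)
  moreover have "laine_coordinates n a P (d + degree P) Q x"
    using decomposition point by (auto simp: laine_coordinates_def)
  ultimately show "x \<in> laine_variety n a P (d + degree P)" by (auto simp: laine_variety_def)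
qed

lemma laine_variety_dimension:
  defines "V \<equiv> laine_variety n a P (d + degree P)"
  shows "affine_variety (laine_indices d n) V" "has_dimension (laine_indices d n) V (d + 1)"
proof -
  have "\<forall>k\<in>{..<n}. \<exists>\<sigma>. \<sigma> \<noteq> 0 \<and> (\<lambda>x. \<sigma> * laine_equation k x) - coord (Residue k) ^ (\<alpha> k + 1)
      \<in> fibre_deg_le (base_indices d) Residue n (\<alpha> k + 1 - 1)"
    unfolding laine_equation_def
    by (intro ballI laine_det_leading laine_coefficient_degree) auto
  from bchoice[OF this] obtain \<sigma> where \<sigma>: "\<And>k. k < n \<Longrightarrow> \<sigma> k \<noteq> 0"
    "\<And>k. k < n \<Longrightarrow> (\<lambda>x. \<sigma> k * laine_equation k x) - coord (Residue k) ^ (\<alpha> k + 1)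
      \<in> fibre_deg_le (base_indices d) Residue n (\<alpha> k + 1 - 1)" by blast
  \<comment> \<open>Multiplying the equations by the nonzero \<open>\<sigma> k\<close> makes them
    monic and keeps their zeros.\<close>
  interpret cover: finite_cover "base_indices d" Residue n "\<lambda>k. \<alpha> k + 1" "\<lambda>k x. \<sigma> k * laine_equation k x"
  proof
    show "finite (base_indices d)" by (rule finite_base_indices)
    show "inj_on Residue {..<n}" by (simp add: inj_on_def)
    show "Residue ` {..<n} \<inter> base_indices d = {}" by (auto simp: base_indices_def)
    show "1 \<le> \<alpha> k + 1" for k by simp
  qed (rule \<sigma>(2))
  have indices: "cover.indices = laine_indices d n"
    unfolding cover.indices_def by (simp add: base_indices_def laine_indices_def)
  \<comment> \<open>The cover lies over the whole affine space of base coordinates; the variety is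
    its part over the hyperbola, which is also the top \<open>hyp_flag d (d + 1)\<close> of the flag
    to be lifted.\<close>
  have V_eq: "V = {x \<in> cover.cover. x (Coeff d) * x Lead_Inverse = 1}"
    unfolding V_def laine_variety_eq cover.cover_def indices using \<sigma>(1) by auto
  then have V_cover: "V \<subseteq> cover.cover" by blast
  define h where "h = coord (Coeff d) * coord Lead_Inverse - 1"
  have "zariski_closed (laine_indices d n) cover.cover"
    by (rule zariski_closedI[of "(\<lambda>k x. \<sigma> k * laine_equation k x) ` {..<n}"])
      (use cover.equation_total in \<open>auto simp: cover.cover_def indices\<close>)
  then have "zariski_closed (laine_indices d n) {x \<in> cover.cover. h x = 0}"
    unfolding h_def
    by (intro zariski_closed_zeros polyfun_minus polyfun_times
        polyfun_1 polyfun_coord) (auto simp: laine_indices_def)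
  also have "{x \<in> cover.cover. h x = 0} = V" by (auto simp: V_eq h_def)
  finally have V_closed: "zariski_closed (laine_indices d n) V" .
  then show "affine_variety (laine_indices d n) V"
    unfolding affine_variety_def using cover.finite_indices by (simp add: indices)
  have surj: "hyp_flag d (d + 1) \<subseteq> (\<lambda>x. restrict x (base_indices d)) ` V"
  proof
    fix s assume "s \<in> hyp_flag d (d + 1)"
    then have s: "s \<in> affine_space (base_indices d)" "s (Coeff d) * s Lead_Inverse = 1"
      by (auto simp: hyp_flag_def hyperbola_def)
    obtain x where x: "x \<in> cover.cover" "restrict x (base_indices d) = s"
      using cover.fibre_nonempty[OF s(1)] .
    have "s i = x i" if "i \<in> base_indices d" for i
      using that x(2) by auto
    then have "s (Coeff d) = x (Coeff d)" "s Lead_Inverse = x Lead_Inverse" by (auto simp: base_indices_def)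
    then have "x \<in> V" using x(1) s(2) by (simp add: V_eq)
    then show "s \<in> (\<lambda>x. restrict x (base_indices d)) ` V" using x(2) by blast
  qed
  have "\<exists>Z. irreducible_chain (laine_indices d n) V (d + 1) Z"
    using cover.chain_lift[of "d + 1" "hyp_flag d" V]
      irreducible_hyp_flag hyp_flag_strict V_closed V_cover surj
    by (auto simp: indices)
  moreover have "l \<le> d + 1" if chain: "irreducible_chain (laine_indices d n) V l Z" for l Z
  proof (rule cover.chain_length_le[where G = "hyp_monomials d" and C = 2])
    have hyp: "x (Coeff d) * x Lead_Inverse = 1" if "x \<in> V" for x using that by (simp add: V_eq)
    show "irreducible_chain cover.indices V l Z" using chain by (simp only: indices)
    show "V \<subseteq> cover.cover" by (rule V_cover)
    show "finite (hyp_monomials d N)" for N by (rule finite_hyp_monomials)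
    show "card (hyp_monomials d N) \<le> 2 * (N + 1) ^ (d + 1)" for N by (rule card_hyp_monomials)
    show "hyp_monomials d N \<subseteq> cover.total_funs" for N
      using hyp_monomials_polynomial cover.base_subset by blast
    show "hyp_monomials d N \<subseteq> hyp_monomials d N'" if "N \<le> N'" for N N'
      using that by (rule hyp_monomials_mono)
    have "(\<Prod>j<d. coord (Coeff j) ^ 0) * coord (Coeff d) ^ 0 \<in> hyp_monomials d 0"
      by (intro hyp_monomialsI) auto
    then show "1 \<in> hyp_monomials d 0" by (simp only: power_0 prod.neutral_const mult_1_left)
    show "\<exists>N. g \<in> cspan_mod (hyp_monomials d N) (vanishing V)"
      if "g \<in> polynomial_functions (base_indices d)" for g
      by (rule hyp_monomials_span[OF hyp that])
    show "g * g' \<in> cspan_mod (hyp_monomials d (N + N')) (vanishing V)"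
      if "g \<in> hyp_monomials d N" "g' \<in> hyp_monomials d N'" for N N' g g'
      by (rule hyp_monomials_times[OF hyp that])
  qed
  ultimately show "has_dimension (laine_indices d n) V (d + 1)"
    unfolding has_dimension_def by blast
qed

end

theorem theorem4p3:
  fixes n p q :: nat and a :: "nat \<Rightarrow> complex" and \<alpha> :: "nat \<Rightarrow> nat" and P :: "complex poly"
  assumes "inj_on a {..<n}"
    and "\<And>k. k < n \<Longrightarrow> \<alpha> k \<ge> 1"
    and "P = (\<Prod>k<n. [:- a k, 1:] ^ \<alpha> k)"
    and "degree P = p"
    and "q \<ge> p"
  shows "(\<forall>Q \<in> laine_set n a P q. \<exists>!x. laine_coordinates n a P q Q x)
    \<and> (\<forall>x \<in> laine_variety n a P q. \<exists>!Q. Q \<in> laine_set n a P q \<and> laine_coordinates n a P q Q x)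
    \<and> affine_variety (laine_indices (q - p) n) (laine_variety n a P q)
    \<and> has_dimension (laine_indices (q - p) n) (laine_variety n a P q) (q - p + 1)"
proof -
  interpret laine_setup n "q - p" a \<alpha> P
    by unfold_locales (use assms in auto)
  have q: "q - p + degree P = q" using assms by simp
  have "\<exists>!Q. Q \<in> laine_set n a P q \<and> laine_coordinates n a P q Q x" if "x \<in> laine_variety n a P q" for x
    using that polynomial_unique[unfolded q] unfolding laine_variety_def by blast
  then show ?thesis
    using coordinates_unique[unfolded q] laine_variety_dimension[unfolded q] by blast
qed

end
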